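(* For the billiard in the square $S=[-1/2,1/2]^2$ with one small obstacle $O$, the rotation set $R$ is equal to the interval $[-\sqrt{2}/4,\sqrt{2}/4]$.
   Context: Setting: $O\subset S$ is a compact convex set with nonempty interior and smooth boundary. It is small if it is contained in a closed ball of radius smaller than $\sqrt{2}/4$ centered at the origin. Billiard trajectories in $S\setminus\operatorname{int}O$ move with unit speed along straight lines and reflect from the sides of $S$ and from $\partial O$ with angle of incidence equal to angle of reflection (a trajectory tangent to $O$ continues straight); a trajectory reaching a vertex of $S$ returns along the same line. Time along a trajectory piece equals its length. Displacement: fix a point $\mathbf{z}$ in the interior of $O$ and set $\phi(\mathbf{x})=\arg(\mathbf{x}-\mathbf{z})/(2\pi)$, identifying $\mathbb{R}^2$ with $\mathbb{C}$; the displacement along a trajectory piece in $S$ is the (continuous) increment of $\phi$ along it. The rotation set $R$ is the set of all limits of sequences $d_n/t_n$, where $d_n$ and $t_n$ are the displacement and the length of a billiard trajectory piece, and $t_n\to\infty$ (it does not depend on the choice of $\mathbf{z}$). *)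

theory Defs
  imports "HOL-Analysis.Analysis"
begin

text \<open>The plane is identified with the complex numbers throughout.\<close>

definition square :: "complex set" where
  "square = {x. \<bar>Re x\<bar> \<le> 1/2 \<and> \<bar>Im x\<bar> \<le> 1/2}"

text \<open>Infinite differentiability of a curve on an open set of parameters; \<open>D n\<close> is its
  \<open>n\<close>-th derivative there.\<close>

definition smooth_curve_on :: "real set \<Rightarrow> (real \<Rightarrow> complex) \<Rightarrow> bool" where
  "smooth_curve_on I c \<longleftrightarrow>
     (\<exists>D :: nat \<Rightarrow> real \<Rightarrow> complex.
        (\<forall>t\<in>I. D 0 t = c t) \<and>
        (\<forall>n. \<forall>t\<in>I. (D n has_vector_derivative D (Suc n) t) (at t)))"

text \<open>The boundary is a one-dimensional embedded \<open>C\<^sup>\<infinity>\<close> submanifold of the plane: near each of its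
  points it is the homeomorphic image of an open interval under a smooth regular curve.\<close>

definition smooth_boundary :: "complex set \<Rightarrow> bool" where
  "smooth_boundary K \<longleftrightarrow>
     (\<forall>p\<in>frontier K. \<exists>U c g. open U \<and> p \<in> U \<and>
        homeomorphism {-1<..<1} (U \<inter> frontier K) c g \<and>
        smooth_curve_on {-1<..<1} c \<and>
        (\<forall>t\<in>{-1<..<1}. vector_derivative c (at t) \<noteq> 0))"

definition obstacle :: "complex set \<Rightarrow> bool" where
  "obstacle K \<longleftrightarrow> K \<subseteq> square \<and> compact K \<and> convex K \<and> interior K \<noteq> {} \<and> smooth_boundary K"

definition small :: "complex set \<Rightarrow> bool" where
  "small K \<longleftrightarrow> (\<exists>r < sqrt 2 / 4. K \<subseteq> cball 0 r)"

text \<open>Outward unit normals of a convex set at a boundary point.  When the boundary is smooth there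
  is exactly one, and it is orthogonal to the tangent line of the boundary.\<close>

definition outer_unit_normal :: "complex set \<Rightarrow> complex \<Rightarrow> complex \<Rightarrow> bool" where
  "outer_unit_normal K x n \<longleftrightarrow> norm n = 1 \<and> (\<forall>y\<in>K. (y - x) \<bullet> n \<le> 0)"

text \<open>\<open>billiard_law K x v w\<close>: a trajectory arriving at \<open>x\<close> with velocity \<open>v\<close> leaves it with
  velocity \<open>w\<close>.  The maps \<open>v \<mapsto> - cnj v\<close> and \<open>v \<mapsto> cnj v\<close> are the
  reflections in vertical and horizontal lines.  If \<open>v\<close> is tangent to the boundary at \<open>x\<close>, the
  reflection formulas give \<open>w = v\<close>.\<close>

definition billiard_law :: "complex set \<Rightarrow> complex \<Rightarrow> complex \<Rightarrow> complex \<Rightarrow> bool" where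
  "billiard_law K x v w \<longleftrightarrow>
     (if \<bar>Re x\<bar> = 1/2 \<and> \<bar>Im x\<bar> = 1/2 then w = - v
      else if \<bar>Re x\<bar> = 1/2 then w = - cnj v
      else if \<bar>Im x\<bar> = 1/2 then w = cnj v
      else if x \<in> frontier K
        then \<exists>n. outer_unit_normal K x n \<and> w = v - (2 * (v \<bullet> n)) *\<^sub>R n
      else w = v)"

text \<open>A trajectory piece of length \<open>T\<close>, parametrised by time in \<open>{0..T}\<close>: a polygonal path of unit
  speed with velocity \<open>v i\<close> between the times \<open>\<tau> i\<close> and \<open>\<tau> (Suc i)\<close>.  Inside such
  a time interval the path can meet a side or the obstacle only tangentially, because it does not
  leave \<open>square - interior K\<close>.\<close>

definition trajectory_piece :: "complex set \<Rightarrow> real \<Rightarrow> (real \<Rightarrow> complex) \<Rightarrow> bool" where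
  "trajectory_piece K T \<gamma> \<longleftrightarrow>
     (\<forall>t\<in>{0..T}. \<gamma> t \<in> square - interior K) \<and>
     (\<exists>(m::nat) (\<tau> :: nat \<Rightarrow> real) (v :: nat \<Rightarrow> complex).
        \<tau> 0 = 0 \<and> \<tau> m = T \<and>
        (\<forall>i<m. \<tau> i < \<tau> (Suc i) \<and> norm (v i) = 1 \<and>
           (\<forall>t\<in>{\<tau> i..\<tau> (Suc i)}. \<gamma> t = \<gamma> (\<tau> i) + (t - \<tau> i) *\<^sub>R v i)) \<and>
        (\<forall>i. Suc i < m \<longrightarrow> billiard_law K (\<gamma> (\<tau> (Suc i))) (v i) (v (Suc i))))"

definition phi :: "complex \<Rightarrow> complex \<Rightarrow> real" where
  "phi z x = Arg (x - z) / (2 * pi)"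

text \<open>Since \<open>phi z\<close> is only meaningful modulo 1, its increment along a path is that of a continuous
  lift \<open>\<theta>\<close>.\<close>

definition has_displacement :: "complex \<Rightarrow> real \<Rightarrow> (real \<Rightarrow> complex) \<Rightarrow> real \<Rightarrow> bool" where
  "has_displacement z T \<gamma> d \<longleftrightarrow>
     (\<exists>\<theta> :: real \<Rightarrow> real. continuous_on {0..T} \<theta> \<and>
        (\<forall>t\<in>{0..T}. \<theta> t - phi z (\<gamma> t) \<in> \<int>) \<and> d = \<theta> T - \<theta> 0)"

definition rotation_set :: "complex set \<Rightarrow> complex \<Rightarrow> real set" where
  "rotation_set K z =
     {\<rho>. \<exists>(T :: nat \<Rightarrow> real) (\<gamma> :: nat \<Rightarrow> real \<Rightarrow> complex) (d :: nat \<Rightarrow> real).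
        (\<forall>n. trajectory_piece K (T n) (\<gamma> n) \<and> has_displacement z (T n) (\<gamma> n) (d n)) \<and>
        filterlim T at_top sequentially \<and> (\<lambda>n. d n / T n) \<longlonglongrightarrow> \<rho>}"

end

theory Submission
  imports Defs
begin

text \<open>The upper bound for the rates and the realization of every rate below it are independent of each
other.

Upper bound. From the four extreme points of the obstacle draw the horizontal and vertical rays to
the sides of the square. They divide the table into four corner regions, and up to a bounded error
four times the displacement counts the crossings of these rays with sign. Let \<open>m = \<plusminus> 1/2\<close> say
whether a point is right or left of the obstacle, and \<open>n = \<plusminus> 1/2\<close> whether it is above or below.
While the velocity keeps the signs \<open>p\<close>, \<open>q\<close> of its coordinates, every crossing raises
\<open>p m + q n\<close> by one, so that four times the displacement grows at most by the length of the piece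
in the \<open>\<ell>\<^sup>1\<close> norm plus the increment of the potential \<open>p (m - x) + q (n - y)\<close>. The potential does not
decrease at a reflection: at a side the term whose sign changes vanishes, and at the obstacle the
normal decides the region, because the rays start at extreme points, while \<open>\<bar>x\<bar>, \<bar>y\<bar> < 1/2\<close>. Hence
\<open>4 \<bar>d\<bar>\<close> is at most the \<open>\<ell>\<^sup>1\<close> length plus a constant, and the \<open>\<ell>\<^sup>1\<close> length is at most
\<open>sqrt 2\<close> times the length (\<open>displacement_bound\<close>).

Realization. Trajectories that start at the midpoint of the bottom side in the two diagonal
directions run along the inscribed diamond, which the small obstacle does not meet, and in time
\<open>2 sqrt 2 N\<close> they have displacement \<open>N\<close> and \<open>- N\<close>. When the initial direction turns from one
diagonal to the other, the displacement over this time changes continuously and takes every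
value in between (\<open>every_rate_realized\<close>). Bounce times jump at a trajectory that grazes
the obstacle, so continuity has another source: in the plane unfolded by
reflections in the sides, the relation between the states at the times \<open>0\<close> and \<open>h\<close> is closed
and determines the position at time \<open>h\<close> uniquely, and a bounded relation with these properties is
continuous (\<open>continuous_on_position\<close>). The displacement depends only on the positions at the multiples
of a small \<open>h\<close>.\<close>

section \<open>Convex bodies with unique normals\<close>

text \<open>The only use of smoothness: a height function over a supporting line is maximal at the contact point,
so every normal there is orthogonal to the tangent of the boundary curve, and two opposite
normals would squeeze the body into a line.\<close>

lemma obstacle_normal_unique:
  assumes K: "obstacle K" and p: "p \<in> K"
    and n: "outer_unit_normal K p n" and n': "outer_unit_normal K p n'"
  shows "n = n'"
proof -
  have cl: "closed K" and ne: "interior K \<noteq> {}"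
    using K by (auto simp: obstacle_def compact_imp_closed)
  have pint: "p \<notin> interior K"
  proof
    assume "p \<in> interior K"
    then obtain e where e: "e > 0" "cball p e \<subseteq> K"
      by (meson mem_interior_cball)
    have "p + e *\<^sub>R n \<in> K"
      using e n by (intro subsetD[OF e(2)]) (auto simp: dist_norm outer_unit_normal_def)
    then have "e * (n \<bullet> n) \<le> 0"
      using n by (force simp: outer_unit_normal_def)
    moreover have "n \<bullet> n = 1"
      using n by (simp add: outer_unit_normal_def dot_square_norm)
    ultimately show False using e by simp
  qed
  then have "p \<in> frontier K"
    using p cl by (simp add: frontier_def)
  then obtain U c g where U: "open U" "p \<in> U"
    and hom: "homeomorphism {-1<..<1} (U \<inter> frontier K) c g"
    and sm: "smooth_curve_on {-1<..<1} c"
    and nz: "\<forall>t\<in>{-1<..<1}. vector_derivative c (at t) \<noteq> 0"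
    using K unfolding obstacle_def smooth_boundary_def by blast
  define t where "t = g p"
  have t: "t \<in> {-1<..<1}" and ct: "c t = p"
    using hom \<open>p \<in> frontier K\<close> U(2) unfolding t_def homeomorphism_def by auto
  obtain D where D0: "\<And>s. s \<in> {-1<..<1} \<Longrightarrow> D (0::nat) s = c s"
    and DS: "\<And>k s. s \<in> {-1<..<1} \<Longrightarrow> (D k has_vector_derivative D (Suc k) s) (at s)"
    using sm unfolding smooth_curve_on_def by metis
  have der: "(c has_vector_derivative D 1 t) (at t)"
    using has_vector_derivative_transform_within_open[of "D 0" "D 1 t" t "{-1<..<1}" c] DS[of t 0] D0 t
    by simp
  define u where "u = D 1 t"
  have u0: "u \<noteq> 0"
    using nz t vector_derivative_at[OF der] by (auto simp: u_def)
  have orth: "k \<bullet> u = 0" if k: "outer_unit_normal K p k" for k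
  proof -
    have "((\<lambda>s. k \<bullet> (c s - p)) has_real_derivative (k \<bullet> u)) (at t)"
      using der unfolding u_def has_field_derivative_def has_vector_derivative_def
      by (auto intro!: derivative_eq_intros simp: algebra_simps)
    moreover have "k \<bullet> (c s - p) \<le> k \<bullet> (c t - p)" if "\<bar>t - s\<bar> < min (1 - t) (t + 1)" for s
    proof -
      have "s \<in> {-1<..<1}" using that by auto
      then have "c s \<in> frontier K" using hom by (auto simp: homeomorphism_def)
      then have "c s \<in> K" using cl frontier_subset_closed by blast
      then show ?thesis
        using k ct by (auto simp: outer_unit_normal_def inner_commute)
    qed
    ultimately show ?thesis
      using DERIV_local_max[of "\<lambda>s. k \<bullet> (c s - p)" "k \<bullet> u" t "min (1 - t) (t + 1)"] t by auto
  qed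
  have nu: "n \<bullet> u = 0" "n' \<bullet> u = 0" using orth n n' by auto
  have nn: "norm n = 1" "norm n' = 1" using n n' by (auto simp: outer_unit_normal_def)
  have "n = n' \<or> n = - n'"
  proof -
    have eq: "Re n * Re u + Im n * Im u = 0" "Re n' * Re u + Im n' * Im u = 0"
      using nu by (auto simp: inner_complex_def)
    have one: "(Re n)\<^sup>2 + (Im n)\<^sup>2 = 1" "(Re n')\<^sup>2 + (Im n')\<^sup>2 = 1"
      using nn by (auto simp: cmod_def)
    have "(Re n * Im n' - Im n * Re n') * Re u = 0" "(Re n * Im n' - Im n * Re n') * Im u = 0"
      using eq by algebra+
    then have cr: "Re n * Im n' - Im n * Re n' = 0"
      using u0 by (auto simp: complex_eq_iff)
    define d where "d = Re n * Re n' + Im n * Im n'"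
    have "d\<^sup>2 = 1" using cr one unfolding d_def by algebra
    moreover have "Re n = d * Re n'" "Im n = d * Im n'"
      using cr one unfolding d_def by algebra+
    ultimately show ?thesis
      by (auto simp: power2_eq_1_iff complex_eq_iff)
  qed
  moreover have "n \<noteq> - n'"
  proof
    assume eq: "n = - n'"
    obtain q e where q: "q \<in> interior K" and e: "e > 0" "cball q e \<subseteq> K"
      using ne by (meson ex_in_conv mem_interior_cball)
    have "q \<in> K" "q + e *\<^sub>R n \<in> K"
      using e nn by (auto simp: subset_iff dist_norm)
    then have "(q + e *\<^sub>R n - p) \<bullet> n \<le> 0" "(q - p) \<bullet> n' \<le> 0"
      using n n' by (auto simp: outer_unit_normal_def)
    then have "e * (n \<bullet> n) \<le> 0"
      using eq by (auto simp: algebra_simps)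
    then show False using e nn by (simp add: dot_square_norm)
  qed
  ultimately show ?thesis by simp
qed

text \<open>Of smoothness only the uniqueness of normals is kept.\<close>

locale smooth_body =
  fixes K :: "complex set"
  assumes compact: "compact K" and convex: "convex K" and interior_nonempty: "interior K \<noteq> {}"
    and normal_unique: "\<And>x n n'. x \<in> K \<Longrightarrow> outer_unit_normal K x n \<Longrightarrow> outer_unit_normal K x n' \<Longrightarrow> n = n'"
begin

lemma closed: "closed K"
  by (simp add: compact compact_imp_closed)

lemma frontier_iff: "x \<in> frontier K \<longleftrightarrow> x \<in> K \<and> x \<notin> interior K"
  using closed by (simp add: frontier_def)

lemma interior_below:
  assumes y: "y \<in> interior K" and n: "outer_unit_normal K x n"
  shows "(y - x) \<bullet> n < 0"
proof -
  obtain e where e: "e > 0" "cball y e \<subseteq> K" using y by (meson mem_interior_cball)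
  have nn: "n \<bullet> n = 1" using n by (simp add: outer_unit_normal_def dot_square_norm)
  have "y + e *\<^sub>R n \<in> K"
    using e n by (intro subsetD[OF e(2)]) (auto simp: dist_norm outer_unit_normal_def)
  then have "(y + e *\<^sub>R n - x) \<bullet> n \<le> 0"
    using n by (auto simp: outer_unit_normal_def)
  then have "(y - x) \<bullet> n + e * 1 \<le> 0"
    by (simp add: nn[symmetric] algebra_simps)
  then show ?thesis using e by simp
qed

lemma separating_normal:
  assumes T: "convex T" "T \<noteq> {}" "interior K \<inter> T = {}"
  obtains n b where "norm n = 1" "\<And>y. y \<in> K \<Longrightarrow> n \<bullet> y \<le> b" "\<And>y. y \<in> T \<Longrightarrow> n \<bullet> y \<ge> b"
proof -
  obtain a b where a: "a \<noteq> 0" "\<forall>x\<in>interior K. inner a x \<le> b" "\<forall>x\<in>T. inner a x \<ge> b"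
    using separating_hyperplane_sets[of "interior K" T] T convex interior_nonempty
    by (auto simp: convex_interior)
  have "K \<subseteq> {x. a \<bullet> x \<le> b}"
  proof -
    have "closure (interior K) \<subseteq> {x. a \<bullet> x \<le> b}"
      using a by (intro closure_minimal) (auto simp: closed_halfspace_le)
    then show ?thesis
      using convex_closure_interior[OF convex interior_nonempty] closed by (simp add: closure_closed)
  qed
  then show ?thesis
    using a that[of "a /\<^sub>R norm a" "b / norm a"]
    by (auto simp: divide_simps subset_iff)
qed

lemma normal_exists:
  assumes "x \<in> frontier K" obtains n where "outer_unit_normal K x n"
proof -
  obtain n b where n: "norm n = 1" "\<And>y. y \<in> K \<Longrightarrow> n \<bullet> y \<le> b" "n \<bullet> x \<ge> b"
    using separating_normal[of "{x}"] assms by (auto simp: frontier_iff)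
  have "outer_unit_normal K x n"
    unfolding outer_unit_normal_def using n by (force simp: inner_commute[of _ n] algebra_simps)
  then show ?thesis by (rule that)
qed

text \<open>Uniqueness of the normal is what forces a ray that points below the supporting line into the
  interior: otherwise a line separating the ray from the body would be a second supporting line.\<close>

lemma ray_enters_interior:
  assumes x: "x \<in> K" and n: "outer_unit_normal K x n" and vn: "v \<bullet> n < 0"
  shows "\<exists>e>0. \<forall>s. 0 < s \<and> s \<le> e \<longrightarrow> x + s *\<^sub>R v \<in> interior K"
proof -
  have "\<exists>s>0. x + s *\<^sub>R v \<in> interior K"
  proof (rule ccontr)
    assume con: "\<not> ?thesis"
    define T where "T = (\<lambda>s. x + s *\<^sub>R v) ` {0<..}"
    have "convex T"
    proof -
      have "T = (\<lambda>y. x + y) ` ((\<lambda>s. s *\<^sub>R v) ` {0<..})" by (auto simp: T_def)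
      moreover have "convex ((\<lambda>s. s *\<^sub>R v) ` {0::real<..})"
        by (intro convex_linear_image convex_real_interval)
           (auto intro!: linearI simp: algebra_simps)
      ultimately show ?thesis by (simp add: convex_translation)
    qed
    then obtain k b where k: "norm k = 1" "\<And>y. y \<in> K \<Longrightarrow> k \<bullet> y \<le> b" "\<And>y. y \<in> T \<Longrightarrow> k \<bullet> y \<ge> b"
      using separating_normal[of T] con by (auto simp: T_def)
    have up: "k \<bullet> x + s * (k \<bullet> v) \<ge> b" if "s > 0" for s
      using k(3)[of "x + s *\<^sub>R v"] that by (auto simp: T_def inner_right_distrib)
    have "k \<bullet> x \<ge> b"
    proof (rule ccontr)
      assume "\<not> ?thesis"
      then have d: "b - k \<bullet> x > 0" by simp
      have kv: "k \<bullet> v > 0" using up[of 1] d by simp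
      show False using up[of "(b - k \<bullet> x) / (2 * (k \<bullet> v))"] d kv by (simp add: field_simps)
    qed
    then have b: "b = k \<bullet> x" using k(2)[OF x] by simp
    have "outer_unit_normal K x k"
      unfolding outer_unit_normal_def using k b by (force simp: inner_commute[of _ k] algebra_simps)
    then have "k = n" using normal_unique x n by blast
    then show False using up[of 1] b vn by (simp add: inner_commute)
  qed
  then obtain e where e: "e > 0" "x + e *\<^sub>R v \<in> interior K" by auto
  have "x + s *\<^sub>R v \<in> interior K" if "0 < s" "s \<le> e" for s
  proof -
    have "x - (s/e) *\<^sub>R (x - (x + e *\<^sub>R v)) \<in> interior K"
      using that e x closure_subset by (intro mem_interior_closure_convex_shrink convex) auto
    then show ?thesis using e by simp
  qed
  then show ?thesis using e by blast
qed

lemma free_direction_outward: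
  assumes x: "x \<in> K" and n: "outer_unit_normal K x n" and d: "d > 0"
    and out: "\<And>s. 0 \<le> s \<Longrightarrow> s \<le> d \<Longrightarrow> x + s *\<^sub>R v \<notin> interior K"
  shows "v \<bullet> n \<ge> 0"
proof (rule ccontr)
  assume "\<not> ?thesis"
  then obtain e where e: "e > 0" "\<And>s. 0 < s \<and> s \<le> e \<Longrightarrow> x + s *\<^sub>R v \<in> interior K"
    using ray_enters_interior[OF x n, of v] by auto
  show False using e(2)[of "min d e"] out[of "min d e"] e(1) d by auto
qed

end

locale small_body = smooth_body +
  assumes small: "x \<in> K \<Longrightarrow> norm x < sqrt 2 / 4"

lemma small_body_obstacle:
  assumes "obstacle K" "small K" shows "small_body K"
proof
  show "compact K" "convex K" "interior K \<noteq> {}" using assms by (auto simp: obstacle_def)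
  show "\<And>x n n'. x \<in> K \<Longrightarrow> outer_unit_normal K x n \<Longrightarrow> outer_unit_normal K x n' \<Longrightarrow> n = n'"
    using obstacle_normal_unique assms by blast
  show "\<And>x. x \<in> K \<Longrightarrow> norm x < sqrt 2 / 4"
    using assms(2) by (force simp: small_def)
qed

lemma (in small_body) coordinates_small:
  assumes "x \<in> K" shows "\<bar>Re x\<bar> < 2/5" "\<bar>Im x\<bar> < 2/5"
proof -
  have "sqrt 2 < 8/5" by (rule real_less_lsqrt) (auto simp: power2_eq_square)
  then have "norm x < 2/5" using small[OF assms] by simp
  then show "\<bar>Re x\<bar> < 2/5" "\<bar>Im x\<bar> < 2/5"
    using abs_Re_le_cmod[of x] abs_Im_le_cmod[of x] by auto
qed

section \<open>Displacement and its centre\<close>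

lemma Arg_quotient_Ints:
  assumes "a \<noteq> 0" "b \<noteq> 0"
  shows "(Arg a + Arg (b / a) - Arg b) / (2 * pi) \<in> \<int>"
proof -
  have "Arg a + Arg (b / a) - Arg b \<in> {0, 2 * pi, - 2 * pi}"
    using Arg_divide'[of b a] assms by auto
  then show ?thesis by auto
qed

lemma divide_nonpos_Reals_iff:
  fixes x :: complex
  assumes "y \<noteq> 0" "x \<noteq> 0"
  shows "x / y \<in> \<real>\<^sub>\<le>\<^sub>0 \<longleftrightarrow> (\<exists>c>0. x = - c *\<^sub>R y)"
proof
  assume "x / y \<in> \<real>\<^sub>\<le>\<^sub>0"
  then obtain r where r: "r \<le> 0" "x / y = of_real r" by (auto elim: nonpos_Reals_cases)
  have "x = r *\<^sub>R y" using r assms by (simp add: field_simps scaleR_conv_of_real)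
  then show "\<exists>c>0. x = - c *\<^sub>R y" using r assms by (intro exI[of _ "- r"]) (auto simp: less_le)
next
  assume "\<exists>c>0. x = - c *\<^sub>R y"
  then show "x / y \<in> \<real>\<^sub>\<le>\<^sub>0" using assms by (auto simp: scaleR_conv_of_real complex_nonpos_Reals_iff)
qed

lemma phi_quotient_Ints:
  assumes "x \<noteq> z" "y \<noteq> z"
  shows "phi z x + Arg ((y - z) / (x - z)) / (2 * pi) - phi z y \<in> \<int>"
  using Arg_quotient_Ints[of "x - z" "y - z"] assms
  by (simp add: phi_def add_divide_distrib diff_divide_distrib)

lemma trajectory_piece_continuous:
  assumes "trajectory_piece K T \<gamma>" shows "continuous_on {0..T} \<gamma>"
proof -
  obtain m \<tau> v where 0: "\<tau> 0 = 0" and m: "\<tau> m = T"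
    and p: "\<And>i. i < m \<Longrightarrow> \<tau> i < \<tau> (Suc i) \<and> norm (v i) = 1 \<and>
           (\<forall>t\<in>{\<tau> i..\<tau> (Suc i)}. \<gamma> t = \<gamma> (\<tau> i) + (t - \<tau> i) *\<^sub>R v i)"
    using assms unfolding trajectory_piece_def by metis
  have "k \<le> m \<Longrightarrow> continuous_on {0..\<tau> k} \<gamma> \<and> 0 \<le> \<tau> k" for k
  proof (induction k)
    case 0 then show ?case using \<open>\<tau> 0 = 0\<close> by simp
  next
    case (Suc k)
    then have k: "k < m" by simp
    have "continuous_on {\<tau> k..\<tau> (Suc k)} (\<lambda>t. \<gamma> (\<tau> k) + (t - \<tau> k) *\<^sub>R v k)"
      by (intro continuous_intros)
    then have "continuous_on {\<tau> k..\<tau> (Suc k)} \<gamma>"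
      by (rule continuous_on_eq) (use p[OF k] in metis)
    then have "continuous_on ({0..\<tau> k} \<union> {\<tau> k..\<tau> (Suc k)}) \<gamma>"
      using Suc k by (intro continuous_on_closed_Un) auto
    moreover have "{0..\<tau> k} \<union> {\<tau> k..\<tau> (Suc k)} = {0..\<tau> (Suc k)}"
      using Suc k p[OF k] by auto
    ultimately show ?case using Suc k p[OF k] by auto
  qed
  then show ?thesis using m by auto
qed

lemma trajectory_pieceD:
  assumes "trajectory_piece K T \<gamma>" "0 \<le> t" "t \<le> T"
  shows "\<gamma> t \<in> square" "\<gamma> t \<notin> interior K"
  using assms by (auto simp: trajectory_piece_def)

text \<open>Two points of a convex body are seen from outside the body under an angle less than \<open>\<pi>\<close>,
  so the choice of the centre changes a displacement by at most 1.\<close>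

lemma (in smooth_body) displacement_change_centre:
  assumes z: "z \<in> interior K" and z': "z' \<in> interior K"
    and cont: "continuous_on {0..T} \<gamma>" and out: "\<And>t. t \<in> {0..T} \<Longrightarrow> \<gamma> t \<notin> interior K"
    and T: "0 \<le> T" and d: "has_displacement z T \<gamma> d"
  obtains d' where "has_displacement z' T \<gamma> d'" "\<bar>d' - d\<bar> \<le> 1"
proof -
  obtain \<theta> where th: "continuous_on {0..T} \<theta>" "\<And>t. t \<in> {0..T} \<Longrightarrow> \<theta> t - phi z (\<gamma> t) \<in> \<int>"
    "d = \<theta> T - \<theta> 0"
    using d by (auto simp: has_displacement_def)
  have nz: "\<gamma> t \<noteq> z" "\<gamma> t \<noteq> z'" if "t \<in> {0..T}" for t using out[OF that] z z' by auto
  define q where "q t = (\<gamma> t - z') / (\<gamma> t - z)" for t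
  have q: "q t \<notin> \<real>\<^sub>\<le>\<^sub>0" if t: "t \<in> {0..T}" for t
  proof
    assume "q t \<in> \<real>\<^sub>\<le>\<^sub>0"
    then obtain c where c: "c > 0" "\<gamma> t - z' = - c *\<^sub>R (\<gamma> t - z)"
      using divide_nonpos_Reals_iff[of "\<gamma> t - z" "\<gamma> t - z'"] nz[OF t] by (auto simp: q_def)
    have "(1 + c) *\<^sub>R \<gamma> t = z' + c *\<^sub>R z"
      using c(2) by (simp add: algebra_simps)
    then have "\<gamma> t = (1/(1 + c)) *\<^sub>R (z' + c *\<^sub>R z)"
      using c(1) by (metis add_pos_pos less_irrefl scaleR_one scaleR_scaleR zero_less_one nonzero_eq_divide_eq)
    also have "\<dots> = (1/(1 + c)) *\<^sub>R z' + (c/(1 + c)) *\<^sub>R z"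
      by (simp add: scaleR_add_right)
    also have "\<dots> \<in> interior K"
      using c by (intro convexD convex_interior convex z z') (auto simp: field_simps)
    finally show False using out[OF t] by simp
  qed
  define \<theta>' where "\<theta>' t = \<theta> t + Arg (q t) / (2 * pi)" for t
  have "continuous_on {0..T} \<theta>'"
    unfolding \<theta>'_def q_def using q nz
    by (intro continuous_intros th cont continuous_on_Arg') (auto simp: q_def)
  moreover have "\<theta>' t - phi z' (\<gamma> t) \<in> \<int>" if t: "t \<in> {0..T}" for t
  proof -
    have "(Arg (\<gamma> t - z) + Arg (q t) - Arg (\<gamma> t - z')) / (2*pi) \<in> \<int>"
      unfolding q_def using nz[OF t] by (intro Arg_quotient_Ints) auto
    with th(2)[OF t] have "(\<theta> t - phi z (\<gamma> t)) + (Arg (\<gamma> t - z) + Arg (q t) - Arg (\<gamma> t - z')) / (2*pi) \<in> \<int>"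
      by (rule Ints_add)
    moreover have "(\<theta> t - phi z (\<gamma> t)) + (Arg (\<gamma> t - z) + Arg (q t) - Arg (\<gamma> t - z')) / (2*pi)
        = \<theta>' t - phi z' (\<gamma> t)"
      by (simp add: \<theta>'_def phi_def add_divide_distrib diff_divide_distrib)
    ultimately show ?thesis by simp
  qed
  ultimately have "has_displacement z' T \<gamma> (\<theta>' T - \<theta>' 0)"
    unfolding has_displacement_def by blast
  moreover have "\<bar>(\<theta>' T - \<theta>' 0) - d\<bar> \<le> 1"
  proof -
    have "(\<theta>' T - \<theta>' 0) - d = (Arg (q T) - Arg (q 0)) / (2 * pi)"
      by (simp add: \<theta>'_def th diff_divide_distrib)
    moreover have "\<bar>Arg (q T) - Arg (q 0)\<bar> \<le> 2 * pi"
      using Arg_bounded[of "q T"] Arg_bounded[of "q 0"] by auto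
    ultimately show ?thesis by (simp add: abs_divide)
  qed
  ultimately show ?thesis by (rule that)
qed

section \<open>Cuts between opposite extreme points of the body\<close>

text \<open>The graph that cuts the complement of the body: the chord between two extreme points \<open>l\<close> and
\<open>r\<close> in the direction \<open>e\<close>, extended by a constant on either side. The chord runs through the body,
so that outside only the two rays remain; they start at points where the normal is \<open>\<plusminus> e\<close>. Points
on the graph count as lying above it.\<close>

definition cut_height :: "complex \<Rightarrow> complex \<Rightarrow> complex \<Rightarrow> complex \<Rightarrow> real \<Rightarrow> real" where
  "cut_height e f l r \<xi> =
     l \<bullet> f + max 0 (min 1 ((\<xi> - l \<bullet> e) / (r \<bullet> e - l \<bullet> e))) * (r \<bullet> f - l \<bullet> f)"

definition side :: "complex \<Rightarrow> complex \<Rightarrow> complex \<Rightarrow> complex \<Rightarrow> complex \<Rightarrow> real" where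
  "side e f l r x = (if cut_height e f l r (x \<bullet> e) \<le> x \<bullet> f then 1/2 else - 1/2)"

text \<open>A sign that is never zero; the value at 0 is arbitrary but has to be fixed.\<close>

definition dir :: "real \<Rightarrow> real" where "dir u = (if 0 \<le> u then 1 else - 1)"

locale cut = small_body +
  fixes e f l r :: complex
  assumes axes: "e = 1 \<and> f = \<i> \<or> e = \<i> \<and> f = 1"
    and lK: "l \<in> K" and rK: "r \<in> K"
    and extreme: "\<And>y. y \<in> K \<Longrightarrow> l \<bullet> e \<le> y \<bullet> e \<and> y \<bullet> e \<le> r \<bullet> e"
begin

abbreviation "\<kappa> \<equiv> cut_height e f l r"
abbreviation "\<sigma> \<equiv> side e f l r"

lemma ef: "norm e = 1" "norm f = 1" "e \<bullet> e = 1" "f \<bullet> f = 1" "e \<bullet> f = 0" "f \<bullet> e = 0" "e \<noteq> - e" "e \<noteq> 0"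
  using axes by (auto simp: inner_complex_def complex_eq_iff cmod_def)

lemma eqI_axes: "x \<bullet> e = y \<bullet> e \<Longrightarrow> x \<bullet> f = y \<bullet> f \<Longrightarrow> x = y"
  using axes by (auto simp: inner_complex_def complex_eq_iff)

lemma normals_at_ends: "outer_unit_normal K l (- e)" "outer_unit_normal K r e"
  using extreme by (auto simp: outer_unit_normal_def ef algebra_simps)

lemma between_ends:
  assumes a: "a \<in> K" "outer_unit_normal K a n" "n \<noteq> e" "n \<noteq> - e"
  shows "l \<bullet> e < a \<bullet> e" "a \<bullet> e < r \<bullet> e"
proof -
  show "l \<bullet> e < a \<bullet> e"
  proof (rule ccontr)
    assume "\<not> ?thesis"
    then have "outer_unit_normal K a (- e)"
      using extreme a by (force simp: outer_unit_normal_def ef algebra_simps)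
    then show False using normal_unique a by blast
  qed
  show "a \<bullet> e < r \<bullet> e"
  proof (rule ccontr)
    assume "\<not> ?thesis"
    then have "outer_unit_normal K a e"
      using extreme a by (force simp: outer_unit_normal_def ef algebra_simps)
    then show False using normal_unique a by blast
  qed
qed

lemma ends_distinct: "l \<bullet> e < r \<bullet> e"
proof -
  obtain q where q: "q \<in> interior K" using interior_nonempty by auto
  show ?thesis
    using interior_below[OF q normals_at_ends(1)] interior_below[OF q normals_at_ends(2)]
    by (auto simp: algebra_simps)
qed

lemma chord_in_body: "0 \<le> u \<Longrightarrow> u \<le> 1 \<Longrightarrow> (1 - u) *\<^sub>R l + u *\<^sub>R r \<in> K"
  using convex lK rK by (simp add: convex_alt)

text \<open>A normal at an inner point of the chord would be a normal at both of its ends.\<close>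

lemma chord_in_interior:
  assumes u: "0 < u" "u < 1"
  shows "(1 - u) *\<^sub>R l + u *\<^sub>R r \<in> interior K"
proof (rule ccontr)
  define p where "p = (1 - u) *\<^sub>R l + u *\<^sub>R r"
  assume "\<not> ?thesis"
  then have p: "p \<in> K" "p \<in> frontier K"
    using chord_in_body[of u] u by (auto simp: p_def frontier_iff)
  obtain n where n: "outer_unit_normal K p n" using normal_exists p by blast
  define a where "a = (r - l) \<bullet> n"
  have "l - p = - u *\<^sub>R (r - l)" "r - p = (1 - u) *\<^sub>R (r - l)"
    by (simp_all add: p_def algebra_simps)
  moreover have "(l - p) \<bullet> n \<le> 0" "(r - p) \<bullet> n \<le> 0"
    using n lK rK by (auto simp: outer_unit_normal_def)
  ultimately have "- u * a \<le> 0" "(1 - u) * a \<le> 0" by (simp_all add: a_def)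
  then have a0: "a = 0" using u by (simp add: zero_le_mult_iff mult_le_0_iff)
  have ln: "(p - l) \<bullet> n = 0" and rn: "(p - r) \<bullet> n = 0"
    using a0 by (auto simp: p_def a_def algebra_simps)
  have "outer_unit_normal K l n"
    using n ln by (force simp: outer_unit_normal_def inner_diff_left)
  moreover have "outer_unit_normal K r n"
    using n rn by (force simp: outer_unit_normal_def inner_diff_left)
  ultimately have "n = - e" "n = e"
    using normal_unique normals_at_ends lK rK by blast+
  then show False using ef by simp
qed

lemma height_left: "\<xi> \<le> l \<bullet> e \<Longrightarrow> \<kappa> \<xi> = l \<bullet> f"
  using ends_distinct by (simp add: cut_height_def max_def min_def divide_simps)

lemma height_right: "\<xi> \<ge> r \<bullet> e \<Longrightarrow> \<kappa> \<xi> = r \<bullet> f"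
  using ends_distinct by (simp add: cut_height_def max_def min_def divide_simps)

lemma height_chord:
  assumes "l \<bullet> e \<le> \<xi>" "\<xi> \<le> r \<bullet> e"
  obtains u where "0 \<le> u" "u \<le> 1" "((1 - u) *\<^sub>R l + u *\<^sub>R r) \<bullet> e = \<xi>"
    "((1 - u) *\<^sub>R l + u *\<^sub>R r) \<bullet> f = \<kappa> \<xi>" "l \<bullet> e < \<xi> \<Longrightarrow> 0 < u" "\<xi> < r \<bullet> e \<Longrightarrow> u < 1"
proof
  define u where "u = (\<xi> - l \<bullet> e) / (r \<bullet> e - l \<bullet> e)"
  show u: "0 \<le> u" "u \<le> 1" using assms ends_distinct by (auto simp: u_def divide_simps)
  show "((1 - u) *\<^sub>R l + u *\<^sub>R r) \<bullet> f = \<kappa> \<xi>"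
    using u by (simp add: cut_height_def u_def[symmetric] algebra_simps)
  have "u * (r \<bullet> e - l \<bullet> e) = \<xi> - l \<bullet> e" using ends_distinct by (simp add: u_def)
  then show "((1 - u) *\<^sub>R l + u *\<^sub>R r) \<bullet> e = \<xi>" by (simp add: algebra_simps)
  show "l \<bullet> e < \<xi> \<Longrightarrow> 0 < u" "\<xi> < r \<bullet> e \<Longrightarrow> u < 1"
    using ends_distinct by (auto simp: u_def divide_simps)
qed

lemma height_convex:
  obtains u where "0 \<le> u" "u \<le> 1" "\<kappa> \<xi> = ((1 - u) *\<^sub>R l + u *\<^sub>R r) \<bullet> f"
  using that[of "max 0 (min 1 ((\<xi> - l \<bullet> e) / (r \<bullet> e - l \<bullet> e)))"]
  by (auto simp: cut_height_def algebra_simps)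

lemma height_between: "min (l \<bullet> f) (r \<bullet> f) \<le> \<kappa> \<xi>" "\<kappa> \<xi> \<le> max (l \<bullet> f) (r \<bullet> f)"
proof -
  obtain u where u: "0 \<le> u" "u \<le> 1" "\<kappa> \<xi> = ((1 - u) *\<^sub>R l + u *\<^sub>R r) \<bullet> f" by (rule height_convex)
  have k: "\<kappa> \<xi> = (1 - u) * (l \<bullet> f) + u * (r \<bullet> f)" by (simp add: u inner_add_left)
  show "min (l \<bullet> f) (r \<bullet> f) \<le> \<kappa> \<xi>"
    using convex_bound_le[of "- (l \<bullet> f)" "- min (l \<bullet> f) (r \<bullet> f)" "- (r \<bullet> f)" "1 - u" u] u k by auto
  show "\<kappa> \<xi> \<le> max (l \<bullet> f) (r \<bullet> f)"
    using convex_bound_le[of "l \<bullet> f" "max (l \<bullet> f) (r \<bullet> f)" "r \<bullet> f" "1 - u" u] u k by auto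
qed

lemma body_coordinate_small: "y \<in> K \<Longrightarrow> \<bar>y \<bullet> f\<bar> < 2/5"
  using axes coordinates_small by (auto simp: inner_complex_def)

lemma side_at_wall: "x \<bullet> f = 1/2 \<Longrightarrow> \<sigma> x = 1/2" "x \<bullet> f = - 1/2 \<Longrightarrow> \<sigma> x = - 1/2"
  using height_between[of "x \<bullet> e"] body_coordinate_small[OF lK] body_coordinate_small[OF rK]
  by (auto simp: side_def)

lemma on_cut_outside:
  assumes x: "x \<notin> interior K" and eq: "x \<bullet> f = \<kappa> (x \<bullet> e)"
  shows "x \<bullet> e \<le> l \<bullet> e \<and> x \<bullet> f = l \<bullet> f \<or> r \<bullet> e \<le> x \<bullet> e \<and> x \<bullet> f = r \<bullet> f"
proof -
  have False if lx: "l \<bullet> e < x \<bullet> e" and xr: "x \<bullet> e < r \<bullet> e"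
  proof -
    obtain u where u: "((1 - u) *\<^sub>R l + u *\<^sub>R r) \<bullet> e = x \<bullet> e"
      "((1 - u) *\<^sub>R l + u *\<^sub>R r) \<bullet> f = \<kappa> (x \<bullet> e)" "0 < u" "u < 1"
      using height_chord[OF less_imp_le[OF lx] less_imp_le[OF xr]] lx xr by metis
    have "(1 - u) *\<^sub>R l + u *\<^sub>R r = x" using u eq by (intro eqI_axes) auto
    then show False using chord_in_interior[OF u(3,4)] x by simp
  qed
  then show ?thesis using eq height_left height_right by fastforce
qed

text \<open>A point strictly below the chord has a point of the body above it and hence no upward normal.
This needs the cut to start at extreme points: for a cut through an arbitrary inner point, tips of
the body could lie on the wrong side.\<close>

lemma side_at_frontier:
  assumes p: "p \<in> K" "p \<notin> interior K" and n: "outer_unit_normal K p n"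
  shows "n \<bullet> f > 0 \<Longrightarrow> \<sigma> p = 1/2" "n \<bullet> f < 0 \<Longrightarrow> \<sigma> p = - 1/2"
proof -
  obtain u where u: "0 \<le> u" "u \<le> 1" "((1 - u) *\<^sub>R l + u *\<^sub>R r) \<bullet> e = p \<bullet> e"
    "((1 - u) *\<^sub>R l + u *\<^sub>R r) \<bullet> f = \<kappa> (p \<bullet> e)"
    using height_chord extreme[OF p(1)] by metis
  define c where "c = (1 - u) *\<^sub>R l + u *\<^sub>R r"
  have cK: "c \<in> K" unfolding c_def using u chord_in_body by simp
  have cp: "c - p = (\<kappa> (p \<bullet> e) - p \<bullet> f) *\<^sub>R f"
    by (rule eqI_axes) (use u in \<open>auto simp: c_def[symmetric] inner_diff_left ef\<close>)
  have le: "(\<kappa> (p \<bullet> e) - p \<bullet> f) * (n \<bullet> f) \<le> 0"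
    using n cK cp by (force simp: outer_unit_normal_def inner_commute)
  show "\<sigma> p = 1/2" if "n \<bullet> f > 0"
    using le that by (auto simp: side_def mult_le_0_iff)
  show "\<sigma> p = - 1/2" if neg: "n \<bullet> f < 0"
  proof -
    have ge: "p \<bullet> f \<le> \<kappa> (p \<bullet> e)" using le neg by (auto simp: mult_le_0_iff)
    have "p \<bullet> f \<noteq> \<kappa> (p \<bullet> e)"
    proof
      assume eq: "p \<bullet> f = \<kappa> (p \<bullet> e)"
      have "p = l \<or> p = r"
        using on_cut_outside[OF p(2) eq] extreme[OF p(1)] eqI_axes by force
      then have "n = - e \<or> n = e"
        using normal_unique n normals_at_ends lK rK by blast
      then show False using neg ef by auto
    qed
    then show ?thesis using ge by (simp add: side_def)
  qed
qed

lemma continuous_height: "continuous_on UNIV \<kappa>"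
  unfolding cut_height_def[abs_def] divide_inverse by (intro continuous_intros)

lemma side_locally_constant:
  assumes "x0 \<bullet> f \<noteq> \<kappa> (x0 \<bullet> e)"
  shows "\<exists>d>0. \<forall>x. dist x x0 < d \<longrightarrow> \<sigma> x = \<sigma> x0"
proof -
  have cont: "continuous_on UNIV (\<lambda>x. x \<bullet> f - \<kappa> (x \<bullet> e))"
    by (intro continuous_intros continuous_on_compose2[OF continuous_height]) auto
  define G where "G = (\<lambda>x. x \<bullet> f - \<kappa> (x \<bullet> e))"
  have "\<bar>G x0\<bar> > 0" using assms by (simp add: G_def)
  then obtain d where d: "d > 0" "\<And>x. dist x x0 < d \<Longrightarrow> dist (G x) (G x0) < \<bar>G x0\<bar>"
    using cont unfolding G_def[symmetric] continuous_on_iff by (metis UNIV_I)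
  have "\<sigma> x = \<sigma> x0" if "dist x x0 < d" for x
    using d(2)[OF that] by (auto simp: side_def G_def dist_real_def split: if_splits)
  then show ?thesis using d by blast
qed

text \<open>A segment that avoids the interior cannot leave an end of the chord towards the body.\<close>

lemma side_near_cut:
  assumes out: "\<And>t. t \<in> {A..B} \<Longrightarrow> X + t *\<^sub>R v \<notin> interior K"
    and t0: "t0 \<in> {A..B}" and on: "(X + t0 *\<^sub>R v) \<bullet> f = \<kappa> ((X + t0 *\<^sub>R v) \<bullet> e)"
  shows "\<exists>d>0. \<forall>t\<in>{A..B}. \<bar>t - t0\<bar> < d \<longrightarrow>
           \<kappa> ((X + t *\<^sub>R v) \<bullet> e) = (X + t0 *\<^sub>R v) \<bullet> f"
proof -
  define x where "x t = X + t *\<^sub>R v" for t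
  have diff: "x t \<bullet> e = x t0 \<bullet> e + (t - t0) * (v \<bullet> e)" for t
    by (simp add: x_def algebra_simps)
  have near: "\<bar>(t - t0) * (v \<bullet> e)\<bar> < d" if "\<bar>t - t0\<bar> < d / (\<bar>v \<bullet> e\<bar> + 1)" "d > 0" for t d
  proof -
    have "\<bar>(t - t0) * (v \<bullet> e)\<bar> \<le> \<bar>t - t0\<bar> * (\<bar>v \<bullet> e\<bar> + 1)"
      by (simp add: abs_mult mult_left_mono)
    also have "\<dots> < d" using that by (simp add: pos_less_divide_eq)
    finally show ?thesis .
  qed
  have end_: "t \<in> {A..B} \<Longrightarrow> (t - t0) * (v \<bullet> n) \<ge> 0"
    if p: "x t0 = p" "p \<in> K" "outer_unit_normal K p n" for p n t
  proof -
    assume t: "t \<in> {A..B}"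
    consider "t = t0" | "t > t0" | "t < t0" by linarith
    then show ?thesis
    proof cases
      case 2
      have "v \<bullet> n \<ge> 0"
      proof (rule free_direction_outward[OF p(2,3)])
        show "t - t0 > 0" using 2 by simp
        show "p + s *\<^sub>R v \<notin> interior K" if "0 \<le> s" "s \<le> t - t0" for s
          using out[of "t0 + s"] that t t0 p(1) by (auto simp: x_def algebra_simps)
      qed
      then show ?thesis using 2 by simp
    next
      case 3
      have "(- v) \<bullet> n \<ge> 0"
      proof (rule free_direction_outward[OF p(2,3)])
        show "t0 - t > 0" using 3 by simp
        show "p + s *\<^sub>R (- v) \<notin> interior K" if "0 \<le> s" "s \<le> t0 - t" for s
          using out[of "t0 - s"] that t t0 p(1) by (auto simp: x_def algebra_simps)
      qed
      then show ?thesis using 3 by (simp add: mult_nonpos_nonpos)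
    qed simp
  qed
  have "x t0 \<notin> interior K" using out t0 by (simp add: x_def)
  from on_cut_outside[OF this] on consider
      "x t0 \<bullet> e < l \<bullet> e" "x t0 \<bullet> f = l \<bullet> f" | "x t0 = l"
    | "x t0 \<bullet> e > r \<bullet> e" "x t0 \<bullet> f = r \<bullet> f" | "x t0 = r"
    by (force simp: x_def[symmetric] intro: eqI_axes)
  then show ?thesis
  proof cases
    case 1
    define d where "d = (l \<bullet> e - x t0 \<bullet> e) / (\<bar>v \<bullet> e\<bar> + 1)"
    have "d > 0" using 1 by (simp add: d_def divide_pos_pos add_nonneg_pos)
    moreover have "\<kappa> (x t \<bullet> e) = x t0 \<bullet> f" if "\<bar>t - t0\<bar> < d" for t
      unfolding 1(2) using near[of t "l \<bullet> e - x t0 \<bullet> e"] that 1(1) diff[of t]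
      by (intro height_left) (auto simp: d_def abs_less_iff)
    ultimately show ?thesis unfolding x_def by blast
  next
    case 2
    have "\<kappa> (x t \<bullet> e) = x t0 \<bullet> f" if "t \<in> {A..B}" for t
      using end_[OF 2 lK normals_at_ends(1) that] diff[of t] 2 by (simp add: height_left)
    then show ?thesis unfolding x_def by (intro exI[of _ 1]) auto
  next
    case 3
    define d where "d = (x t0 \<bullet> e - r \<bullet> e) / (\<bar>v \<bullet> e\<bar> + 1)"
    have "d > 0" using 3 by (simp add: d_def divide_pos_pos add_nonneg_pos)
    moreover have "\<kappa> (x t \<bullet> e) = x t0 \<bullet> f" if "\<bar>t - t0\<bar> < d" for t
      unfolding 3(2) using near[of t "x t0 \<bullet> e - r \<bullet> e"] that 3(1) diff[of t]
      by (intro height_right) (auto simp: d_def abs_less_iff)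
    ultimately show ?thesis unfolding x_def by blast
  next
    case 4
    have "\<kappa> (x t \<bullet> e) = x t0 \<bullet> f" if "t \<in> {A..B}" for t
      using end_[OF 4 rK normals_at_ends(2) that] diff[of t] 4 by (simp add: height_right)
    then show ?thesis unfolding x_def by (intro exI[of _ 1]) auto
  qed
qed

text \<open>Near the cut the graph is constant along a path outside the body, so that the path crosses it
in the direction of its own velocity.\<close>

lemma side_locally_monotone:
  assumes out: "\<And>t. t \<in> {A..B} \<Longrightarrow> X + t *\<^sub>R v \<notin> interior K"
    and t0: "t0 \<in> {A..B}"
  shows "\<exists>d>0. \<forall>t\<in>{A..B}. \<forall>t'\<in>{A..B}. \<bar>t - t0\<bar> < d \<and> \<bar>t' - t0\<bar> < d \<and> t \<le> t' \<longrightarrow>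
     dir (v \<bullet> f) * \<sigma> (X + t *\<^sub>R v) \<le> dir (v \<bullet> f) * \<sigma> (X + t' *\<^sub>R v)"
proof (cases "(X + t0 *\<^sub>R v) \<bullet> f = \<kappa> ((X + t0 *\<^sub>R v) \<bullet> e)")
  case True
  obtain d where d: "d > 0" "\<And>t. t\<in>{A..B} \<Longrightarrow> \<bar>t - t0\<bar> < d \<Longrightarrow>
      \<kappa> ((X + t *\<^sub>R v) \<bullet> e) = (X + t0 *\<^sub>R v) \<bullet> f"
    using side_near_cut[OF out t0 True] by auto
  have s: "\<sigma> (X + t *\<^sub>R v) = (if (t - t0) * (v \<bullet> f) \<ge> 0 then 1/2 else - 1/2)"
    if "t\<in>{A..B}" "\<bar>t - t0\<bar> < d" for t
    using d(2)[OF that] by (simp add: side_def algebra_simps)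
  have "dir (v \<bullet> f) * \<sigma> (X + t *\<^sub>R v) \<le> dir (v \<bullet> f) * \<sigma> (X + t' *\<^sub>R v)"
    if "t\<in>{A..B}" "t'\<in>{A..B}" "\<bar>t - t0\<bar> < d" "\<bar>t' - t0\<bar> < d" "t \<le> t'" for t t'
    unfolding s[OF that(1,3)] s[OF that(2,4)] using that(5)
    by (auto simp: dir_def zero_le_mult_iff)
  then show ?thesis using d(1) by blast
next
  case False
  obtain d where d: "d > 0" "\<And>x. dist x (X + t0 *\<^sub>R v) < d \<Longrightarrow> \<sigma> x = \<sigma> (X + t0 *\<^sub>R v)"
    using side_locally_constant[OF False] by auto
  have const: "\<sigma> (X + t *\<^sub>R v) = \<sigma> (X + t0 *\<^sub>R v)" if "\<bar>t - t0\<bar> < d / (norm v + 1)" for t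
  proof (rule d(2))
    have "dist (X + t *\<^sub>R v) (X + t0 *\<^sub>R v) = \<bar>t - t0\<bar> * norm v"
      by (simp add: dist_norm flip: scaleR_left_diff_distrib)
    also have "\<dots> \<le> \<bar>t - t0\<bar> * (norm v + 1)" by (simp add: mult_left_mono)
    also have "\<dots> < d" using that by (subst (asm) pos_less_divide_eq) (auto simp: add_nonneg_pos)
    finally show "dist (X + t *\<^sub>R v) (X + t0 *\<^sub>R v) < d" .
  qed
  have "dir (v \<bullet> f) * \<sigma> (X + t *\<^sub>R v) \<le> dir (v \<bullet> f) * \<sigma> (X + t' *\<^sub>R v)"
    if "\<bar>t - t0\<bar> < d / (norm v + 1)" "\<bar>t' - t0\<bar> < d / (norm v + 1)" for t t'
    by (simp only: const[OF that(1)] const[OF that(2)])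
  moreover have "d / (norm v + 1) > 0" using d(1) by (simp add: add_nonneg_pos)
  ultimately show ?thesis by blast
qed

end

section \<open>Four regions around the body and the upper bound\<close>

lemma Ints_locally_constant:
  fixes g :: "real \<Rightarrow> real"
  assumes "continuous (at t0 within S) g" "t0 \<in> S" "\<And>t. t \<in> S \<Longrightarrow> g t \<in> \<int>"
  shows "\<exists>d>0. \<forall>t\<in>S. \<bar>t - t0\<bar> < d \<longrightarrow> g t = g t0"
proof -
  obtain d where d: "d > 0" "\<And>t. t \<in> S \<Longrightarrow> dist t t0 < d \<Longrightarrow> dist (g t) (g t0) < 1"
    using assms(1) unfolding continuous_within_eps_delta by (metis zero_less_one)
  have "g t = g t0" if "t \<in> S" "\<bar>t - t0\<bar> < d" for t
    using Ints_eq_abs_less1[of "g t" "g t0"] d(2)[of t] that assms(2,3) by (auto simp: dist_real_def)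
  then show ?thesis using d(1) by blast
qed

lemma partition_mono:
  fixes \<tau> :: "nat \<Rightarrow> real"
  assumes "\<And>i. i < m \<Longrightarrow> \<tau> i < \<tau> (Suc i)"
  shows "i \<le> j \<Longrightarrow> j \<le> m \<Longrightarrow> \<tau> i \<le> \<tau> j"
proof (induction j)
  case (Suc j)
  then show ?case using assms[of j] by (cases "i = Suc j") (auto simp: le_Suc_eq)
qed simp

lemma line_near:
  fixes X v :: "'a::real_normed_vector"
  assumes "d > 0"
  shows "\<exists>d'>0. \<forall>t. \<bar>t - t0\<bar> < d' \<longrightarrow> dist (X + t *\<^sub>R v) (X + t0 *\<^sub>R v) < d"
proof -
  have "isCont (\<lambda>t. X + t *\<^sub>R v) t0" by (intro continuous_intros)
  then show ?thesis
    using assms unfolding continuous_at_eps_delta dist_real_def by blast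
qed

text \<open>A lift of the corner region to the integers that increases by one with each counterclockwise step,
except for the step across the left ray, where the branch of \<open>phi\<close> jumps as well.\<close>

definition quadrant :: "real \<Rightarrow> real \<Rightarrow> real" where
  "quadrant m n = (if 0 < n then (if 0 < m then 0 else 1) else (if 0 < m then - 1 else - 2))"

lemma quadrant_bounded: "\<bar>quadrant m n\<bar> \<le> 2"
  by (simp add: quadrant_def)

lemma side_cases: "side e f l r x = 1/2 \<or> side e f l r x = - 1/2"
  by (simp add: side_def)

text \<open>The horizontal cut joins the leftmost and rightmost points \<open>l\<close>, \<open>r\<close>, the vertical cut the lowest
and highest points \<open>b\<close>, \<open>a\<close>. Angles are measured at a point \<open>c\<close> on the level of \<open>l\<close>, so
that the branch cut of the argument is the left ray of the horizontal cut.\<close>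

locale crossed_cuts = horiz: cut K 1 \<i> l r + vert: cut K \<i> 1 b a for K l r b a +
  fixes c :: complex
  assumes c: "c \<in> interior K" and c_level: "Im c = Im l" and c_right: "Re l < Re c"
    and c_visible: "\<And>x. Im x = Im l \<Longrightarrow> Re l < Re x \<Longrightarrow> Re x \<le> Re c \<Longrightarrow> x \<in> interior K"
begin

abbreviation "n \<equiv> side 1 \<i> l r"
abbreviation "m \<equiv> side \<i> 1 b a"
abbreviation "\<kappa>\<^sub>n \<equiv> cut_height 1 \<i> l r"
abbreviation "\<kappa>\<^sub>m \<equiv> cut_height \<i> 1 b a"

lemma left_end_left: "Re x \<le> Re l \<Longrightarrow> Re x < \<kappa>\<^sub>m (Im x)"
  using horiz.between_ends[OF vert.rK vert.normals_at_ends(2)]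
    horiz.between_ends[OF vert.lK vert.normals_at_ends(1)] vert.height_between(1)[of "Im x"]
  by (auto simp: complex_eq_iff)

lemma right_end_right: "Re r \<le> Re x \<Longrightarrow> \<kappa>\<^sub>m (Im x) < Re x"
  using horiz.between_ends[OF vert.rK vert.normals_at_ends(2)]
    horiz.between_ends[OF vert.lK vert.normals_at_ends(1)] vert.height_between(2)[of "Im x"]
  by (auto simp: complex_eq_iff)

lemma seen_to_the_left:
  assumes x: "x \<notin> interior K" and neg: "x - c \<in> \<real>\<^sub>\<le>\<^sub>0"
  shows "Im x = Im l" "Re x \<le> Re l"
proof -
  show im: "Im x = Im l" using neg c_level by (auto simp: complex_nonpos_Reals_iff)
  show "Re x \<le> Re l"
  proof (rule ccontr)
    assume "\<not> ?thesis"
    then have "x \<in> interior K"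
      using c_visible[OF im] neg by (auto simp: complex_nonpos_Reals_iff)
    then show False using x by simp
  qed
qed

lemma phi_minus_side:
  assumes "Re x < Re c" "n x = (if Im l \<le> Im x then 1/2 else - 1/2)"
  shows "phi c x - n x = Arg (c - x) / (2 * pi)"
proof -
  have nz: "x - c \<noteq> 0" using assms by auto
  have "Arg (c - x) = (if Arg (x - c) \<le> 0 then Arg (x - c) + pi else Arg (x - c) - pi)"
    using Arg_minus[OF nz] by simp
  moreover have "Arg (x - c) \<le> 0 \<longleftrightarrow> Im x < Im l"
    using Arg_pos_iff[of "x - c"] assms c_level by (auto simp: not_less[symmetric])
  ultimately show ?thesis
    using assms by (auto simp: phi_def field_simps)
qed

text \<open>Up to a bounded error this is four times the lift \<open>\<theta>\<close> of the angle, but it is constant while the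
path stays in one corner region.\<close>

definition index :: "complex \<Rightarrow> complex \<Rightarrow> (real \<Rightarrow> real) \<Rightarrow> real \<Rightarrow> real" where
  "index X v \<theta> t =
     4 * (\<theta> t - phi c (X + t *\<^sub>R v)) + quadrant (m (X + t *\<^sub>R v)) (n (X + t *\<^sub>R v))"

context
  fixes X v :: complex and A B :: real and \<theta> :: "real \<Rightarrow> real"
  assumes out: "\<And>t. t \<in> {A..B} \<Longrightarrow> X + t *\<^sub>R v \<notin> interior K"
    and cont: "continuous_on {A..B} \<theta>"
    and lift: "\<And>t. t \<in> {A..B} \<Longrightarrow> \<theta> t - phi c (X + t *\<^sub>R v) \<in> \<int>"
begin

text \<open>The four rays are disjoint, so near any point at most one of \<open>m\<close> and \<open>n\<close> changes, and the index
follows that change by exactly one, up or down.\<close>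

lemma index_locally:
  assumes t0: "t0 \<in> {A..B}"
  shows "\<exists>d>0. \<exists>k \<alpha> \<beta>. \<bar>\<alpha>\<bar> = 1 \<and> \<bar>\<beta>\<bar> = 1 \<and> (\<forall>t\<in>{A..B}. \<bar>t - t0\<bar> < d \<longrightarrow>
           index X v \<theta> t = k + \<alpha> * m (X + t *\<^sub>R v) + \<beta> * n (X + t *\<^sub>R v))"
proof -
  define x where "x t = X + t *\<^sub>R v" for t
  have x0: "x t0 \<notin> interior K" using out t0 by (simp add: x_def)
  have contx: "continuous (at t0 within {A..B}) x"
    unfolding x_def[abs_def] by (intro continuous_intros)
  have conth: "continuous (at t0 within {A..B}) \<theta>"
    using cont t0 by (simp add: continuous_on_eq_continuous_within)
  have const_n: "\<exists>d>0. \<forall>t. \<bar>t - t0\<bar> < d \<longrightarrow> n (x t) = n (x t0)" if "Im (x t0) \<noteq> \<kappa>\<^sub>n (Re (x t0))"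
    using horiz.side_locally_constant[of "x t0"] that line_near[of _ t0 X v]
    unfolding x_def[symmetric] complex_inner_1_right complex_inner_i_right by metis
  have const_m: "\<exists>d>0. \<forall>t. \<bar>t - t0\<bar> < d \<longrightarrow> m (x t) = m (x t0)" if "Re (x t0) \<noteq> \<kappa>\<^sub>m (Im (x t0))"
    using vert.side_locally_constant[of "x t0"] that line_near[of _ t0 X v]
    unfolding x_def[symmetric] complex_inner_1_right complex_inner_i_right by metis
  show ?thesis
  proof (cases "x t0 - c \<in> \<real>\<^sub>\<le>\<^sub>0")
    case True
    note l = seen_to_the_left[OF x0 True]
    \<comment> \<open>Here the branch of the angle jumps together with \<open>n\<close>.\<close>
    have ml: "Re (x t0) \<noteq> \<kappa>\<^sub>m (Im (x t0))" "m (x t0) = - 1/2"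
      using left_end_left[OF l(2)] by (auto simp: side_def)
    obtain d1 where d1: "d1 > 0" "\<And>t. \<bar>t - t0\<bar> < d1 \<Longrightarrow> m (x t) = - 1/2"
      using const_m[OF ml(1)] ml(2) by auto
    have on: "(X + t0 *\<^sub>R v) \<bullet> \<i> = \<kappa>\<^sub>n ((X + t0 *\<^sub>R v) \<bullet> 1)"
      using l horiz.height_left[of "Re (x t0)"] by (simp add: x_def)
    obtain d2 where d2: "d2 > 0" "\<And>t. t\<in>{A..B} \<Longrightarrow> \<bar>t - t0\<bar> < d2 \<Longrightarrow> \<kappa>\<^sub>n (Re (x t)) = Im l"
      using horiz.side_near_cut[OF out t0 on] l
      unfolding x_def[symmetric] complex_inner_1_right complex_inner_i_right by auto
    obtain d3 where d3: "d3 > 0" "\<And>t. \<bar>t - t0\<bar> < d3 \<Longrightarrow> dist (x t) (x t0) < Re c - Re l"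
      using line_near[of "Re c - Re l" t0 X v] c_right by (auto simp: x_def)
    have d3': "Re (x t) < Re c" if "\<bar>t - t0\<bar> < d3" for t
      using d3(2)[OF that] l(2) abs_Re_le_cmod[of "x t - x t0"] by (auto simp: dist_norm)
    define d where "d = min d1 (min d2 d3)"
    have d: "d > 0" using d1 d2 d3 by (simp add: d_def)
    define S where "S = {A..B} \<inter> {t. \<bar>t - t0\<bar> < d}"
    have nS: "n (x t) = (if Im l \<le> Im (x t) then 1/2 else - 1/2)" if "t \<in> S" for t
      using d2(2)[of t] that by (simp add: side_def S_def d_def)
    define g where "g t = \<theta> t - Arg (c - x t) / (2 * pi) - 1/2" for t
    have gS: "g t = (\<theta> t - phi c (x t)) + (n (x t) - 1/2)" if "t \<in> S" for t
      using phi_minus_side[of "x t"] nS[OF that] d3'[of t] that by (simp add: g_def S_def d_def)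
    have SA: "S \<subseteq> {A..B}" by (simp add: S_def)
    have cx: "(x \<longlongrightarrow> x t0) (at t0 within S)" and ct: "(\<theta> \<longlongrightarrow> \<theta> t0) (at t0 within S)"
      using continuous_within_subset[OF contx SA] continuous_within_subset[OF conth SA]
      by (simp_all add: continuous_within)
    have "c - x t0 \<notin> \<real>\<^sub>\<le>\<^sub>0"
      using d3'[of t0] d3(1) by (simp add: complex_nonpos_Reals_iff)
    then have "(g \<longlongrightarrow> g t0) (at t0 within S)"
      unfolding g_def by (intro tendsto_intros cx ct) auto
    then have cg: "continuous (at t0 within S) g" by (simp add: continuous_within)
    have gI: "g t \<in> \<int>" if "t \<in> S" for t
    proof -
      have "n (x t) - 1/2 = 0 \<or> n (x t) - 1/2 = - 1" using side_cases[of 1 \<i> l r "x t"] by linarith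
      then have "n (x t) - 1/2 \<in> \<int>" by (metis Ints_0 Ints_1 Ints_minus)
      moreover have "\<theta> t - phi c (x t) \<in> \<int>" using lift[of t] that SA unfolding x_def by auto
      ultimately show ?thesis unfolding gS[OF that] by (rule Ints_add[rotated])
    qed
    have t0S: "t0 \<in> S" using t0 d by (simp add: S_def)
    obtain d4 where d4: "d4 > 0" "\<And>t. t \<in> S \<Longrightarrow> \<bar>t - t0\<bar> < d4 \<Longrightarrow> g t = g t0"
      using Ints_locally_constant[OF cg t0S gI] by blast
    have "index X v \<theta> t = (4 * g t0 + 2) + 1 * m (x t) + (- 1) * n (x t)"
      if "t \<in> {A..B}" "\<bar>t - t0\<bar> < min d d4" for t
    proof -
      have tS: "t \<in> S" using that by (simp add: S_def)
      have "\<theta> t - phi c (x t) = g t0 - n (x t) + 1/2" using gS[OF tS] d4(2)[OF tS] that by simp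
      moreover have "m (x t) = - 1/2" using d1(2)[of t] that by (simp add: d_def)
      ultimately show ?thesis
        using side_cases[of 1 \<i> l r "x t"]
        unfolding index_def x_def[symmetric] quadrant_def by auto
    qed
    then show ?thesis
      using d d4(1) unfolding x_def[symmetric]
      by (intro exI[of _ "min d d4"] conjI exI[of _ "4 * g t0 + 2"] exI[of _ 1] exI[of _ "-1"]) auto
  next
    case False
    have cF: "continuous (at t0 within {A..B}) (\<lambda>t. \<theta> t - phi c (x t))"
      using False contx conth unfolding phi_def continuous_within
      by (intro tendsto_intros) auto
    obtain d1 where d1: "d1 > 0"
      "\<And>t. t \<in> {A..B} \<Longrightarrow> \<bar>t - t0\<bar> < d1 \<Longrightarrow> \<theta> t - phi c (x t) = \<theta> t0 - phi c (x t0)"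
      using Ints_locally_constant[OF cF t0] lift unfolding x_def by blast
    define w where "w = 4 * (\<theta> t0 - phi c (x t0))"
    show ?thesis
    proof (cases "Im (x t0) = \<kappa>\<^sub>n (Re (x t0))")
      case True
      have "Re r \<le> Re (x t0)"
      proof (rule ccontr)
        assume "\<not> ?thesis"
        then have "Re (x t0) \<le> Re l" "Im (x t0) = Im l"
          using horiz.on_cut_outside[OF x0] True by auto
        then show False
          using False c_level c_right by (auto simp: complex_nonpos_Reals_iff)
      qed
      then have mr: "Re (x t0) \<noteq> \<kappa>\<^sub>m (Im (x t0))" "m (x t0) = 1/2"
        using right_end_right[of "x t0"] by (auto simp: side_def)
      obtain d2 where d2: "d2 > 0" "\<And>t. \<bar>t - t0\<bar> < d2 \<Longrightarrow> m (x t) = 1/2"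
        using const_m[OF mr(1)] mr(2) by auto
      have "index X v \<theta> t = (w - 1) + 1 * m (x t) + 1 * n (x t)"
        if "t \<in> {A..B}" "\<bar>t - t0\<bar> < min d1 d2" for t
        using d1(2)[of t] d2(2)[of t] that side_cases[of 1 \<i> l r "x t"]
        unfolding index_def x_def[symmetric] quadrant_def w_def by auto
      then show ?thesis
        using d1(1) d2(1) unfolding x_def[symmetric]
        by (intro exI[of _ "min d1 d2"] conjI exI[of _ "w - 1"] exI[of _ 1]) auto
    next
      case neq: False
      obtain d2 where d2: "d2 > 0" "\<And>t. \<bar>t - t0\<bar> < d2 \<Longrightarrow> n (x t) = n (x t0)"
        using const_n[OF neq] by auto
      define \<alpha> where "\<alpha> = (if n (x t0) = 1/2 then -1 else 1 :: real)"
      define k where "k = (if n (x t0) = 1/2 then w else w - 1)"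
      have "index X v \<theta> t = k + \<alpha> * m (x t) + 1 * n (x t)"
        if "t \<in> {A..B}" "\<bar>t - t0\<bar> < min d1 d2" for t
        using d1(2)[of t] d2(2)[of t] that side_cases[of 1 \<i> l r "x t0"] side_cases[of \<i> 1 b a "x t"]
        unfolding index_def x_def[symmetric] quadrant_def w_def k_def \<alpha>_def by auto
      then show ?thesis
        using d1(1) d2(1) unfolding x_def[symmetric]
        by (intro exI[of _ "min d1 d2"] conjI exI[of _ k] exI[of _ \<alpha>] exI[of _ 1]) (auto simp: \<alpha>_def)
    qed
  qed
qed

text \<open>Along a segment both terms on the right are locally nondecreasing, so the local bound adds up. The
factor \<open>s\<close> covers both senses of rotation.\<close>

lemma index_change_along_segment:
  assumes AB: "A \<le> B" and s: "\<bar>s\<bar> = 1"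
  shows "s * (index X v \<theta> B - index X v \<theta> A) \<le>
    dir (Re v) * (m (X + B *\<^sub>R v) - m (X + A *\<^sub>R v)) + dir (Im v) * (n (X + B *\<^sub>R v) - n (X + A *\<^sub>R v))"
proof -
  define M where "M t = m (X + t *\<^sub>R v)" for t
  define N where "N t = n (X + t *\<^sub>R v)" for t
  define P where "P p q \<longleftrightarrow> (A \<le> p \<and> p \<le> q \<and> q \<le> B \<longrightarrow> s * (index X v \<theta> q - index X v \<theta> p) \<le>
      dir (Re v) * (M q - M p) + dir (Im v) * (N q - N p))" for p q
  have "P A B"
  proof (rule Bolzano[OF AB])
    show "P p q \<Longrightarrow> P q u \<Longrightarrow> p \<le> q \<Longrightarrow> q \<le> u \<Longrightarrow> P p u" for p q u
      by (auto simp: P_def algebra_simps)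
  next
    fix t0 assume "A \<le> t0" "t0 \<le> B"
    then have t0: "t0 \<in> {A..B}" by simp
    obtain d1 k \<alpha> \<beta> where d1: "d1 > 0" "\<bar>\<alpha>\<bar> = 1" "\<bar>\<beta>\<bar> = 1"
      "\<And>t. t \<in> {A..B} \<Longrightarrow> \<bar>t - t0\<bar> < d1 \<Longrightarrow> index X v \<theta> t = k + \<alpha> * M t + \<beta> * N t"
      using index_locally[OF t0] unfolding M_def N_def by metis
    obtain d2 where d2: "d2 > 0" "\<And>t t'. t \<in> {A..B} \<Longrightarrow> t' \<in> {A..B} \<Longrightarrow>
        \<bar>t - t0\<bar> < d2 \<Longrightarrow> \<bar>t' - t0\<bar> < d2 \<Longrightarrow> t \<le> t' \<Longrightarrow> dir (Re v) * M t \<le> dir (Re v) * M t'"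
      using vert.side_locally_monotone[OF out t0] unfolding M_def complex_inner_1_right by blast
    obtain d3 where d3: "d3 > 0" "\<And>t t'. t \<in> {A..B} \<Longrightarrow> t' \<in> {A..B} \<Longrightarrow>
        \<bar>t - t0\<bar> < d3 \<Longrightarrow> \<bar>t' - t0\<bar> < d3 \<Longrightarrow> t \<le> t' \<Longrightarrow> dir (Im v) * N t \<le> dir (Im v) * N t'"
      using horiz.side_locally_monotone[OF out t0] unfolding N_def complex_inner_i_right by blast
    define d where "d = min d1 (min d2 d3)"
    have "P p q" if pq: "p \<le> t0" "t0 \<le> q" "q - p < d" for p q
      unfolding P_def
    proof
      assume "A \<le> p \<and> p \<le> q \<and> q \<le> B"
      then have S: "p \<in> {A..B}" "q \<in> {A..B}" "\<bar>p - t0\<bar> < d" "\<bar>q - t0\<bar> < d" "p \<le> q"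
        using pq by auto
      have step: "e * \<gamma> * x \<le> dir y * x" if "0 \<le> dir y * x" "\<bar>e\<bar> = 1" "\<bar>\<gamma>\<bar> = 1" for e \<gamma> x y :: real
        using that by (auto simp: dir_def abs_if split: if_splits)
      have "index X v \<theta> q - index X v \<theta> p = \<alpha> * (M q - M p) + \<beta> * (N q - N p)"
        using d1(4)[OF S(1)] d1(4)[OF S(2)] S by (simp add: d_def algebra_simps)
      then have "s * (index X v \<theta> q - index X v \<theta> p) = s * \<alpha> * (M q - M p) + s * \<beta> * (N q - N p)"
        by (simp only: distrib_left mult.assoc)
      also have "\<dots> \<le> dir (Re v) * (M q - M p) + dir (Im v) * (N q - N p)"
        using d2(2)[OF S(1,2)] d3(2)[OF S(1,2)] S s d1(2,3)
        by (intro add_mono step) (auto simp: d_def right_diff_distrib)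
      finally show "s * (index X v \<theta> q - index X v \<theta> p) \<le> dir (Re v) * (M q - M p) + dir (Im v) * (N q - N p)" .
    qed
    then show "\<exists>d>0. \<forall>p q. p \<le> t0 \<and> t0 \<le> q \<and> q - p < d \<longrightarrow> P p q"
      using d1(1) d2(1) d3(1) by (intro exI[of _ d]) (auto simp: d_def)
  qed
  then show ?thesis using AB by (simp add: P_def M_def N_def)
qed

end

text \<open>The difference between counting crossings and measuring length, for motion in the quadrant of \<open>v\<close>.\<close>

definition pot :: "complex \<Rightarrow> complex \<Rightarrow> real" where
  "pot v x = dir (Re v) * (m x - Re x) + dir (Im v) * (n x - Im x)"

lemma pot_bounded: "x \<in> square \<Longrightarrow> \<bar>pot v x\<bar> \<le> 2"
  using side_cases[of 1 \<i> l r x] side_cases[of \<i> 1 b a x]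
  by (auto simp: pot_def dir_def square_def abs_le_iff)

lemma coordinate_at_wall: "\<bar>Re x\<bar> = 1/2 \<Longrightarrow> m x = Re x" "\<bar>Im x\<bar> = 1/2 \<Longrightarrow> n x = Im x"
  using vert.side_at_wall[of x] horiz.side_at_wall[of x] by (auto simp: abs_if split: if_splits)

text \<open>Where a reflection at the body turns a coordinate of the velocity from negative to positive, the normal
points in the positive direction, the point is on the positive side of the cut, and the
coefficient of the changed sign is positive because the body stays away from the walls. At a wall
this coefficient is zero.\<close>

lemma pot_bounce:
  assumes law: "billiard_law K x v w" and x: "x \<notin> interior K"
    and d: "d > 0" and out: "\<And>s. 0 \<le> s \<Longrightarrow> s \<le> d \<Longrightarrow> x + s *\<^sub>R w \<notin> interior K"
  shows "pot v x \<le> pot w x"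
proof -
  consider "\<bar>Re x\<bar> = 1/2" "\<bar>Im x\<bar> = 1/2" | "\<bar>Re x\<bar> = 1/2" "w = - cnj v" | "\<bar>Im x\<bar> = 1/2" "w = cnj v"
    | k where "x \<in> frontier K" "outer_unit_normal K x k" "w = v - (2 * (v \<bullet> k)) *\<^sub>R k" | "w = v"
    using law unfolding billiard_law_def by (auto split: if_splits)
  then show ?thesis
  proof cases
    case (4 k)
    have xK: "x \<in> K" using 4 by (simp add: horiz.frontier_iff)
    have kk: "k \<bullet> k = 1" using 4(2) by (simp add: outer_unit_normal_def dot_square_norm)
    have "w \<bullet> k \<ge> 0"
      by (rule horiz.free_direction_outward[OF xK 4(2) d out])
    then have vk: "v \<bullet> k \<le> 0" using 4(3) kk by (simp add: inner_diff_left)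
    have flip: "dir p * y \<le> dir q * y"
      if "q = p - 2 * (v \<bullet> k) * u" "u > 0 \<Longrightarrow> y \<ge> 0" "u < 0 \<Longrightarrow> y \<le> 0" for p q u y :: real
    proof (cases "dir p = dir q")
      case False
      consider "0 \<le> p" "q < 0" | "p < 0" "0 \<le> q" using False by (force simp: dir_def split: if_splits)
      then show ?thesis
      proof cases
        case 1
        then have "(v \<bullet> k) * u > 0" using that(1) by simp
        then have "u < 0" using vk by (auto simp: zero_less_mult_iff)
        then show ?thesis using 1 that(3) by (simp add: dir_def)
      next
        case 2
        then have "(v \<bullet> k) * u < 0" using that(1) by simp
        then have "u > 0" using vk by (auto simp: mult_less_0_iff)
        then show ?thesis using 2 that(2) by (simp add: dir_def)
      qed
    qed simp
    have small: "\<bar>Re x\<bar> < 2/5" "\<bar>Im x\<bar> < 2/5" using horiz.coordinates_small[OF xK] by auto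
    have "dir (Re v) * (m x - Re x) \<le> dir (Re w) * (m x - Re x)"
      using vert.side_at_frontier[OF xK x 4(2)] small by (intro flip[of _ _ "Re k"]) (auto simp: 4(3))
    moreover have "dir (Im v) * (n x - Im x) \<le> dir (Im w) * (n x - Im x)"
      using horiz.side_at_frontier[OF xK x 4(2)] small by (intro flip[of _ _ "Im k"]) (auto simp: 4(3))
    ultimately show ?thesis by (simp add: pot_def)
  qed (use coordinate_at_wall[of x] in \<open>auto simp: pot_def\<close>)
qed

lemma displacement_le:
  assumes tr: "trajectory_piece K T \<gamma>" and cont: "continuous_on {0..T} \<theta>"
    and lift: "\<And>t. t \<in> {0..T} \<Longrightarrow> \<theta> t - phi c (\<gamma> t) \<in> \<int>" and s: "\<bar>s\<bar> = 1"
  shows "s * (\<theta> T - \<theta> 0) \<le> sqrt 2 / 4 * T + 3"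
proof -
  obtain N \<tau> v where \<tau>0: "\<tau> 0 = 0" and \<tau>N: "\<tau> N = T"
    and piece: "\<And>i. i < N \<Longrightarrow> \<tau> i < \<tau> (Suc i) \<and> norm (v i) = 1 \<and>
           (\<forall>t\<in>{\<tau> i..\<tau> (Suc i)}. \<gamma> t = \<gamma> (\<tau> i) + (t - \<tau> i) *\<^sub>R v i)"
    and law: "\<And>i. Suc i < N \<Longrightarrow> billiard_law K (\<gamma> (\<tau> (Suc i))) (v i) (v (Suc i))"
    using tr unfolding trajectory_piece_def by metis
  note mono = partition_mono[of N \<tau>, OF conjunct1[OF piece]]
  have range: "t \<in> {0..T}" if "i < N" "\<tau> i \<le> t" "t \<le> \<tau> (Suc i)" for i t
    using mono[of 0 i] mono[of "Suc i" N] that \<tau>0 \<tau>N by auto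
  have T0: "0 \<le> T" using mono[of 0 N] \<tau>0 \<tau>N by simp
  define J where "J t = 4 * (\<theta> t - phi c (\<gamma> t)) + quadrant (m (\<gamma> t)) (n (\<gamma> t))" for t
  have one: "s * (J (\<tau> (Suc i)) - J (\<tau> i)) \<le> sqrt 2 * (\<tau> (Suc i) - \<tau> i)
       + pot (v i) (\<gamma> (\<tau> (Suc i))) - pot (v i) (\<gamma> (\<tau> i))" if i: "i < N" for i
  proof -
    define A B X where "A = \<tau> i" and "B = \<tau> (Suc i)" and "X = \<gamma> (\<tau> i) - \<tau> i *\<^sub>R v i"
    have AB: "A < B" and nv: "norm (v i) = 1" using piece[OF i] by (auto simp: A_def B_def)
    have line: "X + t *\<^sub>R v i = \<gamma> t" if "t \<in> {A..B}" for t
    proof -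
      have "\<gamma> t = \<gamma> (\<tau> i) + (t - \<tau> i) *\<^sub>R v i" using piece[OF i] that unfolding A_def B_def by blast
      then show ?thesis by (simp add: X_def algebra_simps)
    qed
    have sub: "{A..B} \<subseteq> {0..T}" using range[OF i] by (auto simp: A_def B_def)
    have "s * (index X (v i) \<theta> B - index X (v i) \<theta> A) \<le>
      dir (Re (v i)) * (m (X + B *\<^sub>R v i) - m (X + A *\<^sub>R v i))
      + dir (Im (v i)) * (n (X + B *\<^sub>R v i) - n (X + A *\<^sub>R v i))"
    proof (rule index_change_along_segment)
      show "X + t *\<^sub>R v i \<notin> interior K" if "t \<in> {A..B}" for t
        using line[OF that] sub that trajectory_pieceD(2)[OF tr, of t] by auto
      show "\<theta> t - phi c (X + t *\<^sub>R v i) \<in> \<int>" if "t \<in> {A..B}" for t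
        using line[OF that] sub that lift[of t] by auto
    qed (use AB s sub continuous_on_subset[OF cont] in auto)
    moreover have "index X (v i) \<theta> B = J B" "index X (v i) \<theta> A = J A" "X + A *\<^sub>R v i = \<gamma> A" "X + B *\<^sub>R v i = \<gamma> B"
      using line[of A] line[of B] AB by (auto simp: index_def J_def)
    ultimately have le: "s * (J B - J A) \<le> dir (Re (v i)) * (m (\<gamma> B) - m (\<gamma> A))
      + dir (Im (v i)) * (n (\<gamma> B) - n (\<gamma> A))" by simp
    have "\<gamma> B = \<gamma> A + (B - A) *\<^sub>R v i"
      using line[of A, symmetric] line[of B, symmetric] AB by (auto simp: algebra_simps)
    then have BA: "Re (\<gamma> B) = Re (\<gamma> A) + (B - A) * Re (v i)" "Im (\<gamma> B) = Im (\<gamma> A) + (B - A) * Im (v i)"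
      by auto
    have "dir (Re (v i)) * (m (\<gamma> B) - m (\<gamma> A)) + dir (Im (v i)) * (n (\<gamma> B) - n (\<gamma> A))
       = (B - A) * (dir (Re (v i)) * Re (v i) + dir (Im (v i)) * Im (v i))
         + pot (v i) (\<gamma> B) - pot (v i) (\<gamma> A)"
      unfolding pot_def BA by (simp add: algebra_simps)
    moreover have "dir (Re (v i)) * Re (v i) + dir (Im (v i)) * Im (v i) \<le> sqrt 2"
    proof -
      have "\<bar>Re (v i)\<bar> + \<bar>Im (v i)\<bar> \<le> sqrt 2 * norm (v i)" by (rule complex_abs_le_norm)
      then show ?thesis using nv by (simp add: dir_def abs_if split: if_splits)
    qed
    then have "(B - A) * (dir (Re (v i)) * Re (v i) + dir (Im (v i)) * Im (v i)) \<le> sqrt 2 * (B - A)"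
      using AB by (simp add: mult.commute mult_left_mono)
    ultimately show ?thesis using le by (simp add: A_def B_def)
  qed
  \<comment> \<open>The potentials telescope, since none of them decreases at a bounce.\<close>
  have sum: "k < N \<Longrightarrow> s * (J (\<tau> (Suc k)) - J 0) \<le> sqrt 2 * \<tau> (Suc k)
       + pot (v k) (\<gamma> (\<tau> (Suc k))) - pot (v 0) (\<gamma> 0)" for k
  proof (induction k)
    case 0 then show ?case using one[of 0] \<tau>0 by simp
  next
    case (Suc k)
    let ?x = "\<gamma> (\<tau> (Suc k))"
    have p: "\<tau> (Suc k) < \<tau> (Suc (Suc k))" using piece[OF Suc.prems] by simp
    have "pot (v k) ?x \<le> pot (v (Suc k)) ?x"
    proof (rule pot_bounce[OF law[OF Suc.prems]])
      show "\<tau> (Suc (Suc k)) - \<tau> (Suc k) > 0" using p by simp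
      have out: "\<gamma> t \<notin> interior K" if "\<tau> (Suc k) \<le> t" "t \<le> \<tau> (Suc (Suc k))" for t
        using trajectory_pieceD(2)[OF tr, of t] range[OF Suc.prems that] by simp
      then show "?x \<notin> interior K" using p by simp
      show "?x + u *\<^sub>R v (Suc k) \<notin> interior K" if u: "0 \<le> u" "u \<le> \<tau> (Suc (Suc k)) - \<tau> (Suc k)" for u
      proof -
        have "\<gamma> (\<tau> (Suc k) + u) = ?x + (\<tau> (Suc k) + u - \<tau> (Suc k)) *\<^sub>R v (Suc k)"
          by (rule piece[OF Suc.prems, THEN conjunct2, THEN conjunct2, rule_format]) (use u in auto)
        then show ?thesis using out[of "\<tau> (Suc k) + u"] u by simp
      qed
    qed
    then show ?case using Suc.IH one[OF Suc.prems] Suc.prems by (simp add: algebra_simps)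
  qed
  have "s * (J T - J 0) \<le> sqrt 2 * T + 4"
  proof (cases N)
    case 0 then show ?thesis using \<tau>0 \<tau>N by simp
  next
    case (Suc k)
    have "\<bar>pot (v k) (\<gamma> T)\<bar> \<le> 2" "\<bar>pot (v 0) (\<gamma> 0)\<bar> \<le> 2"
      using trajectory_pieceD(1)[OF tr] T0 by (auto intro!: pot_bounded)
    then show ?thesis using sum[of k] Suc \<tau>N by auto
  qed
  moreover have "s * (4 * (\<theta> T - \<theta> 0)) = s * (J T - J 0) + s * (4 * (phi c (\<gamma> T) - phi c (\<gamma> 0)))
       + s * (quadrant (m (\<gamma> 0)) (n (\<gamma> 0)) - quadrant (m (\<gamma> T)) (n (\<gamma> T)))"
    by (simp add: J_def algebra_simps)
  moreover have "s * (4 * (phi c (\<gamma> T) - phi c (\<gamma> 0))) \<le> 4"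
  proof -
    have "\<bar>phi c x\<bar> \<le> 1/2" for x
      using Arg_bounded[of "x - c"] by (simp add: phi_def abs_divide abs_le_iff)
    from this[of "\<gamma> T"] this[of "\<gamma> 0"] have "\<bar>4 * (phi c (\<gamma> T) - phi c (\<gamma> 0))\<bar> \<le> 4"
      unfolding abs_le_iff by auto
    then show ?thesis using s by (auto simp: abs_if split: if_splits)
  qed
  moreover have "s * (quadrant (m (\<gamma> 0)) (n (\<gamma> 0)) - quadrant (m (\<gamma> T)) (n (\<gamma> T))) \<le> 4"
  proof -
    have "\<bar>quadrant (m (\<gamma> 0)) (n (\<gamma> 0)) - quadrant (m (\<gamma> T)) (n (\<gamma> T))\<bar> \<le> 4"
      using quadrant_bounded[of "m (\<gamma> 0)" "n (\<gamma> 0)"] quadrant_bounded[of "m (\<gamma> T)" "n (\<gamma> T)"] by linarith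
    then show ?thesis using s by (auto simp: abs_if split: if_splits)
  qed
  ultimately show ?thesis by (simp add: algebra_simps)
qed

end

theorem (in small_body) displacement_bound:
  assumes tr: "trajectory_piece K T \<gamma>" and z: "z \<in> interior K" and T: "0 \<le> T"
    and d: "has_displacement z T \<gamma> d"
  shows "\<bar>d\<bar> \<le> sqrt 2 / 4 * T + 4"
proof -
  have ne: "K \<noteq> {}" using z interior_subset by auto
  have cont: "continuous_on K (\<lambda>x. x \<bullet> e)" for e by (intro continuous_intros)
  have ext: "\<exists>y\<in>K. \<forall>x\<in>K. y \<bullet> e \<le> x \<bullet> e" "\<exists>y\<in>K. \<forall>x\<in>K. x \<bullet> e \<le> y \<bullet> e" for e
    using continuous_attains_inf[OF compact ne cont] continuous_attains_sup[OF compact ne cont]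
    by simp_all
  obtain l r where l: "l \<in> K" "\<And>x. x \<in> K \<Longrightarrow> l \<bullet> 1 \<le> x \<bullet> 1" and r: "r \<in> K" "\<And>x. x \<in> K \<Longrightarrow> x \<bullet> 1 \<le> r \<bullet> 1"
    using ext[of 1] by blast
  obtain b a where b: "b \<in> K" "\<And>x. x \<in> K \<Longrightarrow> b \<bullet> \<i> \<le> x \<bullet> \<i>" and a: "a \<in> K" "\<And>x. x \<in> K \<Longrightarrow> x \<bullet> \<i> \<le> a \<bullet> \<i>"
    using ext[of \<i>] by blast
  interpret horiz: cut K 1 \<i> l r by unfold_locales (use l r in auto)
  interpret vert: cut K \<i> 1 b a by unfold_locales (use a b in auto)
  obtain e where e: "e > 0" "\<And>s. 0 < s \<Longrightarrow> s \<le> e \<Longrightarrow> l + s *\<^sub>R 1 \<in> interior K"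
    using ray_enters_interior[OF l(1) horiz.normals_at_ends(1), of 1] by auto
  define c where "c = l + e *\<^sub>R 1"
  interpret crossed_cuts K l r b a c
  proof unfold_locales
    show "c \<in> interior K" using e by (simp add: c_def)
    show "Im c = Im l" "Re l < Re c" using e by (auto simp: c_def)
    show "x \<in> interior K" if "Im x = Im l" "Re l < Re x" "Re x \<le> Re c" for x
    proof -
      have "x = l + (Re x - Re l) *\<^sub>R 1" using that by (simp add: complex_eq_iff)
      then show ?thesis using e(2)[of "Re x - Re l"] that by (simp add: c_def)
    qed
  qed
  obtain d' where d': "has_displacement c T \<gamma> d'" "\<bar>d' - d\<bar> \<le> 1"
    using displacement_change_centre[OF z c trajectory_piece_continuous[OF tr] _ T d]
      trajectory_pieceD(2)[OF tr] by auto
  then obtain \<theta> where th: "continuous_on {0..T} \<theta>" "\<And>t. t \<in> {0..T} \<Longrightarrow> \<theta> t - phi c (\<gamma> t) \<in> \<int>"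
    "d' = \<theta> T - \<theta> 0" by (auto simp: has_displacement_def)
  have "\<bar>d'\<bar> \<le> sqrt 2 / 4 * T + 3"
    using displacement_le[OF tr th(1,2), of 1] displacement_le[OF tr th(1,2), of "-1"] th(3) by auto
  then show ?thesis using d'(2) by linarith
qed

section \<open>Folding the plane onto the square\<close>

text \<open>The triangular wave \<open>fold1\<close> reflects the real line at the half-integers onto \<open>[-1/2, 1/2]\<close>.\<close>

definition cell :: "real \<Rightarrow> int" where "cell x = \<lfloor>x + 1/2\<rfloor>"

definition orientation :: "real \<Rightarrow> real" where "orientation x = (if even (cell x) then 1 else - 1)"

definition fold1 :: "real \<Rightarrow> real" where "fold1 x = orientation x * (x - of_int (cell x))"

lemma orientation_cases: "orientation x = 1 \<or> orientation x = - 1"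
  by (simp add: orientation_def)

lemma orientation_square [simp]: "orientation x * orientation x = 1"
    "orientation x * (orientation x * y) = y" "\<bar>orientation x\<bar> = 1"
  by (simp_all add: orientation_def)

lemma cell_bounds: "of_int (cell x) - 1/2 \<le> x" "x < of_int (cell x) + 1/2"
  unfolding cell_def by linarith+

lemma cell_unique: "of_int k - 1/2 \<le> x \<Longrightarrow> x < of_int k + 1/2 \<Longrightarrow> cell x = k"
  unfolding cell_def by linarith

lemma fold1_on_cell:
  assumes "of_int k - 1/2 \<le> x" "x \<le> of_int k + 1/2"
  shows "fold1 x = (if even k then 1 else - 1) * (x - of_int k)"
proof (cases "x = of_int k + 1/2")
  case True
  have "cell x = k + 1" by (rule cell_unique) (use True in auto)
  then show ?thesis using True by (simp add: fold1_def orientation_def)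
next
  case False
  then have "cell x = k" using assms by (intro cell_unique) auto
  then show ?thesis by (simp add: fold1_def orientation_def)
qed

lemma abs_fold1: "\<bar>fold1 x\<bar> = \<bar>x - of_int (cell x)\<bar>"
  by (simp add: fold1_def abs_mult)

lemma fold1_bound: "\<bar>fold1 x\<bar> \<le> 1/2"
  using cell_bounds[of x] unfolding abs_fold1 by linarith

lemma fold1_inner:
  assumes "\<bar>fold1 x\<bar> + \<bar>t\<bar> < 1/2"
  shows "fold1 (x + t) = fold1 x + orientation x * t" "orientation (x + t) = orientation x"
proof -
  have c: "cell (x + t) = cell x"
    by (rule cell_unique; use assms in \<open>unfold abs_fold1, linarith\<close>)
  then show "orientation (x + t) = orientation x" by (simp add: orientation_def)
  then show "fold1 (x + t) = fold1 x + orientation x * t"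
    using c by (simp add: fold1_def algebra_simps)
qed

text \<open>The slopes of \<open>fold1\<close> to the right and to the left of a point differ exactly at the walls.\<close>

definition left_orientation :: "real \<Rightarrow> real" where
  "left_orientation x = (if x = of_int (cell x) - 1/2 then - orientation x else orientation x)"

lemma left_orientation_cases: "left_orientation x = 1 \<or> left_orientation x = - 1"
  by (simp add: left_orientation_def orientation_def)

lemma fold1_wall: "\<bar>fold1 x\<bar> = 1/2 \<longleftrightarrow> left_orientation x = - orientation x"
proof -
  have "\<bar>x - of_int (cell x)\<bar> = 1/2 \<longleftrightarrow> x = of_int (cell x) - 1/2"
    using cell_bounds[of x] by linarith
  then show ?thesis
    unfolding abs_fold1 using orientation_cases[of x] by (auto simp: left_orientation_def)
qed

lemma fold1_not_wall: "\<bar>fold1 x\<bar> \<noteq> 1/2 \<longleftrightarrow> left_orientation x = orientation x"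
  using fold1_wall[of x] orientation_cases[of x] by (auto simp: left_orientation_def)

lemma fold1_right:
  "\<exists>d>0. \<forall>s. 0 \<le> s \<and> s \<le> d \<longrightarrow> fold1 (x + s) = fold1 x + orientation x * s"
proof (intro exI conjI allI impI)
  let ?d = "of_int (cell x) + 1/2 - x"
  show "?d > 0" using cell_bounds[of x] by simp
  show "fold1 (x + s) = fold1 x + orientation x * s" if "0 \<le> s \<and> s \<le> ?d" for s
    using fold1_on_cell[of "cell x" "x + s"] fold1_on_cell[of "cell x" x] that cell_bounds[of x]
    by (auto simp: orientation_def algebra_simps)
qed

lemma fold1_left:
  "\<exists>d>0. \<forall>s. 0 \<le> s \<and> s \<le> d \<longrightarrow> fold1 (x - s) = fold1 x - left_orientation x * s"
proof (cases "x = of_int (cell x) - 1/2")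
  case True
  have "fold1 (x - s) = fold1 x - left_orientation x * s" if "0 \<le> s" "s \<le> 1" for s
    using fold1_on_cell[of "cell x - 1" "x - s"] that True
    by (auto simp: fold1_def orientation_def left_orientation_def algebra_simps)
  then show ?thesis by (intro exI[of _ 1]) auto
next
  case False
  define d where "d = x - of_int (cell x) + 1/2"
  have "fold1 (x - s) = fold1 x - left_orientation x * s" if "0 \<le> s" "s \<le> d" for s
    using fold1_on_cell[of "cell x" "x - s"] that cell_bounds[of x] False
    by (auto simp: d_def fold1_def orientation_def left_orientation_def algebra_simps)
  moreover have "d > 0" using cell_bounds[of x] False by (simp add: d_def)
  ultimately show ?thesis by blast
qed

lemma fold1_lipschitz: "\<bar>fold1 x - fold1 y\<bar> \<le> \<bar>x - y\<bar>"
proof (induction x y rule: linorder_wlog)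
  case (le x y)
  consider "cell x = cell y" | "cell y = cell x + 1" | "cell y \<ge> cell x + 2"
    using floor_mono[of "x + 1/2" "y + 1/2"] le unfolding cell_def by linarith
  then show ?case
  proof cases
    case 1
    then have "fold1 x - fold1 y = orientation x * (x - y)"
      by (simp add: fold1_def orientation_def algebra_simps)
    then show ?thesis by (simp add: abs_mult)
  next
    case 2
    then show ?thesis using le cell_bounds[of x] cell_bounds[of y]
      by (auto simp: fold1_def orientation_def abs_le_iff)
  next
    case 3
    then have "y - x \<ge> 1" using cell_bounds[of x] cell_bounds[of y] by linarith
    then show ?thesis using fold1_bound[of x] fold1_bound[of y] by linarith
  qed
qed (simp add: abs_minus_commute)

text \<open>The velocity after (\<open>vr\<close>) and before (\<open>vl\<close>) the passage through a point, for a point that moves with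
constant velocity before folding.\<close>

definition vr :: "real \<Rightarrow> real \<Rightarrow> real" where
  "vr x u = (if 0 \<le> u then orientation x else left_orientation x) * u"

definition vl :: "real \<Rightarrow> real \<Rightarrow> real" where
  "vl x u = (if 0 \<le> u then left_orientation x else orientation x) * u"

lemma vr_vl_wall: "\<bar>fold1 x\<bar> = 1/2 \<Longrightarrow> vr x u = - vl x u"
  using fold1_wall[of x] by (simp add: vr_def vl_def)

lemma vr_vl_inside: "\<bar>fold1 x\<bar> \<noteq> 1/2 \<Longrightarrow> vr x u = orientation x * u \<and> vl x u = orientation x * u"
  using fold1_not_wall[of x] by (simp add: vr_def vl_def)

lemma abs_vr: "\<bar>vr x u\<bar> = \<bar>u\<bar>" and abs_vl: "\<bar>vl x u\<bar> = \<bar>u\<bar>"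
  using left_orientation_cases[of x] orientation_cases[of x] by (auto simp: vr_def vl_def abs_mult)

lemma fold1_vr: "\<exists>d>0. \<forall>s. 0 \<le> s \<and> s \<le> d \<longrightarrow> fold1 (x + s * u) = fold1 x + s * vr x u"
proof (cases "0 \<le> u")
  case True
  obtain d where d: "d > 0" "\<And>s. 0 \<le> s \<Longrightarrow> s \<le> d \<Longrightarrow> fold1 (x + s) = fold1 x + orientation x * s"
    using fold1_right[of x] by auto
  have "fold1 (x + s * u) = fold1 x + s * vr x u" if "0 \<le> s" "s \<le> d / (u + 1)" for s
  proof -
    have "s * (u + 1) \<le> d" using that True by (simp add: pos_le_divide_eq)
    then show ?thesis using d(2)[of "s * u"] that True by (simp add: vr_def algebra_simps)
  qed
  then show ?thesis using d(1) True by (intro exI[of _ "d / (u + 1)"]) auto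
next
  case False
  obtain d where d: "d > 0" "\<And>s. 0 \<le> s \<Longrightarrow> s \<le> d \<Longrightarrow> fold1 (x - s) = fold1 x - left_orientation x * s"
    using fold1_left[of x] by auto
  have "fold1 (x + s * u) = fold1 x + s * vr x u" if "0 \<le> s" "s \<le> d / (- u)" for s
  proof -
    have "s * (- u) \<le> d" using that False by (subst (asm) pos_le_divide_eq) auto
    then show ?thesis using d(2)[of "s * (- u)"] that False
      by (simp add: vr_def mult_nonneg_nonpos algebra_simps)
  qed
  moreover have "d / (- u) > 0" using d(1) False by (intro divide_pos_pos) auto
  ultimately show ?thesis by blast
qed

lemma fold1_vl: "\<exists>d>0. \<forall>s. 0 \<le> s \<and> s \<le> d \<longrightarrow> fold1 (x - s * u) = fold1 x - s * vl x u"
proof (cases "u = 0")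
  case True then show ?thesis by (intro exI[of _ 1]) (simp add: vl_def)
next
  case False
  then have "vr x (- u) = - vl x u" by (simp add: vr_def vl_def)
  then show ?thesis using fold1_vr[of x "- u"] by simp
qed

definition fold2 :: "complex \<Rightarrow> complex" where "fold2 X = Complex (fold1 (Re X)) (fold1 (Im X))"

definition VR :: "complex \<Rightarrow> complex \<Rightarrow> complex" where
  "VR X V = Complex (vr (Re X) (Re V)) (vr (Im X) (Im V))"

definition VL :: "complex \<Rightarrow> complex \<Rightarrow> complex" where
  "VL X V = Complex (vl (Re X) (Re V)) (vl (Im X) (Im V))"

text \<open>The linear part of the folding in the interior of a cell.\<close>

definition turn :: "complex \<Rightarrow> complex \<Rightarrow> complex" where
  "turn X W = Complex (orientation (Re X) * Re W) (orientation (Im X) * Im W)"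

lemma norm_eq_abs: "\<bar>Re x\<bar> = \<bar>Re y\<bar> \<Longrightarrow> \<bar>Im x\<bar> = \<bar>Im y\<bar> \<Longrightarrow> cmod x = cmod y"
  unfolding cmod_def by (metis power2_abs)

lemma norm_VR: "norm (VR X V) = norm V" and norm_VL: "norm (VL X V) = norm V"
  and norm_turn: "norm (turn X V) = norm V"
  by (auto intro!: norm_eq_abs simp: VR_def VL_def turn_def abs_vr abs_vl abs_mult)

lemma turn_turn [simp]: "turn X (turn X V) = V"
  by (simp add: turn_def complex_eq_iff)

lemma inner_turn: "turn X V \<bullet> turn X W = V \<bullet> W"
  by (simp add: turn_def inner_complex_def mult_ac)

lemma turn_linear: "turn X (V + W) = turn X V + turn X W" "turn X (V - W) = turn X V - turn X W"
  "turn X (c *\<^sub>R V) = c *\<^sub>R turn X V"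
  by (simp_all add: turn_def complex_eq_iff algebra_simps)

lemma fold_square: "fold2 X \<in> square"
  using fold1_bound by (simp add: fold2_def square_def)

lemma fold_lipschitz: "norm (fold2 X - fold2 Y) \<le> norm (X - Y)"
  unfolding cmod_def fold2_def
  by (intro real_sqrt_le_mono add_mono) (auto simp flip: abs_le_square_iff intro: fold1_lipschitz)

lemma continuous_fold: "continuous_on S fold2"
proof (rule continuous_on_subset)
  show "continuous_on UNIV fold2"
    unfolding continuous_on_iff dist_norm using fold_lipschitz by (meson le_less_trans)
qed simp

lemma fold_VR: "\<exists>d>0. \<forall>s. 0 \<le> s \<and> s \<le> d \<longrightarrow> fold2 (X + s *\<^sub>R V) = fold2 X + s *\<^sub>R VR X V"
proof -
  obtain d1 where "d1 > 0" "\<And>s. 0 \<le> s \<Longrightarrow> s \<le> d1 \<Longrightarrow> fold1 (Re X + s * Re V) = fold1 (Re X) + s * vr (Re X) (Re V)"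
    using fold1_vr by blast
  moreover obtain d2 where "d2 > 0" "\<And>s. 0 \<le> s \<Longrightarrow> s \<le> d2 \<Longrightarrow> fold1 (Im X + s * Im V) = fold1 (Im X) + s * vr (Im X) (Im V)"
    using fold1_vr by blast
  ultimately show ?thesis
    by (intro exI[of _ "min d1 d2"]) (simp add: fold2_def VR_def complex_eq_iff)
qed

lemma fold_VL: "\<exists>d>0. \<forall>s. 0 \<le> s \<and> s \<le> d \<longrightarrow> fold2 (X - s *\<^sub>R V) = fold2 X - s *\<^sub>R VL X V"
proof -
  obtain d1 where "d1 > 0" "\<And>s. 0 \<le> s \<Longrightarrow> s \<le> d1 \<Longrightarrow> fold1 (Re X - s * Re V) = fold1 (Re X) - s * vl (Re X) (Re V)"
    using fold1_vl by blast
  moreover obtain d2 where "d2 > 0" "\<And>s. 0 \<le> s \<Longrightarrow> s \<le> d2 \<Longrightarrow> fold1 (Im X - s * Im V) = fold1 (Im X) - s * vl (Im X) (Im V)"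
    using fold1_vl by blast
  ultimately show ?thesis
    by (intro exI[of _ "min d1 d2"]) (simp add: fold2_def VL_def complex_eq_iff)
qed

lemma (in small_body) fold_near_body:
  assumes "fold2 X \<in> K" "norm W \<le> 1/10"
  shows "fold2 (X + W) = fold2 X + turn X W" "turn (X + W) = turn X"
proof -
  have b: "\<bar>fold1 (Re X)\<bar> < 2/5" "\<bar>fold1 (Im X)\<bar> < 2/5"
    using coordinates_small[OF assms(1)] by (auto simp: fold2_def)
  have "\<bar>Re W\<bar> \<le> 1/10" "\<bar>Im W\<bar> \<le> 1/10"
    using abs_Re_le_cmod[of W] abs_Im_le_cmod[of W] assms(2) by auto
  then have "\<bar>fold1 (Re X)\<bar> + \<bar>Re W\<bar> < 1/2" "\<bar>fold1 (Im X)\<bar> + \<bar>Im W\<bar> < 1/2" using b by auto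
  note this[THEN fold1_inner(1)] this[THEN fold1_inner(2)]
  then show "fold2 (X + W) = fold2 X + turn X W" "turn (X + W) = turn X"
    by (auto simp: fold2_def turn_def complex_eq_iff fun_eq_iff)
qed

lemma (in small_body) velocity_at_body:
  assumes "fold2 X \<in> K"
  shows "VR X V = turn X V" "VL X V = turn X V" "\<bar>Re (fold2 X)\<bar> \<noteq> 1/2" "\<bar>Im (fold2 X)\<bar> \<noteq> 1/2"
proof -
  have b: "\<bar>fold1 (Re X)\<bar> < 2/5" "\<bar>fold1 (Im X)\<bar> < 2/5"
    using coordinates_small[OF assms(1)] by (auto simp: fold2_def)
  then show "VR X V = turn X V" "VL X V = turn X V" "\<bar>Re (fold2 X)\<bar> \<noteq> 1/2" "\<bar>Im (fold2 X)\<bar> \<noteq> 1/2"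
    using vr_vl_inside[of "Re X"] vr_vl_inside[of "Im X"]
    by (auto simp: VR_def VL_def turn_def fold2_def)
qed

context small_body
begin

lemma law_bounce:
  assumes X: "fold2 X \<in> K" "fold2 X \<notin> interior K" and n: "outer_unit_normal K (fold2 X) (turn X k)"
    and W: "W = V - (2 * (V \<bullet> k)) *\<^sub>R k"
  shows "billiard_law K (fold2 X) (VL X V) (VR X W)"
proof -
  have "fold2 X \<in> frontier K" using X by (simp add: frontier_iff)
  moreover have "turn X W = turn X V - (2 * (turn X V \<bullet> turn X k)) *\<^sub>R turn X k"
    by (simp add: W turn_linear inner_turn)
  ultimately show ?thesis
    using n velocity_at_body[OF X(1)] unfolding billiard_law_def by auto
qed

text \<open>A straight passage is always lawful: at a wall the folding reflects the velocity, and at the body a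
passage that does not enter it on either side is tangential.\<close>

lemma law_straight:
  assumes X: "fold2 X \<notin> interior K"
    and d: "d > 0" and fwd: "\<And>s. 0 \<le> s \<Longrightarrow> s \<le> d \<Longrightarrow> fold2 (X + s *\<^sub>R V) \<notin> interior K"
    and e: "e > 0" and bwd: "\<And>s. 0 \<le> s \<Longrightarrow> s \<le> e \<Longrightarrow> fold2 (X - s *\<^sub>R V) \<notin> interior K"
  shows "billiard_law K (fold2 X) (VL X V) (VR X V)"
proof (cases "fold2 X \<in> K")
  case True
  then have fr: "fold2 X \<in> frontier K" using X by (simp add: frontier_iff)
  obtain n where n: "outer_unit_normal K (fold2 X) n" by (rule normal_exists[OF fr])
  define k where "k = turn X n"
  have eq: "fold2 (X + s *\<^sub>R V) = fold2 X + s *\<^sub>R turn X V" if "\<bar>s\<bar> * norm V \<le> 1/10" for s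
    using fold_near_body(1)[OF True, of "s *\<^sub>R V"] that by (simp add: turn_linear)
  define c where "c = 1 / (10 * (norm V + 1))"
  have c: "c > 0" by (simp add: c_def add_nonneg_pos)
  have cV: "\<bar>s\<bar> * norm V \<le> 1/10" if "\<bar>s\<bar> \<le> c" for s
  proof -
    have "\<bar>s\<bar> * norm V \<le> c * (norm V + 1)" using that c by (intro mult_mono) auto
    also have "\<dots> = 1/10"
    proof -
      have "norm V + 1 \<noteq> 0" using norm_ge_zero[of V] by linarith
      then show ?thesis by (simp add: c_def divide_simps)
    qed
    finally show ?thesis .
  qed
  have "turn X V \<bullet> n \<ge> 0"
  proof (rule free_direction_outward[OF True n])
    show "min c d > 0" using c d by simp
    show "fold2 X + s *\<^sub>R turn X V \<notin> interior K" if "0 \<le> s" "s \<le> min c d" for s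
      using fwd[of s] that eq[OF cV, of s] by simp
  qed
  moreover have "(- turn X V) \<bullet> n \<ge> 0"
  proof (rule free_direction_outward[OF True n])
    show "min c e > 0" using c e by simp
    show "fold2 X + s *\<^sub>R (- turn X V) \<notin> interior K" if "0 \<le> s" "s \<le> min c e" for s
      using bwd[of s] that eq[OF cV, of "- s"] by simp
  qed
  ultimately have "turn X V \<bullet> turn X k = 0" by (simp add: k_def)
  then have "V \<bullet> k = 0" by (simp add: inner_turn)
  then show ?thesis
    using n by (intro law_bounce[OF True X, of k V V]) (auto simp: k_def)
next
  case False
  have "fold2 X \<notin> frontier K" using False by (simp add: frontier_iff)
  then show ?thesis
    using vr_vl_wall[of "Re X"] vr_vl_wall[of "Im X"] vr_vl_inside[of "Re X"] vr_vl_inside[of "Im X"]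
    unfolding billiard_law_def by (auto simp: fold2_def VL_def VR_def complex_eq_iff)
qed

end

section \<open>Folded lines as billiard paths\<close>

text \<open>A nonempty trajectory piece that remembers its first and last velocities, so that pieces can be joined.\<close>

definition billiard_path :: "complex set \<Rightarrow> real \<Rightarrow> real \<Rightarrow> (real \<Rightarrow> complex) \<Rightarrow> complex \<Rightarrow> complex \<Rightarrow> bool" where
  "billiard_path K a b \<gamma> v0 v1 \<longleftrightarrow>
     (\<exists>(m::nat) \<tau> v. 0 < m \<and> \<tau> 0 = a \<and> \<tau> m = b \<and>
        (\<forall>i<m. \<tau> i < \<tau> (Suc i) \<and> norm (v i) = 1 \<and>
           (\<forall>t\<in>{\<tau> i..\<tau> (Suc i)}. \<gamma> t = \<gamma> (\<tau> i) + (t - \<tau> i) *\<^sub>R v i)) \<and>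
        (\<forall>i. Suc i < m \<longrightarrow> billiard_law K (\<gamma> (\<tau> (Suc i))) (v i) (v (Suc i))) \<and>
        v 0 = v0 \<and> v (m - 1) = v1)"

lemma billiard_path_single:
  assumes "a < b" "norm v = 1" "\<And>t. t \<in> {a..b} \<Longrightarrow> \<gamma> t = \<gamma> a + (t - a) *\<^sub>R v"
  shows "billiard_path K a b \<gamma> v v"
  unfolding billiard_path_def
proof (intro exI conjI allI impI ballI)
  define \<tau> where "\<tau> = (\<lambda>i::nat. if i = 0 then a else b)"
  show "(0::nat) < 1" by simp
  show "\<tau> 0 = a" "\<tau> 1 = b" by (simp_all add: \<tau>_def)
  fix i :: nat assume i: "i < 1"
  show "\<tau> i < \<tau> (Suc i)" using assms(1) i by (simp add: \<tau>_def)
  show "norm v = 1" by fact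
  fix t assume "t \<in> {\<tau> i..\<tau> (Suc i)}"
  then have "t \<in> {a..b}" "\<tau> i = a" using i by (auto simp: \<tau>_def)
  then show "\<gamma> t = \<gamma> (\<tau> i) + (t - \<tau> i) *\<^sub>R v" using assms(3)[of t] by metis
qed auto

lemma billiard_path_join:
  assumes 1: "billiard_path K a b \<gamma> v0 v1" and 2: "billiard_path K b c \<gamma> w0 w1"
    and law: "billiard_law K (\<gamma> b) v1 w0"
  shows "billiard_path K a c \<gamma> v0 w1"
proof -
  obtain m \<tau> v where p: "0 < m" "\<tau> 0 = a" "\<tau> m = b" "v 0 = v0" "v (m - 1) = v1"
    and p1: "\<And>i. i < m \<Longrightarrow> \<tau> i < \<tau> (Suc i) \<and> norm (v i) = 1 \<and>
           (\<forall>t\<in>{\<tau> i..\<tau> (Suc i)}. \<gamma> t = \<gamma> (\<tau> i) + (t - \<tau> i) *\<^sub>R v i)"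
    and p2: "\<And>i. Suc i < m \<Longrightarrow> billiard_law K (\<gamma> (\<tau> (Suc i))) (v i) (v (Suc i))"
    using 1 unfolding billiard_path_def by metis
  obtain k \<sigma> w where q: "0 < k" "\<sigma> 0 = b" "\<sigma> k = c" "w 0 = w0" "w (k - 1) = w1"
    and q1: "\<And>i. i < k \<Longrightarrow> \<sigma> i < \<sigma> (Suc i) \<and> norm (w i) = 1 \<and>
           (\<forall>t\<in>{\<sigma> i..\<sigma> (Suc i)}. \<gamma> t = \<gamma> (\<sigma> i) + (t - \<sigma> i) *\<^sub>R w i)"
    and q2: "\<And>i. Suc i < k \<Longrightarrow> billiard_law K (\<gamma> (\<sigma> (Suc i))) (w i) (w (Suc i))"
    using 2 unfolding billiard_path_def by metis
  define \<rho> where "\<rho> i = (if i \<le> m then \<tau> i else \<sigma> (i - m))" for i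
  define u where "u i = (if i < m then v i else w (i - m))" for i
  have \<rho>m: "\<rho> (m + j) = \<sigma> j" for j using p q by (simp add: \<rho>_def)
  have "\<rho> i < \<rho> (Suc i) \<and> norm (u i) = 1 \<and> (\<forall>t\<in>{\<rho> i..\<rho> (Suc i)}. \<gamma> t = \<gamma> (\<rho> i) + (t - \<rho> i) *\<^sub>R u i)"
    if "i < m + k" for i
  proof (cases "i < m")
    case True
    then have "\<rho> i = \<tau> i" "\<rho> (Suc i) = \<tau> (Suc i)" "u i = v i" by (auto simp: \<rho>_def u_def)
    then show ?thesis using p1[OF True] by metis
  next
    case False
    then obtain j where j: "i = m + j" using le_Suc_ex[of m i] by auto
    then have "\<rho> i = \<sigma> j" "\<rho> (Suc i) = \<sigma> (Suc j)" "u i = w j"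
      using \<rho>m[of j] \<rho>m[of "Suc j"] by (auto simp: u_def)
    then show ?thesis using q1[of j] that j by (metis add_less_cancel_left)
  qed
  moreover have "billiard_law K (\<gamma> (\<rho> (Suc i))) (u i) (u (Suc i))" if "Suc i < m + k" for i
  proof -
    consider "Suc i < m" | "Suc i = m" | j where "i = m + j"
      using le_Suc_ex[of m i] by force
    then show ?thesis
    proof cases
      case 1 then show ?thesis using p2[of i] by (simp add: \<rho>_def u_def)
    next
      case 2 then show ?thesis using law p q by (auto simp: \<rho>_def u_def)
    next
      case 3 then show ?thesis using q2[of j] \<rho>m[of "Suc j"] that by (simp add: u_def)
    qed
  qed
  moreover have "\<rho> 0 = a" "\<rho> (m + k) = c" "u 0 = v0" "u (m + k - 1) = w1" "0 < m + k"
    using p q \<rho>m[of k] by (auto simp: \<rho>_def u_def)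
  ultimately show ?thesis unfolding billiard_path_def by metis
qed

lemma billiard_path_trajectory:
  assumes "billiard_path K 0 T \<gamma> v0 v1" "\<And>t. t \<in> {0..T} \<Longrightarrow> \<gamma> t \<in> square - interior K"
  shows "trajectory_piece K T \<gamma>"
  using assms unfolding billiard_path_def trajectory_piece_def by metis

lemma billiard_path_cong:
  assumes "billiard_path K a b \<gamma> v0 v1" "\<And>t. t \<in> {a..b} \<Longrightarrow> \<gamma> t = \<delta> t"
  shows "billiard_path K a b \<delta> v0 v1"
proof -
  obtain m \<tau> v where p: "0 < m" "\<tau> 0 = a" "\<tau> m = b" "v 0 = v0" "v (m - 1) = v1"
    and p1: "\<And>i. i < m \<Longrightarrow> \<tau> i < \<tau> (Suc i) \<and> norm (v i) = 1 \<and>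
           (\<forall>t\<in>{\<tau> i..\<tau> (Suc i)}. \<gamma> t = \<gamma> (\<tau> i) + (t - \<tau> i) *\<^sub>R v i)"
    and p2: "\<And>i. Suc i < m \<Longrightarrow> billiard_law K (\<gamma> (\<tau> (Suc i))) (v i) (v (Suc i))"
    using assms(1) unfolding billiard_path_def by metis
  note mono = partition_mono[of m \<tau>, OF conjunct1[OF p1]]
  have eq: "\<gamma> t = \<delta> t" if "i < m" "\<tau> i \<le> t" "t \<le> \<tau> (Suc i)" for i t
    using mono[of 0 i] mono[of "Suc i" m] that p by (intro assms(2)) auto
  have "\<tau> i < \<tau> (Suc i) \<and> norm (v i) = 1 \<and>
           (\<forall>t\<in>{\<tau> i..\<tau> (Suc i)}. \<delta> t = \<delta> (\<tau> i) + (t - \<tau> i) *\<^sub>R v i)" if "i < m" for i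
    using p1[OF that] eq[OF that] by (metis atLeastAtMost_iff less_imp_le order_refl)
  moreover have "billiard_law K (\<delta> (\<tau> (Suc i))) (v i) (v (Suc i))" if "Suc i < m" for i
    using p2[OF that] p1[of i, THEN conjunct1] eq[of i "\<tau> (Suc i)"] that by simp
  ultimately show ?thesis using p unfolding billiard_path_def by metis
qed

text \<open>Locally a folded line has at most one corner; the local pieces are joined along the interval.\<close>

lemma (in small_body) fold_segment:
  assumes V: "norm V = 1" and ab: "a < b"
    and out: "\<And>t. t \<in> {a..b} \<Longrightarrow> fold2 (X + t *\<^sub>R V) \<notin> interior K"
  shows "billiard_path K a b (\<lambda>t. fold2 (X + t *\<^sub>R V)) (VR (X + a *\<^sub>R V) V) (VL (X + b *\<^sub>R V) V)"
proof -
  define Y where "Y t = X + t *\<^sub>R V" for t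
  have Yadd: "Y (t + s) = Y t + s *\<^sub>R V" "Y (t - s) = Y t - s *\<^sub>R V" for t s
    by (simp_all add: Y_def algebra_simps)
  define \<gamma> where "\<gamma> t = fold2 (Y t)" for t
  define P where "P p q \<longleftrightarrow> (a \<le> p \<and> p < q \<and> q \<le> b \<longrightarrow> billiard_path K p q \<gamma> (VR (Y p) V) (VL (Y q) V))" for p q
  have law: "billiard_law K (\<gamma> t) (VL (Y t) V) (VR (Y t) V)" if t: "a < t" "t < b" for t
    unfolding \<gamma>_def
  proof (rule law_straight)
    show "fold2 (Y t) \<notin> interior K" using out[of t] t by (simp add: Y_def)
    show "b - t > 0" "t - a > 0" using t by auto
    show "fold2 (Y t + s *\<^sub>R V) \<notin> interior K" if "0 \<le> s" "s \<le> b - t" for s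
      using out[of "t + s"] that t Yadd(1)[of t s] by (simp add: Y_def add.assoc)
    show "fold2 (Y t - s *\<^sub>R V) \<notin> interior K" if "0 \<le> s" "s \<le> t - a" for s
      using out[of "t - s"] that t Yadd(2)[of t s] by (simp add: Y_def add_diff_eq)
  qed
  have "P a b"
  proof (rule Bolzano)
    show "a \<le> b" using ab by simp
    show "P p u" if "P p q" "P q u" "p \<le> q" "q \<le> u" for p q u
    proof (cases "p = q \<or> q = u")
      case False
      then show ?thesis using that law[of q] unfolding P_def
        by (auto intro: billiard_path_join)
    qed (use that in auto)
  next
    fix t0 assume "a \<le> t0" "t0 \<le> b"
    obtain d where d: "d > 0" "\<And>s. 0 \<le> s \<Longrightarrow> s \<le> d \<Longrightarrow> fold2 (Y t0 + s *\<^sub>R V) = fold2 (Y t0) + s *\<^sub>R VR (Y t0) V"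
      using fold_VR by blast
    obtain e where e: "e > 0" "\<And>s. 0 \<le> s \<Longrightarrow> s \<le> e \<Longrightarrow> fold2 (Y t0 - s *\<^sub>R V) = fold2 (Y t0) - s *\<^sub>R VL (Y t0) V"
      using fold_VL by blast
    have right: "\<gamma> t = \<gamma> t0 + (t - t0) *\<^sub>R VR (Y t0) V" if "t0 \<le> t" "t \<le> t0 + d" for t
      using d(2)[of "t - t0"] Yadd(1)[of t0 "t - t0"] that by (simp add: \<gamma>_def)
    have left: "\<gamma> t = \<gamma> t0 + (t - t0) *\<^sub>R VL (Y t0) V" if "t \<le> t0" "t0 - e \<le> t" for t
    proof -
      have "fold2 (Y t) = fold2 (Y t0) - (t0 - t) *\<^sub>R VL (Y t0) V"
        using e(2)[of "t0 - t"] Yadd(2)[of t0 "t0 - t"] that by simp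
      then show ?thesis by (simp add: \<gamma>_def scaleR_left_diff_distrib)
    qed
    \<comment> \<open>One-sided velocities are determined by the path on any one-sided neighbourhood.\<close>
    have VRu: "VR (Y p) V = w" if "p < q" "\<And>t. p \<le> t \<Longrightarrow> t \<le> q \<Longrightarrow> \<gamma> t = \<gamma> p + (t - p) *\<^sub>R w" for p q w
    proof -
      obtain f where f: "f > 0" "\<And>s. 0 \<le> s \<Longrightarrow> s \<le> f \<Longrightarrow> fold2 (Y p + s *\<^sub>R V) = fold2 (Y p) + s *\<^sub>R VR (Y p) V"
        using fold_VR by blast
      define s where "s = min f (q - p)"
      have s: "s > 0" "s \<le> f" "p + s \<le> q" using f that(1) by (auto simp: s_def)
      have "\<gamma> p + s *\<^sub>R VR (Y p) V = \<gamma> p + s *\<^sub>R w"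
        using f(2)[of s] that(2)[of "p + s"] s Yadd(1)[of p s] by (simp add: \<gamma>_def)
      then show ?thesis using s by simp
    qed
    have VLu: "VL (Y q) V = w" if "p < q" "\<And>t. p \<le> t \<Longrightarrow> t \<le> q \<Longrightarrow> \<gamma> t = \<gamma> q + (t - q) *\<^sub>R w" for p q w
    proof -
      obtain f where f: "f > 0" "\<And>s. 0 \<le> s \<Longrightarrow> s \<le> f \<Longrightarrow> fold2 (Y q - s *\<^sub>R V) = fold2 (Y q) - s *\<^sub>R VL (Y q) V"
        using fold_VL by blast
      define s where "s = min f (q - p)"
      have s: "s > 0" "s \<le> f" "p \<le> q - s" using f that(1) by (auto simp: s_def)
      have "\<gamma> q - s *\<^sub>R VL (Y q) V = \<gamma> q - s *\<^sub>R w"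
        using f(2)[of s] that(2)[of "q - s"] s Yadd(2)[of q s] by (simp add: \<gamma>_def)
      then show ?thesis using s by simp
    qed
    have R: "billiard_path K t0 q \<gamma> (VR (Y t0) V) (VL (Y q) V)" if q: "t0 < q" "q \<le> t0 + d" for q
    proof -
      have eqR: "\<gamma> t = \<gamma> q + (t - q) *\<^sub>R VR (Y t0) V" if "t0 \<le> t" "t \<le> q" for t
        using right[of t] right[of q] that q by (simp add: scaleR_left_diff_distrib)
      have "VL (Y q) V = VR (Y t0) V" by (rule VLu[OF q(1) eqR])
      moreover have "billiard_path K t0 q \<gamma> (VR (Y t0) V) (VR (Y t0) V)"
        by (rule billiard_path_single[OF q(1)]) (use V q in \<open>auto simp: norm_VR intro!: right\<close>)
      ultimately show ?thesis by simp
    qed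
    have L: "billiard_path K p t0 \<gamma> (VR (Y p) V) (VL (Y t0) V)" if p: "p < t0" "t0 - e \<le> p" for p
    proof -
      have eqL: "\<gamma> t = \<gamma> p + (t - p) *\<^sub>R VL (Y t0) V" if "p \<le> t" "t \<le> t0" for t
        using left[of t] left[of p] that p by (simp add: scaleR_left_diff_distrib)
      have "VR (Y p) V = VL (Y t0) V" by (rule VRu[OF p(1) eqL])
      moreover have "billiard_path K p t0 \<gamma> (VL (Y t0) V) (VL (Y t0) V)"
        by (rule billiard_path_single[OF p(1)]) (use V p in \<open>auto simp: norm_VL intro!: eqL\<close>)
      ultimately show ?thesis by simp
    qed
    have "P p q" if near: "p \<le> t0" "t0 \<le> q" "q - p < min d e" for p q
      unfolding P_def
    proof
      assume pq: "a \<le> p \<and> p < q \<and> q \<le> b"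
      consider "p = t0" | "q = t0" | "p < t0" "t0 < q" using near by linarith
      then show "billiard_path K p q \<gamma> (VR (Y p) V) (VL (Y q) V)"
      proof cases
        case 1 then show ?thesis using R[of q] pq near by auto
      next
        case 2 then show ?thesis using L[of p] pq near by auto
      next
        case 3 then show ?thesis
          using L[of p] R[of q] pq near law[of t0] by (auto intro: billiard_path_join)
      qed
    qed
    then show "\<exists>d>0. \<forall>p q. p \<le> t0 \<and> t0 \<le> q \<and> q - p < d \<longrightarrow> P p q"
      using d(1) e(1) by (intro exI[of _ "min d e"]) auto
  qed
  then show ?thesis using ab by (simp add: P_def \<gamma>_def[abs_def] Y_def)
qed

section \<open>Scattering: closedness, uniqueness and continuity\<close>

definition reflect :: "complex \<Rightarrow> complex \<Rightarrow> complex" where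
  "reflect k v = v - (2 * (v \<bullet> k)) *\<^sub>R k"

lemma reflect_facts:
  assumes "norm k = 1"
  shows "reflect k v \<bullet> k = - (v \<bullet> k)" "norm (reflect k v) = norm v" "reflect k (reflect k v) = v"
proof -
  have kk: "k \<bullet> k = 1" using assms by (simp add: dot_square_norm)
  show 1: "reflect k v \<bullet> k = - (v \<bullet> k)" by (simp add: reflect_def inner_diff_left kk)
  have "reflect k v \<bullet> reflect k v = v \<bullet> v"
    by (simp add: reflect_def inner_diff_left inner_diff_right kk inner_commute[of k v] algebra_simps)
  then show "norm (reflect k v) = norm v" by (simp add: norm_eq_sqrt_inner)
  have "reflect k (reflect k v) = reflect k v - (2 * (reflect k v \<bullet> k)) *\<^sub>R k"
    by (simp only: reflect_def)
  also have "\<dots> = v" unfolding 1 by (simp add: reflect_def)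
  finally show "reflect k (reflect k v) = v" .
qed

lemma reflect_orthogonal: "v \<bullet> k = 0 \<Longrightarrow> reflect k v = v"
  by (simp add: reflect_def)

text \<open>A flow outside the open set \<open>D\<close> with bounces at the points of \<open>C - D\<close>, where \<open>N p k\<close> says that \<open>k\<close> is
the normal at \<open>p\<close>. The obstacles are so far apart that after a bounce no other is met within time \<open>h\<close>.\<close>

locale scattering =
  fixes C D :: "complex set" and N :: "complex \<Rightarrow> complex \<Rightarrow> bool" and h :: real
  assumes h: "0 < h"
    and closed_C: "closed C" and open_D: "open D" and D_sub: "D \<subseteq> C"
    and N_exists: "p \<in> C \<Longrightarrow> p \<notin> D \<Longrightarrow> \<exists>k. N p k"
    and N_norm: "N p k \<Longrightarrow> norm k = 1"
    and N_unique: "N p k \<Longrightarrow> N p k' \<Longrightarrow> k = k'"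
    and N_closed: "(\<And>n::nat. N (P n) (Q n)) \<Longrightarrow> P \<longlonglongrightarrow> p \<Longrightarrow> Q \<longlonglongrightarrow> k \<Longrightarrow> N p k"
    and enter: "N p k \<Longrightarrow> v \<bullet> k < 0 \<Longrightarrow> \<exists>e>0. \<forall>s. 0 < s \<and> s \<le> e \<longrightarrow> p + s *\<^sub>R v \<in> D"
    and leave: "N p k \<Longrightarrow> norm w = 1 \<Longrightarrow> 0 \<le> w \<bullet> k \<Longrightarrow> 0 \<le> s \<Longrightarrow> s \<le> h \<Longrightarrow> p + s *\<^sub>R w \<notin> D"
    and leave_strictly: "N p k \<Longrightarrow> norm w = 1 \<Longrightarrow> 0 < w \<bullet> k \<Longrightarrow> 0 < s \<Longrightarrow> s \<le> h \<Longrightarrow> p + s *\<^sub>R w \<notin> C"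
begin

definition free :: "complex \<Rightarrow> complex \<Rightarrow> real \<Rightarrow> bool" where
  "free x v s \<longleftrightarrow> (\<forall>u. 0 \<le> u \<and> u \<le> s \<longrightarrow> x + u *\<^sub>R v \<notin> D)"

text \<open>A tangential contact is a bounce without effect. It is included, as is a bounce at either end of the
time interval, to make the relation closed.\<close>

definition bounce :: "complex \<times> complex \<Rightarrow> complex \<times> complex \<Rightarrow> real \<Rightarrow> complex \<Rightarrow> bool" where
  "bounce a b s k \<longleftrightarrow> 0 \<le> s \<and> s \<le> h \<and> free (fst a) (snd a) s \<and> N (fst a + s *\<^sub>R snd a) k \<and>
     snd a \<bullet> k \<le> 0 \<and> snd b = reflect k (snd a) \<and> fst b = fst a + s *\<^sub>R snd a + (h - s) *\<^sub>R snd b"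

definition straight :: "complex \<times> complex \<Rightarrow> complex \<times> complex \<Rightarrow> bool" where
  "straight a b \<longleftrightarrow> free (fst a) (snd a) h \<and> b = (fst a + h *\<^sub>R snd a, snd a)"

definition step :: "complex \<times> complex \<Rightarrow> complex \<times> complex \<Rightarrow> bool" where
  "step a b \<longleftrightarrow> norm (snd a) = 1 \<and> (straight a b \<or> (\<exists>s k. bounce a b s k))"

lemma free_limit:
  fixes x v :: "nat \<Rightarrow> complex" and s :: "nat \<Rightarrow> real"
  assumes "\<And>n. free (x n) (v n) (s n)" "\<And>n. 0 \<le> s n"
    and "x \<longlonglongrightarrow> x0" "v \<longlonglongrightarrow> v0" "s \<longlonglongrightarrow> s0"
  shows "free x0 v0 s0"
  unfolding free_def
proof (intro allI impI)
  fix u assume u: "0 \<le> u \<and> u \<le> s0"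
  define c where "c = u / s0"
  have c: "0 \<le> c" "c \<le> 1" "c * s0 = u" using u by (auto simp: c_def divide_simps)
  have "x n + (c * s n) *\<^sub>R v n \<in> - D" for n
    using assms(1)[of n] assms(2)[of n] c mult_left_le_one_le[of "s n" c] by (simp add: free_def)
  moreover have "(\<lambda>n. x n + (c * s n) *\<^sub>R v n) \<longlonglongrightarrow> x0 + (c * s0) *\<^sub>R v0"
    by (intro tendsto_intros assms)
  ultimately have "x0 + (c * s0) *\<^sub>R v0 \<in> - D"
    by (rule closed_sequentially[OF closed_Compl[OF open_D]])
  then show "x0 + u *\<^sub>R v0 \<notin> D" using c by simp
qed

lemma step_closed:
  assumes st: "\<And>n::nat. step (A n) (B n)" and A: "A \<longlonglongrightarrow> a" and B: "B \<longlonglongrightarrow> b"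
  shows "step a b"
proof -
  have tA: "(\<lambda>n. fst (A n)) \<longlonglongrightarrow> fst a" "(\<lambda>n. snd (A n)) \<longlonglongrightarrow> snd a"
    and tB: "(\<lambda>n. fst (B n)) \<longlonglongrightarrow> fst b" "(\<lambda>n. snd (B n)) \<longlonglongrightarrow> snd b"
    using A B by (auto intro!: tendsto_intros)
  have na: "norm (snd a) = 1"
    using tendsto_norm[OF tA(2)] st by (auto simp: step_def LIMSEQ_const_iff)
  have "{n. straight (A n) (B n)} \<union> {n. \<exists>s k. bounce (A n) (B n) s k} = UNIV"
    using st by (auto simp: step_def)
  then have "infinite ({n. straight (A n) (B n)} \<union> {n. \<exists>s k. bounce (A n) (B n) s k})"
    by simp
  then consider "infinite {n. straight (A n) (B n)}" | "infinite {n. \<exists>s k. bounce (A n) (B n) s k}"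
    by auto
  then show ?thesis
  proof cases
    case 1
    obtain r where r: "strict_mono r" "\<And>n::nat. straight (A (r n)) (B (r n))"
      using infinite_enumerate[OF 1] by auto
    note lims = LIMSEQ_subseq_LIMSEQ[OF tA(1) r(1)] LIMSEQ_subseq_LIMSEQ[OF tA(2) r(1)]
      LIMSEQ_subseq_LIMSEQ[OF tB(1) r(1)] LIMSEQ_subseq_LIMSEQ[OF tB(2) r(1)]
    have "free (fst a) (snd a) h"
      using r(2) h by (intro free_limit[OF _ _ lims(1,2) tendsto_const]) (auto simp: straight_def)
    moreover have "fst b = fst a + h *\<^sub>R snd a"
    proof (rule LIMSEQ_unique)
      show "(\<lambda>n. fst (A (r n)) + h *\<^sub>R snd (A (r n))) \<longlonglongrightarrow> fst b"
        using lims(3) r(2) by (simp add: straight_def o_def)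
      show "(\<lambda>n. fst (A (r n)) + h *\<^sub>R snd (A (r n))) \<longlonglongrightarrow> fst a + h *\<^sub>R snd a"
        using lims by (auto simp: o_def intro!: tendsto_intros)
    qed
    moreover have "snd b = snd a"
    proof (rule LIMSEQ_unique)
      show "(\<lambda>n. snd (A (r n))) \<longlonglongrightarrow> snd b"
        using lims(4) r(2) by (simp add: straight_def o_def)
    qed (use lims in \<open>simp add: o_def\<close>)
    ultimately show ?thesis using na by (simp add: step_def straight_def prod_eq_iff)
  next
    case 2
    obtain q where q: "strict_mono q" "\<And>n::nat. \<exists>s k. bounce (A (q n)) (B (q n)) s k"
      using infinite_enumerate[OF 2] by auto
    then obtain S Q where SQ: "\<And>n. bounce (A (q n)) (B (q n)) (S n) (Q n)" by metis
    have "(S n, Q n) \<in> {0..h} \<times> sphere 0 1" for n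
      using SQ[of n] N_norm by (auto simp: bounce_def)
    moreover have "seq_compact ({0..h} \<times> sphere (0::complex) 1)"
      by (intro compact_imp_seq_compact compact_Times) auto
    ultimately obtain l p where l: "l \<in> {0..h} \<times> sphere 0 1" and p: "strict_mono p"
      "((\<lambda>n. (S n, Q n)) \<circ> p) \<longlonglongrightarrow> l"
      unfolding seq_compact_def by (elim allE[of _ "\<lambda>n. (S n, Q n)"]) blast
    obtain s k where sk: "l = (s, k)" by (cases l)
    define r where "r = q \<circ> p"
    have r: "strict_mono r" using q(1) p(1) by (simp add: r_def strict_mono_o)
    note lims = LIMSEQ_subseq_LIMSEQ[OF tA(1) r] LIMSEQ_subseq_LIMSEQ[OF tA(2) r]
      LIMSEQ_subseq_LIMSEQ[OF tB(1) r] LIMSEQ_subseq_LIMSEQ[OF tB(2) r]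
    note lims = lims[unfolded o_def]
    have S: "(\<lambda>n. S (p n)) \<longlonglongrightarrow> s" and Q: "(\<lambda>n. Q (p n)) \<longlonglongrightarrow> k"
      using tendsto_fst[OF p(2)] tendsto_snd[OF p(2)] sk by (auto simp: o_def)
    have b: "bounce (A (r n)) (B (r n)) (S (p n)) (Q (p n))" for n
      using SQ[of "p n"] by (simp add: r_def)
    have "bounce a b s k"
      unfolding bounce_def
    proof (intro conjI)
      show "0 \<le> s" "s \<le> h" using l sk by auto
      show "free (fst a) (snd a) s"
        by (rule free_limit[OF _ _ lims(1,2) S]) (use b in \<open>auto simp: bounce_def\<close>)
      have P: "(\<lambda>n. fst (A (r n)) + S (p n) *\<^sub>R snd (A (r n))) \<longlonglongrightarrow> fst a + s *\<^sub>R snd a"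
        by (intro tendsto_intros lims S)
      show "N (fst a + s *\<^sub>R snd a) k"
        by (rule N_closed[OF _ P Q]) (use b in \<open>simp add: bounce_def\<close>)
      show "snd a \<bullet> k \<le> 0"
      proof (rule LIMSEQ_le_const2)
        show "(\<lambda>n. snd (A (r n)) \<bullet> Q (p n)) \<longlonglongrightarrow> snd a \<bullet> k" by (intro tendsto_intros lims S Q)
      qed (use b in \<open>auto simp: bounce_def\<close>)
      show "snd b = reflect k (snd a)"
      proof (rule LIMSEQ_unique[OF lims(4)])
        have "(\<lambda>n. reflect (Q (p n)) (snd (A (r n)))) \<longlonglongrightarrow> reflect k (snd a)"
          unfolding reflect_def by (intro tendsto_intros lims S Q)
        then show "(\<lambda>n. snd (B (r n))) \<longlonglongrightarrow> reflect k (snd a)"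
          using b by (simp add: bounce_def)
      qed
      show "fst b = fst a + s *\<^sub>R snd a + (h - s) *\<^sub>R snd b"
      proof (rule LIMSEQ_unique[OF lims(3)])
        have "(\<lambda>n. fst (A (r n)) + S (p n) *\<^sub>R snd (A (r n)) + (h - S (p n)) *\<^sub>R snd (B (r n)))
            \<longlonglongrightarrow> fst a + s *\<^sub>R snd a + (h - s) *\<^sub>R snd b"
          by (intro tendsto_intros lims S Q)
        moreover have "fst (B (r n)) = fst (A (r n)) + S (p n) *\<^sub>R snd (A (r n)) + (h - S (p n)) *\<^sub>R snd (B (r n))" for n
          using b[of n] unfolding bounce_def by blast
        ultimately show "(\<lambda>n. fst (B (r n))) \<longlonglongrightarrow> fst a + s *\<^sub>R snd a + (h - s) *\<^sub>R snd b"
          by presburger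
      qed
    qed
    then show ?thesis using na by (auto simp: step_def)
  qed
qed

text \<open>A proper bounce cannot be delayed: without it the ray would enter the obstacle at once.\<close>

lemma free_until_bounce:
  assumes "free x v t" "N (x + s *\<^sub>R v) k" "v \<bullet> k < 0" "0 \<le> s"
  shows "t \<le> s"
proof (rule ccontr)
  assume t: "\<not> t \<le> s"
  obtain e where e: "e > 0" "\<And>u. 0 < u \<Longrightarrow> u \<le> e \<Longrightarrow> x + s *\<^sub>R v + u *\<^sub>R v \<in> D"
    using enter[OF assms(2,3)] by auto
  define u where "u = min e (t - s)"
  have "0 < u" "u \<le> e" "s + u \<le> t" using e t by (auto simp: u_def)
  then have "x + s *\<^sub>R v + u *\<^sub>R v \<in> D" "x + (s + u) *\<^sub>R v \<notin> D"
    using e(2)[of u] assms(1,4) by (auto simp: free_def)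
  then show False by (simp add: scaleR_left_distrib add.assoc)
qed

lemma step_cases:
  assumes "step a b"
  obtains "straight a b" | s k where "bounce a b s k" "snd a \<bullet> k < 0"
proof -
  have na: "norm (snd a) = 1" using assms by (simp add: step_def)
  consider "straight a b" | s k where "bounce a b s k" using assms by (auto simp: step_def)
  then show ?thesis
  proof cases
    case (2 s k)
    show ?thesis
    proof (cases "snd a \<bullet> k = 0")
      case True
      have same: "snd b = snd a" using 2 True by (simp add: bounce_def reflect_orthogonal)
      have "free (fst a) (snd a) h"
        unfolding free_def
      proof (intro allI impI)
        fix u assume u: "0 \<le> u \<and> u \<le> h"
        show "fst a + u *\<^sub>R snd a \<notin> D"
        proof (cases "u \<le> s")
          case True then show ?thesis using 2 u by (simp add: bounce_def free_def)
        next
          case False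
          have "fst a + s *\<^sub>R snd a + (u - s) *\<^sub>R snd a \<notin> D"
            using 2 u False True na \<open>snd a \<bullet> k = 0\<close> by (intro leave[of _ k]) (auto simp: bounce_def)
          then show ?thesis by (simp add: algebra_simps)
        qed
      qed
      moreover have "fst b = fst a + h *\<^sub>R snd a"
        using 2 unfolding bounce_def same by (simp add: algebra_simps)
      ultimately show ?thesis using same that(1) by (simp add: straight_def prod_eq_iff)
    next
      case False
      then show ?thesis using that(2)[OF 2] 2 by (simp add: bounce_def)
    qed
  qed (use that in blast)
qed

text \<open>Pairs that describe the same physical state: at the boundary the velocity may be taken just before
or just after the bounce.\<close>

definition twin :: "complex \<times> complex \<Rightarrow> complex \<times> complex \<Rightarrow> bool" where
  "twin a b \<longleftrightarrow> a = b \<or> fst a = fst b \<and> (\<exists>k. N (fst a) k \<and> snd b = reflect k (snd a))"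

lemma twin_sym: "twin a b \<Longrightarrow> twin b a"
  unfolding twin_def using N_norm reflect_facts(3) by metis

lemma step_unique:
  assumes ab: "step a b" and ac: "step a c" shows "twin b c"
proof -
  have *: "twin b c" if "straight a b" "bounce a c s k" "snd a \<bullet> k < 0" for b c s k
  proof -
    have "h \<le> s" "s \<le> h"
      using free_until_bounce[of "fst a" "snd a" h s k] that by (auto simp: straight_def bounce_def)
    then have "s = h" by simp
    then show ?thesis using that by (auto simp: straight_def bounce_def twin_def)
  qed
  show ?thesis
  proof (cases rule: step_cases[OF ab])
    case 1
    show ?thesis
      by (cases rule: step_cases[OF ac]) (use 1 * in \<open>auto simp: straight_def twin_def\<close>)
  next
    case (2 s k)
    show ?thesis
    proof (cases rule: step_cases[OF ac])
      case 1 then show ?thesis using * 2 twin_sym by blast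
    next
      case (2 s' k')
      have "s = s'"
        using free_until_bounce[of "fst a" "snd a" s s' k'] free_until_bounce[of "fst a" "snd a" s' s k]
          2 \<open>bounce a b s k\<close> \<open>snd a \<bullet> k < 0\<close> by (auto simp: bounce_def)
      moreover have "k = k'"
        using \<open>s = s'\<close> 2 \<open>bounce a b s k\<close> N_unique by (auto simp: bounce_def)
      ultimately show ?thesis
        using 2 \<open>bounce a b s k\<close> by (auto simp: bounce_def twin_def prod_eq_iff)
    qed
  qed
qed

text \<open>A state that is about to bounce moves on exactly like its twin that has already bounced.\<close>

lemma step_from_twin:
  assumes N: "N x k" and v: "v \<bullet> k < 0" and st: "step (x, v) b"
  shows "b = (x + h *\<^sub>R reflect k v, reflect k v)" "step (x, reflect k v) b"
proof -
  have nv: "norm v = 1" using st by (simp add: step_def)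
  show b: "b = (x + h *\<^sub>R reflect k v, reflect k v)"
  proof (cases rule: step_cases[OF st])
    case 1
    then show ?thesis using free_until_bounce[of x v h 0 k] N v h by (simp add: straight_def)
  next
    case (2 s k')
    then have "s = 0" using free_until_bounce[of x v s 0 k] N v by (auto simp: bounce_def)
    then show ?thesis using 2 N N_unique[of x k k'] by (auto simp: bounce_def prod_eq_iff)
  qed
  have "free x (reflect k v) h"
    unfolding free_def using leave[OF N, of "reflect k v"] reflect_facts[OF N_norm[OF N]] v nv by auto
  then show "step (x, reflect k v) b"
    using b nv reflect_facts[OF N_norm[OF N]] by (simp add: step_def straight_def)
qed

lemma step_twin:
  assumes t: "twin a a'" and ab: "step a b" and ab': "step a' b'"
  shows "twin b b'"
proof (cases "a = a'")
  case True then show ?thesis using step_unique ab ab' by simp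
next
  case False
  then obtain k where k: "N (fst a) k" "fst a' = fst a" "snd a' = reflect k (snd a)"
    using t unfolding twin_def by metis
  have flipped: "reflect k (snd a') = snd a" "snd a' \<bullet> k = - (snd a \<bullet> k)"
    using k reflect_facts[OF N_norm[OF k(1)]] by auto
  consider "snd a \<bullet> k < 0" | "snd a \<bullet> k = 0" | "snd a' \<bullet> k < 0" using flipped by linarith
  then show ?thesis
  proof cases
    case 1
    have "step a' b"
      using step_from_twin(2)[OF k(1) 1, of b] ab k by (metis prod.collapse)
    then show ?thesis using step_unique ab' by blast
  next
    case 2
    then have "a = a'" using k reflect_orthogonal by (simp add: prod_eq_iff)
    then show ?thesis using False by simp
  next
    case 3
    have "step a b'"
      using step_from_twin(2)[of "fst a" k "snd a'" b'] 3 ab' k flipped by (metis prod.collapse)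
    then show ?thesis using step_unique ab by blast
  qed
qed

lemma step_dist: assumes "step a b" shows "dist (fst a) (fst b) \<le> h" "norm (snd b) = 1"
proof -
  have na: "norm (snd a) = 1" using assms by (simp add: step_def)
  consider "straight a b" | s k where "bounce a b s k" using assms by (auto simp: step_def)
  then have "dist (fst a) (fst b) \<le> h \<and> norm (snd b) = 1"
  proof cases
    case 1 then show ?thesis using na h by (simp add: straight_def dist_norm)
  next
    case (2 s k)
    have nb: "norm (snd b) = 1" using 2 reflect_facts N_norm na by (auto simp: bounce_def)
    have "fst b - fst a = s *\<^sub>R snd a + (h - s) *\<^sub>R snd b" using 2 by (simp add: bounce_def)
    then have "norm (fst b - fst a) \<le> s * 1 + (h - s) * 1"
      using norm_triangle_ineq[of "s *\<^sub>R snd a" "(h - s) *\<^sub>R snd b"] na nb 2 by (simp add: bounce_def)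
    then show ?thesis using nb by (simp add: dist_norm norm_minus_commute)
  qed
  then show "dist (fst a) (fst b) \<le> h" "norm (snd b) = 1" by auto
qed

lemma steps_unique: "(step ^^ n) a b \<Longrightarrow> (step ^^ n) a c \<Longrightarrow> twin b c"
proof (induction n arbitrary: b c)
  case 0 then show ?case by (simp add: twin_def)
next
  case (Suc n)
  obtain b' where b': "(step ^^ n) a b'" "step b' b" using Suc.prems(1) by (rule relpowp_Suc_E)
  obtain c' where c': "(step ^^ n) a c'" "step c' c" using Suc.prems(2) by (rule relpowp_Suc_E)
  show ?case using step_twin[OF Suc.IH[OF b'(1) c'(1)] b'(2) c'(2)] .
qed

lemma steps_dist: "(step ^^ n) a b \<Longrightarrow> norm (snd a) = 1 \<Longrightarrow> dist (fst a) (fst b) \<le> n * h \<and> norm (snd b) = 1"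
proof (induction n arbitrary: b)
  case (Suc n)
  obtain c where c: "(step ^^ n) a c" "step c b" using Suc.prems(1) by (rule relpowp_Suc_E)
  show ?case
    using Suc.IH[OF c(1) Suc.prems(2)] step_dist[OF c(2)] dist_triangle[of "fst a" "fst b" "fst c"]
    by (auto simp: algebra_simps)
qed auto

lemma steps_closed:
  "(\<And>m::nat. (step ^^ n) (A m) (B m)) \<Longrightarrow> A \<longlonglongrightarrow> a \<Longrightarrow> B \<longlonglongrightarrow> b \<Longrightarrow> (step ^^ n) a b"
proof (induction n arbitrary: A B b a)
  case 0
  have "A = B" using 0 by (intro ext) simp
  then have "a = b" using LIMSEQ_unique[OF "0.prems"(2)] "0.prems"(3) by simp
  then show ?case by simp
next
  case (Suc n)
  have "\<exists>c. (step ^^ n) (A m) c \<and> step c (B m)" for m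
    using Suc.prems(1)[of m] by (rule relpowp_Suc_E) blast
  then obtain M where M: "\<And>m. (step ^^ n) (A m) (M m)" "\<And>m. step (M m) (B m)" by metis
  have "bounded (range B)" using Suc.prems(3) by (rule convergent_imp_bounded)
  then obtain R where R: "\<And>m. norm (B m) \<le> R" by (auto simp: bounded_iff)
  have "norm (M m) \<le> (R + h) + 1" for m
  proof -
    have "norm (M m) \<le> norm (fst (M m)) + norm (snd (M m))"
      using norm_Pair_le[of "fst (M m)" "snd (M m)"] by simp
    moreover have "norm (snd (M m)) = 1" using M(2)[of m] by (simp add: step_def)
    moreover have "norm (fst (M m)) \<le> norm (fst (B m)) + h"
      using step_dist(1)[OF M(2)[of m]] norm_triangle_ineq2[of "fst (M m)" "fst (B m)"]
      by (simp add: dist_norm)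
    moreover have "norm (fst (B m)) \<le> R" using R[of m] norm_fst_le[of "fst (B m)" "snd (B m)"] by simp
    ultimately show ?thesis by simp
  qed
  then have "bounded (range M)" by (auto simp: bounded_iff)
  then obtain l r where r: "strict_mono r" "(M \<circ> r) \<longlonglongrightarrow> l"
    using bounded_imp_convergent_subsequence by blast
  have "(step ^^ n) a l"
    by (rule Suc.IH[OF _ LIMSEQ_subseq_LIMSEQ[OF Suc.prems(2) r(1)] r(2)]) (simp only: o_apply M)
  moreover have "step l b"
    by (rule step_closed[OF _ r(2) LIMSEQ_subseq_LIMSEQ[OF Suc.prems(3) r(1)]]) (simp only: o_apply M)
  ultimately show ?case by (rule relpowp_Suc_I)
qed

text \<open>A step whose bounce, if any, comes strictly before its end, so that the final velocity is really
the velocity of arrival.\<close>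

definition regular_step :: "complex \<times> complex \<Rightarrow> complex \<times> complex \<Rightarrow> bool" where
  "regular_step a b \<longleftrightarrow> straight a b \<or>
     (\<exists>s k. bounce a b s k \<and> s < h \<and> free (fst a + s *\<^sub>R snd a) (snd b) (h - s))"

lemma regular_step_exists:
  assumes x: "x \<notin> D" and v: "norm v = 1"
  shows "\<exists>b. regular_step (x, v) b"
proof (cases "free x v h")
  case True then show ?thesis by (auto simp: regular_step_def straight_def)
next
  case False
  define S where "S = {u. 0 \<le> u \<and> u \<le> h \<and> x + u *\<^sub>R v \<in> D}"
  have S: "S \<noteq> {}" "bdd_below S" using False by (auto simp: S_def free_def bdd_below_def)
  define s where "s = Inf S"
  have s0: "0 \<le> s" unfolding s_def using S by (intro cInf_greatest) (auto simp: S_def)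
  have low: "s \<le> u" if "u \<in> S" for u unfolding s_def using S that by (intro cInf_lower)
  have near: "\<exists>u\<in>S. u < s + d" if "d > 0" for d
    using cInf_lessD[OF S(1), of "s + d"] that by (auto simp: s_def)
  define p where "p = x + s *\<^sub>R v"
  have dist: "dist (x + u *\<^sub>R v) p = \<bar>u - s\<bar>" for u
    using v by (simp add: p_def dist_norm flip: scaleR_left_diff_distrib)
  have pD: "p \<notin> D"
  proof
    assume pD: "p \<in> D"
    then obtain d where d: "d > 0" "ball p d \<subseteq> D" using open_D by (meson open_contains_ball)
    have "s \<noteq> 0" using pD x by (auto simp: p_def)
    define u where "u = max 0 (s - d / 2)"
    have u: "0 \<le> u" "u < s" "\<bar>u - s\<bar> < d" using d s0 \<open>s \<noteq> 0\<close> by (auto simp: u_def)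
    have "s \<le> h" using near[of 1] low S by (force simp: S_def)
    moreover have "x + u *\<^sub>R v \<in> D" using d(2) u dist[of u] by (auto simp: dist_commute)
    ultimately show False using low[of u] u by (auto simp: S_def)
  qed
  have pC: "p \<in> C"
  proof (rule ccontr)
    assume "p \<notin> C"
    then obtain d where d: "d > 0" "ball p d \<subseteq> - C" using closed_C by (meson ComplI open_Compl open_contains_ball)
    obtain u where u: "u \<in> S" "u < s + d" using near[OF d(1)] by blast
    then have "x + u *\<^sub>R v \<in> ball p d" using low[OF u(1)] dist[of u] by (auto simp: dist_commute)
    then show False using d(2) u(1) D_sub by (auto simp: S_def)
  qed
  obtain k where k: "N p k" using N_exists[OF pC pD] by blast
  obtain u where u: "u \<in> S" using S by blast
  have us: "s < u" "u \<le> h" using u low[OF u] pD by (auto simp: S_def p_def less_le)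
  have vk: "v \<bullet> k \<le> 0"
  proof (rule ccontr)
    assume "\<not> ?thesis"
    then have "p + (u - s) *\<^sub>R v \<notin> C" using us s0 by (intro leave_strictly[OF k v]) auto
    moreover have "p + (u - s) *\<^sub>R v = x + u *\<^sub>R v" by (simp add: p_def algebra_simps)
    ultimately show False using u D_sub by (auto simp: S_def)
  qed
  define w where "w = reflect k v"
  have w: "norm w = 1" "w \<bullet> k \<ge> 0" using reflect_facts[OF N_norm[OF k]] v vk by (auto simp: w_def)
  have "free x v s"
    unfolding free_def
  proof (intro allI impI)
    fix t assume t: "0 \<le> t \<and> t \<le> s"
    show "x + t *\<^sub>R v \<notin> D"
    proof (cases "t = s")
      case True then show ?thesis using pD by (simp add: p_def)
    next
      case False then show ?thesis using low[of t] t us by (auto simp: S_def)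
    qed
  qed
  moreover have "free p w (h - s)"
    unfolding free_def using leave[OF k w] s0 by auto
  ultimately have "regular_step (x, v) (p + (h - s) *\<^sub>R w, w)"
    unfolding regular_step_def bounce_def using us s0 k vk w_def
    by (intro disjI2 exI[of _ s] exI[of _ k]) (auto simp: p_def)
  then show ?thesis by blast
qed

lemma regular_step_step: "regular_step a b \<Longrightarrow> norm (snd a) = 1 \<Longrightarrow> step a b"
  by (auto simp: regular_step_def step_def)

lemma regular_step_end: "regular_step a b \<Longrightarrow> fst b \<notin> D"
  using h by (auto simp: regular_step_def straight_def free_def bounce_def)

definition next_state :: "complex \<times> complex \<Rightarrow> complex \<times> complex" where
  "next_state a = (SOME b. regular_step a b)"

definition state :: "complex \<times> complex \<Rightarrow> nat \<Rightarrow> complex \<times> complex" where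
  "state a n = (next_state ^^ n) a"

lemma state_simps: "state a 0 = a" "state a (Suc n) = next_state (state a n)"
  by (simp_all add: state_def)

context
  fixes a :: "complex \<times> complex"
  assumes start: "fst a \<notin> D" "norm (snd a) = 1"
begin

lemma next_state: "fst b \<notin> D \<Longrightarrow> norm (snd b) = 1 \<Longrightarrow> regular_step b (next_state b)"
  unfolding next_state_def using regular_step_exists[of "fst b" "snd b"] by (metis prod.collapse someI_ex)

lemma state_valid: "fst (state a n) \<notin> D \<and> norm (snd (state a n)) = 1"
proof (induction n)
  case (Suc n)
  then have r: "regular_step (state a n) (state a (Suc n))" using next_state by (simp add: state_simps)
  show ?case
    using regular_step_end[OF r] step_dist(2)[OF regular_step_step[OF r]] Suc by simp
qed (use start in \<open>simp add: state_simps\<close>)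

lemma state_regular: "regular_step (state a n) (state a (Suc n))"
  using next_state state_valid[of n] by (simp add: state_simps)

lemma state_steps: "(step ^^ n) a (state a n)"
proof (induction n)
  case (Suc n)
  then show ?case using state_regular[of n] state_valid[of n] by (meson regular_step_step relpowp_Suc_I)
qed (simp add: state_simps)

end

text \<open>Closedness of the step relation together with uniqueness of its positions gives continuity,
  although the time of a bounce jumps at a trajectory that grazes the obstacle.\<close>

lemma continuous_on_position:
  fixes f :: "'a::metric_space \<Rightarrow> complex \<times> complex"
  assumes cont: "continuous_on S f" and valid: "\<And>s. s \<in> S \<Longrightarrow> fst (f s) \<notin> D \<and> norm (snd (f s)) = 1"
  shows "continuous_on S (\<lambda>s. fst (state (f s) n))"
proof (unfold continuous_on_sequentially, intro allI ballI impI)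
  fix x :: "nat \<Rightarrow> 'a" and s assume s: "s \<in> S" and x: "(\<forall>m. x m \<in> S) \<and> x \<longlonglongrightarrow> s"
  define P where "P m = fst (state (f (x m)) n)" for m
  define L where "L = fst (state (f s) n)"
  have fx: "(\<lambda>m. f (x m)) \<longlonglongrightarrow> f s"
    using cont s x by (auto simp: continuous_on_sequentially o_def)
  have "P \<longlonglongrightarrow> L"
  proof (rule ccontr)
    assume "\<not> ?thesis"
    then obtain e where e: "e > 0" "\<forall>M. \<exists>m\<ge>M. \<not> dist (P m) L < e"
      unfolding LIMSEQ_def by blast
    then have "infinite {m. \<not> dist (P m) L < e}"
      unfolding infinite_nat_iff_unbounded_le by simp
    then obtain r where r: "strict_mono r" "\<And>m::nat. \<not> dist (P (r m)) L < e"
      using infinite_enumerate by blast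
    define B where "B m = state (f (x (r m))) n" for m
    have B: "(step ^^ n) (f (x (r m))) (B m)" "norm (snd (f (x (r m)))) = 1" for m
      using state_steps valid x by (auto simp: B_def)
    have "bounded (range (\<lambda>m. f (x m)))" using fx by (rule convergent_imp_bounded)
    then obtain R where R: "\<And>m. norm (f (x m)) \<le> R" by (auto simp: bounded_iff)
    have "norm (B m) \<le> (R + n * h) + 1" for m
    proof -
      have "norm (B m) \<le> norm (fst (B m)) + norm (snd (B m))"
        using norm_Pair_le[of "fst (B m)" "snd (B m)"] by simp
      moreover have "norm (fst (B m)) \<le> norm (fst (f (x (r m)))) + n * h"
        using steps_dist[OF B(1)[of m] B(2)[of m]] norm_triangle_ineq2[of "fst (B m)" "fst (f (x (r m)))"]
        by (simp add: dist_norm norm_minus_commute)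
      moreover have "norm (fst (f (x (r m)))) \<le> R"
        using R[of "r m"] norm_fst_le[of "fst (f (x (r m)))" "snd (f (x (r m)))"] by simp
      ultimately show ?thesis using steps_dist[OF B] by auto
    qed
    then have "bounded (range B)" by (auto simp: bounded_iff)
    then obtain b q where q: "strict_mono q" "(B \<circ> q) \<longlonglongrightarrow> b"
      using bounded_imp_convergent_subsequence by blast
    have fxq: "(\<lambda>m. f (x (r (q m)))) \<longlonglongrightarrow> f s"
      using LIMSEQ_subseq_LIMSEQ[OF fx strict_mono_o[OF r(1) q(1)]] by (simp add: o_def)
    have "(step ^^ n) (f s) b"
      by (rule steps_closed[OF _ fxq q(2)]) (simp only: o_apply B)
    then have "twin b (state (f s) n)" using steps_unique state_steps valid[OF s] by blast
    then have "fst b = L" by (auto simp: twin_def L_def)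
    then have "(\<lambda>m. fst ((B \<circ> q) m)) \<longlonglongrightarrow> L" using tendsto_fst[OF q(2)] by simp
    then obtain m where "dist (fst ((B \<circ> q) m)) L < e" using e(1) by (metis LIMSEQ_def order_refl)
    then show False using r(2)[of "q m"] by (simp add: B_def P_def)
  qed
  then show "((\<lambda>s. fst (state (f s) n)) \<circ> x) \<longlonglongrightarrow> fst (state (f s) n)"
    by (simp add: P_def[abs_def] L_def o_def)
qed

end

section \<open>Trajectories in the unfolded plane\<close>

locale unfolded = small_body +
  fixes h :: real
  assumes h_pos: "0 < h" and h_le: "h \<le> 1/10"
begin

definition "obstacles = {X. fold2 X \<in> K}"
definition "interiors = {X. fold2 X \<in> interior K}"
definition "normal p k \<longleftrightarrow> p \<in> obstacles \<and> p \<notin> interiors \<and> outer_unit_normal K (fold2 p) (turn p k)"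

lemma fold_ray:
  assumes "fold2 p \<in> K" "norm w = 1" "0 \<le> s" "s \<le> h"
  shows "fold2 (p + s *\<^sub>R w) = fold2 p + s *\<^sub>R turn p w"
  using fold_near_body(1)[OF assms(1), of "s *\<^sub>R w"] assms h_le by (simp add: turn_linear)

text \<open>Within distance \<open>1/10\<close> of the unfolded body the folding is a single isometry, which carries all
required properties over from the body.\<close>

sublocale scattering obstacles interiors normal h
proof
  show "0 < h" by (rule h_pos)
  have "closed (fold2 -` K)" by (rule closed_vimage[OF closed continuous_fold])
  then show cl: "closed obstacles" by (simp add: obstacles_def vimage_def)
  have "open (fold2 -` interior K)" by (rule open_vimage[OF open_interior continuous_fold])
  then show op: "open interiors" by (simp add: interiors_def vimage_def)
  show "interiors \<subseteq> obstacles" using interior_subset by (auto simp: interiors_def obstacles_def)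
  show "\<exists>k. normal p k" if p: "p \<in> obstacles" "p \<notin> interiors" for p
  proof -
    have "fold2 p \<in> frontier K" using p by (simp add: frontier_iff obstacles_def interiors_def)
    then obtain n where "outer_unit_normal K (fold2 p) n" by (rule normal_exists)
    then have "normal p (turn p n)" using p by (simp add: normal_def)
    then show ?thesis by blast
  qed
  show "norm k = 1" if "normal p k" for p k
    using that norm_turn[of p k] by (simp add: normal_def outer_unit_normal_def)
  show "k = k'" if k: "normal p k" "normal p k'" for p k k'
  proof -
    have "turn p k = turn p k'" using k normal_unique[of "fold2 p"] by (auto simp: normal_def obstacles_def)
    then show ?thesis by (metis turn_turn)
  qed
  show "normal p k"
    if N: "\<And>n. normal (P n) (Q n)" and P: "P \<longlonglongrightarrow> p" and Q: "Q \<longlonglongrightarrow> k" for P Q :: "nat \<Rightarrow> complex" and p k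
  proof -
    have pC: "p \<in> obstacles"
      by (rule closed_sequentially[OF cl _ P]) (use N in \<open>simp add: normal_def\<close>)
    have "p \<in> - interiors"
      by (rule closed_sequentially[OF closed_Compl[OF op] _ P]) (use N in \<open>simp add: normal_def\<close>)
    moreover have "outer_unit_normal K (fold2 p) (turn p k)"
      unfolding outer_unit_normal_def
    proof (intro conjI ballI)
      have tQ: "(\<lambda>n. turn p (Q n)) \<longlonglongrightarrow> turn p k"
        unfolding turn_def by (intro tendsto_intros tendsto_Complex Q)
      have tP: "(\<lambda>n. fold2 (P n)) \<longlonglongrightarrow> fold2 p"
        by (rule continuous_on_tendsto_compose[OF continuous_fold[of UNIV] P]) auto
      have "norm (turn p (Q n)) = 1" for n
        using N[of n] norm_turn[of _ "Q n"] by (simp add: normal_def outer_unit_normal_def)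
      then show "norm (turn p k) = 1"
        using tendsto_norm[OF tQ] by (simp add: LIMSEQ_const_iff)
      fix y assume y: "y \<in> K"
      obtain M where M: "\<And>n. n \<ge> M \<Longrightarrow> norm (P n - p) < 1/10"
        using P unfolding LIMSEQ_iff by (meson zero_less_divide_1_iff zero_less_numeral)
      have le: "(y - fold2 (P n)) \<bullet> turn p (Q n) \<le> 0" if "n \<ge> M" for n
      proof -
        have "turn (p + (P n - p)) = turn p"
          using pC M[OF that] by (intro fold_near_body(2)) (auto simp: obstacles_def)
        then have "turn (P n) = turn p" by simp
        then show ?thesis using N[of n] y by (simp add: normal_def outer_unit_normal_def)
      qed
      show "(y - fold2 p) \<bullet> turn p k \<le> 0"
      proof (rule LIMSEQ_le_const2)
        show "(\<lambda>n. (y - fold2 (P n)) \<bullet> turn p (Q n)) \<longlonglongrightarrow> (y - fold2 p) \<bullet> turn p k"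
          by (intro tendsto_intros tP tQ)
      qed (use le in blast)
    qed
    ultimately show ?thesis using pC by (simp add: normal_def)
  qed
  show "\<exists>e>0. \<forall>s. 0 < s \<and> s \<le> e \<longrightarrow> p + s *\<^sub>R v \<in> interiors"
    if N: "normal p k" and v: "v \<bullet> k < 0" for p k v
  proof -
    have pK: "fold2 p \<in> K" using N by (simp add: normal_def obstacles_def)
    have "turn p v \<bullet> turn p k < 0" using v by (simp add: inner_turn)
    then obtain e where e: "e > 0" "\<And>s. 0 < s \<Longrightarrow> s \<le> e \<Longrightarrow> fold2 p + s *\<^sub>R turn p v \<in> interior K"
      using ray_enters_interior[OF pK] N unfolding normal_def by metis
    have v0: "v \<noteq> 0" using v by auto
    define d where "d = 1 / (10 * norm v)"
    have d: "d > 0" using v0 by (simp add: d_def)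
    have "p + s *\<^sub>R v \<in> interiors" if s: "0 < s" "s \<le> min e d" for s
    proof -
      have "norm (s *\<^sub>R v) \<le> d * norm v" using s by (simp add: mult_right_mono)
      also have "\<dots> = 1/10" using v0 by (simp add: d_def)
      finally have "fold2 (p + s *\<^sub>R v) = fold2 p + s *\<^sub>R turn p v"
        using fold_near_body(1)[OF pK] by (simp add: turn_linear)
      then show ?thesis using e(2)[of s] s by (simp add: interiors_def)
    qed
    then show ?thesis using e(1) d by (intro exI[of _ "min e d"]) auto
  qed
  show "p + s *\<^sub>R w \<notin> interiors"
    if N: "normal p k" and w: "norm w = 1" "0 \<le> w \<bullet> k" and s: "0 \<le> s" "s \<le> h" for p k w s
  proof
    assume "p + s *\<^sub>R w \<in> interiors"
    then have "fold2 p + s *\<^sub>R turn p w \<in> interior K"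
      using fold_ray[of p w s] N w s by (simp add: interiors_def obstacles_def normal_def)
    from interior_below[OF this] N have "(s *\<^sub>R turn p w) \<bullet> turn p k < 0"
      by (force simp: normal_def)
    then show False using w s by (simp add: inner_turn mult_less_0_iff)
  qed
  show "p + s *\<^sub>R w \<notin> obstacles"
    if N: "normal p k" and w: "norm w = 1" "0 < w \<bullet> k" and s: "0 < s" "s \<le> h" for p k w s
  proof
    assume "p + s *\<^sub>R w \<in> obstacles"
    then have "fold2 p + s *\<^sub>R turn p w \<in> K"
      using fold_ray[of p w s] N w s by (simp add: obstacles_def normal_def)
    then have "(s *\<^sub>R turn p w) \<bullet> turn p k \<le> 0"
      using N by (force simp: normal_def outer_unit_normal_def)
    then show False using w s by (simp add: inner_turn mult_le_0_iff)
  qed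
qed

text \<open>The arrival at a state: the ray behind it is free for a short time.\<close>

definition arrived :: "complex \<times> complex \<Rightarrow> bool" where
  "arrived a \<longleftrightarrow> (\<exists>e>0. \<forall>u. 0 \<le> u \<and> u \<le> e \<longrightarrow> fst a - u *\<^sub>R snd a \<notin> interiors)"

lemma free_interior: "free x V s \<Longrightarrow> 0 \<le> u \<Longrightarrow> u \<le> s \<Longrightarrow> fold2 (x + u *\<^sub>R V) \<notin> interior K"
  unfolding free_def by (auto simp: interiors_def)

lemma free_segment:
  assumes V: "norm V = 1" and s: "0 < s" and fr: "free x V s"
  shows "billiard_path K T (T + s) (\<lambda>t. fold2 (x + (t - T) *\<^sub>R V)) (VR x V) (VL (x + s *\<^sub>R V) V)"
proof -
  have eq: "x - T *\<^sub>R V + t *\<^sub>R V = x + (t - T) *\<^sub>R V" for t by (simp add: algebra_simps)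
  have "billiard_path K T (T + s) (\<lambda>t. fold2 ((x - T *\<^sub>R V) + t *\<^sub>R V))
     (VR ((x - T *\<^sub>R V) + T *\<^sub>R V) V) (VL ((x - T *\<^sub>R V) + (T + s) *\<^sub>R V) V)"
  proof (rule fold_segment[OF V])
    show "fold2 (x - T *\<^sub>R V + t *\<^sub>R V) \<notin> interior K" if "t \<in> {T..T + s}" for t
      using free_interior[OF fr, of "t - T"] that unfolding eq by auto
  qed (use s in simp)
  then show ?thesis unfolding eq by simp
qed

lemma free_arrived:
  assumes "free x V s" "0 < s" shows "arrived (x + s *\<^sub>R V, V)"
proof -
  have "x + s *\<^sub>R V - u *\<^sub>R V \<notin> interiors" if "0 \<le> u" "u \<le> s" for u
  proof -
    have "x + (s - u) *\<^sub>R V \<notin> interiors" using assms that by (simp add: free_def)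
    then show ?thesis by (simp add: algebra_simps)
  qed
  then show ?thesis using assms(2) unfolding arrived_def by auto
qed

lemma law_at_start:
  assumes "arrived (x, V)" "free x V s" "0 < s"
  shows "billiard_law K (fold2 x) (VL x V) (VR x V)"
proof -
  obtain e where e: "e > 0" "\<And>u. 0 \<le> u \<Longrightarrow> u \<le> e \<Longrightarrow> x - u *\<^sub>R V \<notin> interiors"
    using assms(1) by (auto simp: arrived_def)
  show ?thesis
  proof (rule law_straight[OF _ assms(3) _ e(1)])
    show "fold2 x \<notin> interior K" using e(2)[of 0] e(1) by (simp add: interiors_def)
    show "fold2 (x - u *\<^sub>R V) \<notin> interior K" if "0 \<le> u" "u \<le> e" for u
      using e(2)[OF that] by (simp add: interiors_def)
  qed (use free_interior[OF assms(2)] in blast)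
qed

lemma law_at_normal:
  assumes "normal x k" shows "billiard_law K (fold2 x) (VL x V) (VR x (reflect k V))"
  using assms by (intro law_bounce[of _ k]) (auto simp: normal_def obstacles_def interiors_def reflect_def)

lemma regular_step_path:
  assumes reg: "regular_step a b" and na: "norm (snd a) = 1"
  obtains P where "P 0 = fold2 (fst a)" "P h = fold2 (fst b)"
    "\<And>u. u \<in> {0..h} \<Longrightarrow> P u \<in> square - interior K"
    "\<And>u. u \<in> {0..h} \<Longrightarrow> norm (P u - P 0) \<le> u"
    "arrived b"
    "\<And>T. \<exists>w. billiard_path K T (T + h) (\<lambda>t. P (t - T)) w (VL (fst b) (snd b)) \<and>
        (arrived a \<longrightarrow> billiard_law K (fold2 (fst a)) (VL (fst a) (snd a)) w)"
proof -
  define x v where "x = fst a" and "v = snd a"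
  consider "straight a b" | s k where "bounce a b s k" "s < h" "free (x + s *\<^sub>R v) (snd b) (h - s)"
    using reg by (auto simp: regular_step_def x_def v_def)
  then show thesis
  proof cases
    case 1
    define P where "P u = fold2 (x + u *\<^sub>R v)" for u
    have fr: "free x v h" and b: "fst b = x + h *\<^sub>R v" "snd b = v"
      using 1 by (auto simp: straight_def x_def v_def)
    show thesis
    proof (rule that[of P])
      show "P 0 = fold2 (fst a)" "P h = fold2 (fst b)" by (simp_all add: P_def x_def b[unfolded x_def])
      show "P u \<in> square - interior K" if "u \<in> {0..h}" for u
        using free_interior[OF fr, of u] that fold_square by (auto simp: P_def)
      show "norm (P u - P 0) \<le> u" if "u \<in> {0..h}" for u
        using fold_lipschitz[of "x + u *\<^sub>R v" x] that na by (simp add: P_def v_def)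
      show "arrived b" using free_arrived[OF fr h_pos] b by (metis prod.collapse)
      show "\<exists>w. billiard_path K T (T + h) (\<lambda>t. P (t - T)) w (VL (fst b) (snd b)) \<and>
        (arrived a \<longrightarrow> billiard_law K (fold2 (fst a)) (VL (fst a) (snd a)) w)" for T
        using free_segment[of v h x T] law_at_start[of x v h] fr h_pos na
        unfolding P_def b by (intro exI[of _ "VR x v"]) (simp add: x_def v_def)
    qed
  next
    case (2 s k)
    define p w where "p = x + s *\<^sub>R v" and "w = reflect k v"
    have s: "0 \<le> s" "s < h" and fr: "free x v s" and k: "normal p k" and b: "snd b = w"
      "fst b = p + (h - s) *\<^sub>R w" and fr2: "free p w (h - s)"
      using 2 unfolding bounce_def x_def[symmetric] v_def[symmetric] p_def[symmetric] w_def by auto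
    have nw: "norm w = 1" using reflect_facts(2)[OF N_norm[OF k]] na by (simp add: w_def v_def)
    define P where "P u = (if u \<le> s then fold2 (x + u *\<^sub>R v) else fold2 (p + (u - s) *\<^sub>R w))" for u
    have P2: "P u = fold2 (p + (u - s) *\<^sub>R w)" if "s \<le> u" for u
      using that by (cases "u = s") (auto simp: P_def p_def)
    show thesis
    proof (rule that[of P])
      show "P 0 = fold2 (fst a)" "P h = fold2 (fst b)" using s by (simp_all add: P_def b x_def)
      show "P u \<in> square - interior K" if "u \<in> {0..h}" for u
        using free_interior[OF fr, of u] free_interior[OF fr2, of "u - s"] that fold_square by (auto simp: P_def)
      show "norm (P u - P 0) \<le> u" if u: "u \<in> {0..h}" for u
      proof (cases "u \<le> s")
        case True
        then show ?thesis
          using fold_lipschitz[of "x + u *\<^sub>R v" x] u s na by (simp add: P_def v_def)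
      next
        case False
        have "norm (s *\<^sub>R v + (u - s) *\<^sub>R w) \<le> s + (u - s)"
          using norm_triangle_ineq[of "s *\<^sub>R v" "(u - s) *\<^sub>R w"] s False na nw by (simp add: v_def)
        then show ?thesis
          using fold_lipschitz[of "p + (u - s) *\<^sub>R w" x] False s by (simp add: P_def p_def add.assoc)
      qed
      show "arrived b" using free_arrived[OF fr2] s b by (metis diff_gt_0_iff_gt prod.collapse)
      fix T
      have seg2: "billiard_path K (T + s) (T + h) (\<lambda>t. P (t - T)) (VR p w) (VL (fst b) (snd b))"
      proof (rule billiard_path_cong)
        show "billiard_path K (T + s) (T + h) (\<lambda>t. fold2 (p + (t - (T + s)) *\<^sub>R w)) (VR p w) (VL (fst b) (snd b))"
          using free_segment[OF nw _ fr2, of "T + s"] s b by simp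
        show "fold2 (p + (t - (T + s)) *\<^sub>R w) = P (t - T)" if "t \<in> {T + s..T + h}" for t
          using P2[of "t - T"] that by (simp add: diff_diff_eq)
      qed
      show "\<exists>w. billiard_path K T (T + h) (\<lambda>t. P (t - T)) w (VL (fst b) (snd b)) \<and>
        (arrived a \<longrightarrow> billiard_law K (fold2 (fst a)) (VL (fst a) (snd a)) w)"
      proof (cases "s = 0")
        case True
        then have "p = x" by (simp add: p_def)
        then show ?thesis
          using seg2 True law_at_normal[OF k, of v] by (auto simp: x_def v_def w_def)
      next
        case False
        have seg1: "billiard_path K T (T + s) (\<lambda>t. P (t - T)) (VR x v) (VL p v)"
        proof (rule billiard_path_cong)
          show "billiard_path K T (T + s) (\<lambda>t. fold2 (x + (t - T) *\<^sub>R v)) (VR x v) (VL p v)"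
            using free_segment[of v s x T] fr s False na by (simp add: v_def p_def)
        qed (use s in \<open>auto simp: P_def\<close>)
        have law: "billiard_law K (P (T + s - T)) (VL p v) (VR p w)"
          using law_at_normal[OF k, of v] P2[of s] by (simp add: w_def)
        have "billiard_path K T (T + h) (\<lambda>t. P (t - T)) (VR x v) (VL (fst b) (snd b))"
          by (rule billiard_path_join[OF seg1 seg2 law])
        then show ?thesis
          using law_at_start[of x v s] fr s False by (intro exI[of _ "VR x v"]) (simp add: x_def v_def)
      qed
    qed
  qed
qed

lemma path_through_states:
  assumes start: "fst a \<notin> interiors" "norm (snd a) = 1" and n: "0 < n"
  shows "\<exists>\<gamma> v0. billiard_path K 0 (n * h) \<gamma> v0 (VL (fst (state a n)) (snd (state a n))) \<and>
     (\<forall>j\<le>n. \<gamma> (j * h) = fold2 (fst (state a j))) \<and>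
     (\<forall>t\<in>{0..n * h}. \<gamma> t \<in> square - interior K) \<and>
     (\<forall>j<n. \<forall>t\<in>{j * h..Suc j * h}. norm (\<gamma> t - \<gamma> (j * h)) \<le> h) \<and> arrived (state a n)"
  using n
proof (induction n rule: nat_induct_non_zero)
  case 1
  obtain P where P: "P 0 = fold2 (fst (state a 0))" "P h = fold2 (fst (state a (Suc 0)))"
    "\<And>u. u \<in> {0..h} \<Longrightarrow> P u \<in> square - interior K"
    "\<And>u. u \<in> {0..h} \<Longrightarrow> norm (P u - P 0) \<le> u" "arrived (state a (Suc 0))"
    "\<And>T. \<exists>w. billiard_path K T (T + h) (\<lambda>t. P (t - T)) w (VL (fst (state a (Suc 0))) (snd (state a (Suc 0)))) \<and>
        (arrived (state a 0) \<longrightarrow> billiard_law K (fold2 (fst (state a 0))) (VL (fst (state a 0)) (snd (state a 0))) w)"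
    by (rule regular_step_path[OF state_regular[OF start, of 0] state_valid[OF start, of 0, THEN conjunct2]]) blast
  obtain w where "billiard_path K 0 h P w (VL (fst (state a 1)) (snd (state a 1)))"
    using P(6)[of 0] by auto
  moreover have "norm (P t - P 0) \<le> h" if "t \<in> {0..h}" for t
    using P(4)[OF that] that by simp
  ultimately show ?case
    using P by (intro exI[of _ P] exI[of _ w]) (auto simp: le_Suc_eq)
next
  case (Suc n)
  then obtain \<gamma> v0 where g: "billiard_path K 0 (n * h) \<gamma> v0 (VL (fst (state a n)) (snd (state a n)))"
     "\<And>j. j \<le> n \<Longrightarrow> \<gamma> (j * h) = fold2 (fst (state a j))"
     "\<And>t. t\<in>{0..n * h} \<Longrightarrow> \<gamma> t \<in> square - interior K"
     "\<And>j t. j < n \<Longrightarrow> t\<in>{j * h..Suc j * h} \<Longrightarrow> norm (\<gamma> t - \<gamma> (j * h)) \<le> h" "arrived (state a n)"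
    by blast
  obtain P where P: "P 0 = fold2 (fst (state a n))" "P h = fold2 (fst (state a (Suc n)))"
    "\<And>u. u \<in> {0..h} \<Longrightarrow> P u \<in> square - interior K"
    "\<And>u. u \<in> {0..h} \<Longrightarrow> norm (P u - P 0) \<le> u" "arrived (state a (Suc n))"
    "\<And>T. \<exists>w. billiard_path K T (T + h) (\<lambda>t. P (t - T)) w (VL (fst (state a (Suc n))) (snd (state a (Suc n)))) \<and>
        (arrived (state a n) \<longrightarrow> billiard_law K (fold2 (fst (state a n))) (VL (fst (state a n)) (snd (state a n))) w)"
    by (rule regular_step_path[OF state_regular[OF start, of n] state_valid[OF start, of n, THEN conjunct2]]) blast
  define \<delta> where "\<delta> t = (if t \<le> n * h then \<gamma> t else P (t - n * h))" for t
  have \<delta>1: "\<delta> t = \<gamma> t" if "t \<le> n * h" for t using that by (simp add: \<delta>_def)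
  have \<delta>2: "\<delta> t = P (t - n * h)" if "n * h \<le> t" for t
    using that g(2)[of n] P(1) by (cases "t = n * h") (auto simp: \<delta>_def)
  have Suc_eq: "real (Suc n) * h = n * h + h" by (simp add: algebra_simps)
  obtain w where w: "billiard_path K (n * h) (n * h + h) (\<lambda>t. P (t - n * h)) w (VL (fst (state a (Suc n))) (snd (state a (Suc n))))"
    and law: "billiard_law K (fold2 (fst (state a n))) (VL (fst (state a n)) (snd (state a n))) w"
    using P(6)[of "n * h"] g(5) by blast
  have b1: "billiard_path K 0 (n * h) \<delta> v0 (VL (fst (state a n)) (snd (state a n)))"
    by (rule billiard_path_cong[OF g(1)]) (simp add: \<delta>1)
  have b2: "billiard_path K (n * h) (Suc n * h) \<delta> w (VL (fst (state a (Suc n))) (snd (state a (Suc n))))"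
    unfolding Suc_eq by (rule billiard_path_cong[OF w]) (simp add: \<delta>2)
  have at_n: "\<delta> (n * h) = fold2 (fst (state a n))" using \<delta>1 g(2) by simp
  have path: "billiard_path K 0 (Suc n * h) \<delta> v0 (VL (fst (state a (Suc n))) (snd (state a (Suc n))))"
    by (rule billiard_path_join[OF b1 b2]) (use law at_n in simp)
  have grid: "\<delta> (j * h) = fold2 (fst (state a j))" if "j \<le> Suc n" for j
  proof (cases "j = Suc n")
    case True
    then show ?thesis using \<delta>2[of "Suc n * h"] P(2) h_pos Suc_eq by simp
  next
    case False
    then show ?thesis using g(2)[of j] \<delta>1[of "j * h"] that h_pos by simp
  qed
  have inside: "\<delta> t \<in> square - interior K" if "t \<in> {0..Suc n * h}" for t
  proof (cases "t \<le> n * h")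
    case True then show ?thesis using g(3)[of t] \<delta>1[of t] that by simp
  next
    case False then show ?thesis using P(3)[of "t - n * h"] \<delta>2[of t] that Suc_eq by simp
  qed
  have short: "norm (\<delta> t - \<delta> (j * h)) \<le> h" if j: "j < Suc n" and t: "t \<in> {j * h..Suc j * h}" for j t
  proof (cases "j = n")
    case True
    then show ?thesis
      using P(4)[of "t - n * h"] \<delta>2[of t] \<delta>2[of "n * h"] t Suc_eq by simp
  next
    case False
    then have "real (Suc j) * h \<le> n * h" using j h_pos by (intro mult_right_mono) auto
    with t have "t \<le> n * h" unfolding atLeastAtMost_iff by (blast intro: order_trans)
    moreover have "j * h \<le> n * h" using j h_pos by (intro mult_right_mono) auto
    ultimately show ?thesis using g(4)[of j t] \<delta>1[of t] \<delta>1[of "j * h"] t j False by simp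
  qed
  show ?case
    using path grid inside short P(5) by blast
qed

end

section \<open>Displacement along a time grid\<close>

text \<open>As long as \<open>z\<close> does not lie between the path and its last grid point, the principal argument of the
quotient of their positions relative to \<open>z\<close> is a continuous lift of the angle.\<close>

lemma has_displacement_grid:
  fixes \<eta> :: real and \<gamma> :: "real \<Rightarrow> complex"
  assumes eta: "0 < \<eta>" and cont: "continuous_on {0..n * \<eta>} \<gamma>"
    and seen: "\<And>j t. j < n \<Longrightarrow> t \<in> {j * \<eta>..Suc j * \<eta>} \<Longrightarrow>
       \<gamma> t \<noteq> z \<and> (\<gamma> t - z) / (\<gamma> (j * \<eta>) - z) \<notin> \<real>\<^sub>\<le>\<^sub>0"
    and z0: "\<gamma> 0 \<noteq> z"
  shows "has_displacement z (n * \<eta>) \<gamma> (\<Sum>j<n. Arg ((\<gamma> (Suc j * \<eta>) - z) / (\<gamma> (j * \<eta>) - z)) / (2 * pi))"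
  using cont seen
proof (induction n)
  case 0
  then show ?case
    unfolding has_displacement_def by (intro exI[of _ "\<lambda>_. phi z (\<gamma> 0)"]) auto
next
  case (Suc n)
  let ?a = "real n * \<eta>"
  have Suc_eq: "real (Suc n) * \<eta> = ?a + \<eta>" by (simp add: algebra_simps)
  have "has_displacement z ?a \<gamma> (\<Sum>j<n. Arg ((\<gamma> (Suc j * \<eta>) - z) / (\<gamma> (j * \<eta>) - z)) / (2 * pi))"
  proof (rule Suc.IH[OF continuous_on_subset[OF Suc.prems(1)]])
    show "{0..?a} \<subseteq> {0..real (Suc n) * \<eta>}" using eta by (auto simp: Suc_eq)
    show "\<gamma> t \<noteq> z \<and> (\<gamma> t - z) / (\<gamma> (j * \<eta>) - z) \<notin> \<real>\<^sub>\<le>\<^sub>0"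
      if "j < n" "t \<in> {j * \<eta>..Suc j * \<eta>}" for j t
      using Suc.prems(2)[of j t] that by simp
  qed
  then obtain \<theta> where th: "continuous_on {0..?a} \<theta>" "\<And>t. t \<in> {0..?a} \<Longrightarrow> \<theta> t - phi z (\<gamma> t) \<in> \<int>"
    "(\<Sum>j<n. Arg ((\<gamma> (Suc j * \<eta>) - z) / (\<gamma> (j * \<eta>) - z)) / (2 * pi)) = \<theta> ?a - \<theta> 0"
    unfolding has_displacement_def by blast
  define A where "A t = Arg ((\<gamma> t - z) / (\<gamma> ?a - z)) / (2 * pi)" for t
  define \<theta>' where "\<theta>' t = (if t \<le> ?a then \<theta> t else \<theta> ?a + A t)" for t
  have a0: "0 \<le> ?a" using eta by simp
  have s: "\<gamma> t \<noteq> z" "(\<gamma> t - z) / (\<gamma> ?a - z) \<notin> \<real>\<^sub>\<le>\<^sub>0" if "t \<in> {?a..?a + \<eta>}" for t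
    using Suc.prems(2)[of n t] that Suc_eq by auto
  have za: "\<gamma> ?a \<noteq> z" using s(1)[of ?a] eta by simp
  have Aa: "A ?a = 0" using za by (simp add: A_def)
  have contA: "continuous_on {?a..?a + \<eta>} A"
    unfolding A_def
  proof -
    have "{?a..?a + \<eta>} \<subseteq> {0..real (Suc n) * \<eta>}" unfolding Suc_eq using a0 by auto
    then have "continuous_on {?a..?a + \<eta>} \<gamma>" by (rule continuous_on_subset[OF Suc.prems(1)])
    then show "continuous_on {?a..?a + \<eta>} (\<lambda>t. Arg ((\<gamma> t - z) / (\<gamma> ?a - z)) / (2 * pi))"
      using s za by (intro continuous_intros continuous_on_Arg') auto
  qed
  have "continuous_on {0..?a + \<eta>} \<theta>'"
    unfolding \<theta>'_def
  proof (rule continuous_on_cases_1)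
    show "continuous_on {t \<in> {0..?a + \<eta>}. t \<le> ?a} \<theta>"
      by (rule continuous_on_subset[OF th(1)]) auto
    show "continuous_on {t \<in> {0..?a + \<eta>}. ?a \<le> t} (\<lambda>t. \<theta> ?a + A t)"
      by (intro continuous_intros continuous_on_subset[OF contA]) auto
  qed (simp add: Aa)
  moreover have "\<theta>' t - phi z (\<gamma> t) \<in> \<int>" if t: "t \<in> {0..?a + \<eta>}" for t
  proof (cases "t \<le> ?a")
    case True then show ?thesis using th(2) t by (simp add: \<theta>'_def)
  next
    case False
    have "phi z (\<gamma> ?a) + A t - phi z (\<gamma> t) \<in> \<int>"
      unfolding A_def using s(1)[of t] za t False by (intro phi_quotient_Ints) auto
    moreover have "\<theta> ?a - phi z (\<gamma> ?a) \<in> \<int>" using th(2) a0 by simp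
    ultimately have "(phi z (\<gamma> ?a) + A t - phi z (\<gamma> t)) + (\<theta> ?a - phi z (\<gamma> ?a)) \<in> \<int>"
      by (rule Ints_add)
    then show ?thesis using False by (simp add: \<theta>'_def algebra_simps)
  qed
  moreover have "\<theta>' (?a + \<eta>) - \<theta>' 0 = (\<Sum>j<Suc n. Arg ((\<gamma> (Suc j * \<eta>) - z) / (\<gamma> (j * \<eta>) - z)) / (2 * pi))"
    using th(3) a0 eta by (simp add: \<theta>'_def A_def algebra_simps)
  ultimately show ?case unfolding has_displacement_def Suc_eq by metis
qed

lemma has_displacement_unique:
  assumes T: "0 \<le> T" and d: "has_displacement z T \<gamma> d" and d': "has_displacement z T \<gamma> d'"
  shows "d = d'"
proof -
  obtain \<theta> where th: "continuous_on {0..T} \<theta>" "\<And>t. t \<in> {0..T} \<Longrightarrow> \<theta> t - phi z (\<gamma> t) \<in> \<int>" "d = \<theta> T - \<theta> 0"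
    using d unfolding has_displacement_def by blast
  obtain \<theta>' where th': "continuous_on {0..T} \<theta>'" "\<And>t. t \<in> {0..T} \<Longrightarrow> \<theta>' t - phi z (\<gamma> t) \<in> \<int>" "d' = \<theta>' T - \<theta>' 0"
    using d' unfolding has_displacement_def by blast
  define g where "g t = \<theta> t - \<theta>' t" for t
  have gI: "g t \<in> \<int>" if "t \<in> {0..T}" for t
    using Ints_diff[OF th(2)[OF that] th'(2)[OF that]] by (simp add: g_def)
  have gc: "continuous_on {0..T} g" unfolding g_def by (intro continuous_intros th th')
  define P where "P p q \<longleftrightarrow> (0 \<le> p \<and> q \<le> T \<longrightarrow> g p = g q)" for p q
  have "P 0 T"
  proof (rule Bolzano[OF T])
    show "P p q \<Longrightarrow> P q u \<Longrightarrow> p \<le> q \<Longrightarrow> q \<le> u \<Longrightarrow> P p u" for p q u by (simp add: P_def)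
    fix t0 assume "0 \<le> t0" "t0 \<le> T"
    then have t0: "t0 \<in> {0..T}" by simp
    have cg: "continuous (at t0 within {0..T}) g"
      using gc t0 by (simp add: continuous_on_eq_continuous_within)
    obtain e where e: "e > 0" "\<And>t. t \<in> {0..T} \<Longrightarrow> \<bar>t - t0\<bar> < e \<Longrightarrow> g t = g t0"
      using Ints_locally_constant[OF cg t0 gI] by blast
    have "P p q" if "p \<le> t0" "t0 \<le> q" "q - p < e" for p q
      unfolding P_def using e(2)[of p] e(2)[of q] that by auto
    then show "\<exists>d>0. \<forall>p q. p \<le> t0 \<and> t0 \<le> q \<and> q - p < d \<longrightarrow> P p q" using e(1) by blast
  qed
  then have "g 0 = g T" by (simp add: P_def)
  then show ?thesis using th(3) th'(3) by (simp add: g_def)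
qed

section \<open>The diamond orbit and all intermediate rates\<close>

text \<open>A point closer to \<open>y\<close> than \<open>z\<close> is cannot be hidden from \<open>y\<close> behind \<open>z\<close>.\<close>

lemma seen_from_near:
  fixes x y z :: complex
  assumes "norm (x - y) < norm (y - z)"
  shows "x \<noteq> z" "(x - z) / (y - z) \<notin> \<real>\<^sub>\<le>\<^sub>0"
proof -
  show xz: "x \<noteq> z" using assms by (auto simp: norm_minus_commute)
  have yz: "y \<noteq> z" using assms by auto
  show "(x - z) / (y - z) \<notin> \<real>\<^sub>\<le>\<^sub>0"
  proof
    assume "(x - z) / (y - z) \<in> \<real>\<^sub>\<le>\<^sub>0"
    then obtain c where c: "c > 0" "x - z = - c *\<^sub>R (y - z)"
      using divide_nonpos_Reals_iff[of "y - z" "x - z"] xz yz by auto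
    have "x - y = (x - z) - (y - z)" by simp
    also have "\<dots> = - (1 + c) *\<^sub>R (y - z)" unfolding c(2) by (simp add: algebra_simps)
    finally have "norm (x - y) = (1 + c) * norm (y - z)" using c(1) by simp
    moreover have "1 * norm (y - z) \<le> (1 + c) * norm (y - z)" using c(1) by (intro mult_right_mono) auto
    ultimately show False using assms by simp
  qed
qed

text \<open>The four edges of the inscribed diamond, starting at the midpoint of the bottom side, run through
counterclockwise for \<open>\<sigma> = 1\<close> and clockwise for \<open>\<sigma> = -1\<close>.\<close>

definition edge :: "real \<Rightarrow> nat \<Rightarrow> real \<Rightarrow> complex" where
  "edge \<sigma> r u = (if r = 0 then Complex (\<sigma> * (u / 2)) ((u - 1) / 2)
     else if r = 1 then Complex (\<sigma> * ((1 - u) / 2)) (u / 2)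
     else if r = 2 then Complex (\<sigma> * (- u / 2)) ((1 - u) / 2)
     else Complex (\<sigma> * ((u - 1) / 2)) (- u / 2))"

lemma fold1_minus: "fold1 (- x) = - fold1 x"
  using fold1_on_cell[of "cell x" x] fold1_on_cell[of "- cell x" "- x"] cell_bounds[of x] by auto

lemma diagonal_ray_on_edge:
  assumes \<sigma>: "\<sigma> = 1 \<or> \<sigma> = - 1" and u: "0 \<le> u" "u \<le> 1"
  shows "fold2 (Complex (\<sigma> * ((real k + u) / 2)) ((real k + u) / 2 - 1/2)) = edge \<sigma> (k mod 4) u"
proof -
  define q r where "q = int (k div 4)" and "r = k mod 4"
  have "real k = real (4 * (k div 4) + k mod 4)" by simp
  then have k: "real k = 4 * of_int q + real r"
    unfolding q_def r_def of_nat_add of_nat_mult by simp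
  have r: "r = 0 \<or> r = 1 \<or> r = 2 \<or> r = 3" unfolding r_def by presburger
  have s: "fold1 (\<sigma> * x) = \<sigma> * fold1 x" for x using \<sigma> fold1_minus by auto
  note c = fold1_on_cell[of "2 * q"] fold1_on_cell[of "2 * q + 1"] fold1_on_cell[of "2 * q + 2"]
  have f1: "fold1 ((real k + u) / 2) = (if r = 0 then u / 2 else if r = 1 then (1 - u) / 2
      else if r = 2 then - u / 2 else (u - 1) / 2)"
    using c[of "(real k + u) / 2"] k r u by (auto simp: field_simps)
  have f2: "fold1 ((real k + u) / 2 - 1/2) = (if r = 0 then (u - 1) / 2 else if r = 1 then u / 2
      else if r = 2 then (1 - u) / 2 else - u / 2)"
    using c[of "(real k + u) / 2 - 1/2"] k r u by (auto simp: field_simps)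
  show ?thesis
    unfolding fold2_def complex.sel s f1 f2 r_def[symmetric] edge_def by auto
qed

lemma edge_end: "r < 4 \<Longrightarrow> edge \<sigma> r 1 = edge \<sigma> (Suc r mod 4) 0"
proof -
  assume "r < 4"
  then consider "r = 0" | "r = 1" | "r = 2" | "r = 3" by linarith
  then show ?thesis by cases (auto simp: edge_def)
qed

lemma edge_l1:
  assumes "\<sigma> = 1 \<or> \<sigma> = - 1" "0 \<le> u" "u \<le> 1"
  shows "\<bar>Re (edge \<sigma> r u)\<bar> + \<bar>Im (edge \<sigma> r u)\<bar> = 1/2"
  using assms by (auto simp: edge_def abs_mult field_simps)

text \<open>Seen from inside the inscribed diamond, each edge turns in the sense of \<open>\<sigma>\<close> by less than \<open>\<pi>\<close>.\<close>

lemma edge_seen: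
  assumes \<sigma>: "\<sigma> = 1 \<or> \<sigma> = - 1" and z: "\<bar>Re z\<bar> + \<bar>Im z\<bar> < 1/2" and u: "0 < u" "u \<le> 1"
  shows "0 < \<sigma> * Im ((edge \<sigma> r u - z) / (edge \<sigma> r 0 - z))"
proof -
  have im: "Im ((edge \<sigma> r u - z) * cnj (edge \<sigma> r 0 - z)) =
     (if r = 0 then u * (\<sigma> * (1/4 + Im z / 2) - Re z / 2)
      else if r = 1 then u * (\<sigma> * (1/4 - Im z / 2) - Re z / 2)
      else if r = 2 then u * (\<sigma> * (1/4 - Im z / 2) + Re z / 2)
      else u * (\<sigma> * (1/4 + Im z / 2) + Re z / 2))"
    using \<sigma> by (auto simp: edge_def field_simps)
  have pos: "0 < \<sigma> * Im ((edge \<sigma> r u - z) * cnj (edge \<sigma> r 0 - z))"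
    unfolding im using \<sigma> z u by (auto simp: zero_less_mult_iff mult_less_0_iff abs_if split: if_splits)
  show ?thesis
    using pos \<sigma> Im_complex_div_gt_0[of "edge \<sigma> r u - z" "edge \<sigma> r 0 - z"]
      Im_complex_div_lt_0[of "edge \<sigma> r u - z" "edge \<sigma> r 0 - z"] by auto
qed

text \<open>The sum is an integer because the diamond closes up, it has the sign of \<open>\<sigma>\<close>, and it is less than
2 in absolute value because each edge contributes less than half a turn.\<close>

lemma edge_sum:
  assumes \<sigma>: "\<sigma> = 1 \<or> \<sigma> = - 1" and z: "\<bar>Re z\<bar> + \<bar>Im z\<bar> < 1/2"
  shows "(\<Sum>r<4. Arg ((edge \<sigma> r 1 - z) / (edge \<sigma> r 0 - z)) / (2 * pi)) = \<sigma>"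
proof -
  define A where "A r = Arg ((edge \<sigma> r 1 - z) / (edge \<sigma> r 0 - z)) / (2 * pi)" for r
  have nz: "edge \<sigma> r u \<noteq> z" if "0 \<le> u" "u \<le> 1" for r u
    using edge_l1[OF \<sigma> that, of r] z by auto
  have A: "0 < \<sigma> * A r \<and> \<sigma> * A r < 1/2" for r
  proof -
    define q where "q = (edge \<sigma> r 1 - z) / (edge \<sigma> r 0 - z)"
    have "0 < \<sigma> * Im q" using edge_seen[OF \<sigma> z, of 1 r] by (simp add: q_def)
    then have "0 < \<sigma> * Arg q \<and> \<sigma> * Arg q < pi"
      using \<sigma> Arg_lt_pi[of q] Arg_neg_iff[of q] mpi_less_Arg[of q] by auto
    moreover have "\<sigma> * A r = (\<sigma> * Arg q) / (2 * pi)" by (simp add: A_def q_def)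
    moreover have "0 < y / (2 * pi) \<and> y / (2 * pi) < 1/2" if "0 < y \<and> y < pi" for y :: real
      using that by (simp add: field_simps)
    ultimately show ?thesis by presburger
  qed
  have I: "phi z (edge \<sigma> r 0) + A r - phi z (edge \<sigma> r 1) \<in> \<int>" for r
    unfolding A_def using nz by (intro phi_quotient_Ints) auto
  have S: "(\<Sum>r<4. A r) = A 0 + A 1 + A 2 + A 3" by (simp add: eval_nat_numeral lessThan_Suc)
  have "(phi z (edge \<sigma> 0 0) + A 0 - phi z (edge \<sigma> 0 1)) + (phi z (edge \<sigma> 1 0) + A 1 - phi z (edge \<sigma> 1 1))
     + (phi z (edge \<sigma> 2 0) + A 2 - phi z (edge \<sigma> 2 1)) + (phi z (edge \<sigma> 3 0) + A 3 - phi z (edge \<sigma> 3 1)) \<in> \<int>"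
    by (intro Ints_add I)
  moreover have "edge \<sigma> 0 1 = edge \<sigma> 1 0" "edge \<sigma> 1 1 = edge \<sigma> 2 0" "edge \<sigma> 2 1 = edge \<sigma> 3 0" "edge \<sigma> 3 1 = edge \<sigma> 0 0"
    by (simp_all add: edge_def)
  ultimately have int: "(\<Sum>r<4. A r) \<in> \<int>" unfolding S by (simp add: algebra_simps)
  have "0 < \<sigma> * (\<Sum>r<4. A r)" "\<sigma> * (\<Sum>r<4. A r) < 2"
    unfolding S using A[of 0] A[of 1] A[of 2] A[of 3] by (auto simp: distrib_left)
  then have "\<bar>(\<Sum>r<4. A r) - \<sigma>\<bar> < 1" using \<sigma> by auto
  moreover have "\<sigma> \<in> \<int>" using \<sigma> by auto
  ultimately show ?thesis using Ints_eq_abs_less1[OF int, of \<sigma>] by (simp add: A_def)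
qed

lemma sum_periodic:
  fixes A :: "nat \<Rightarrow> real"
  shows "(\<Sum>k<4 * N. A (k mod 4)) = N * (\<Sum>r<4. A r)"
proof (induction N)
  case (Suc N)
  have e: "4 * Suc N = Suc (Suc (Suc (Suc (4 * N))))" by simp
  have m: "(4 * N) mod 4 = 0" "Suc (4 * N) mod 4 = 1" "Suc (Suc (4 * N)) mod 4 = 2"
    "Suc (Suc (Suc (4 * N))) mod 4 = 3" by presburger+
  have "(\<Sum>k<4 * Suc N. A (k mod 4)) = (\<Sum>k<4 * N. A (k mod 4)) + (A 0 + A 1 + A 2 + A 3)"
    unfolding e sum.lessThan_Suc m by (simp only: add.assoc)
  moreover have "(\<Sum>r<4. A r) = A 0 + A 1 + A 2 + A 3" by (simp add: eval_nat_numeral lessThan_Suc)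
  ultimately have "(\<Sum>k<4 * Suc N. A (k mod 4)) = (\<Sum>k<4 * N. A (k mod 4)) + (\<Sum>r<4. A r)" by simp
  then show ?case using Suc by (simp add: algebra_simps)
qed simp

definition diagonal :: "real \<Rightarrow> complex" where "diagonal \<sigma> = Complex (\<sigma> * (sqrt 2 / 2)) (sqrt 2 / 2)"

definition bottom :: complex where "bottom = Complex 0 (- 1/2)"

lemma norm_diagonal: "\<sigma> = 1 \<or> \<sigma> = - 1 \<Longrightarrow> norm (diagonal \<sigma>) = 1"
  by (auto simp: diagonal_def cmod_def power2_eq_square)

lemma diamond_on_edge:
  assumes \<sigma>: "\<sigma> = 1 \<or> \<sigma> = - 1" and u: "0 \<le> u" "u \<le> 1" and t: "t = (real k + u) * (sqrt 2 / 2)"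
  shows "fold2 (bottom + t *\<^sub>R diagonal \<sigma>) = edge \<sigma> (k mod 4) u"
proof -
  have "t * (sqrt 2 / 2) = (real k + u) / 2" by (simp add: t field_simps)
  then have "bottom + t *\<^sub>R diagonal \<sigma> = Complex (\<sigma> * ((real k + u) / 2)) ((real k + u) / 2 - 1/2)"
    by (simp add: bottom_def diagonal_def complex_eq_iff algebra_simps)
  then show ?thesis using diagonal_ray_on_edge[OF \<sigma> u] by simp
qed

lemma (in small_body) l1_small: "x \<in> K \<Longrightarrow> \<bar>Re x\<bar> + \<bar>Im x\<bar> < 1/2"
proof -
  assume "x \<in> K"
  then have "sqrt 2 * norm x < sqrt 2 * (sqrt 2 / 4)" using small by (intro mult_strict_left_mono) auto
  then show ?thesis using complex_abs_le_norm[of x] by simp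
qed

text \<open>The diamond is the circle of radius \<open>1/2\<close> in the \<open>\<ell>\<^sup>1\<close> norm and has distance \<open>sqrt 2 / 4\<close> from the
origin.\<close>

lemma (in small_body) diamond_avoids:
  assumes \<sigma>: "\<sigma> = 1 \<or> \<sigma> = - 1" and t: "0 \<le> t"
  shows "fold2 (bottom + t *\<^sub>R diagonal \<sigma>) \<notin> K"
proof -
  define y where "y = t * sqrt 2"
  define k where "k = nat \<lfloor>y\<rfloor>"
  define u where "u = y - real k"
  have y0: "0 \<le> y" using t by (simp add: y_def)
  have u: "0 \<le> u" "u \<le> 1" unfolding u_def k_def using y0 by linarith+
  have "t = (real k + u) * (sqrt 2 / 2)" by (simp add: u_def y_def)
  from diamond_on_edge[OF \<sigma> u this] edge_l1[OF \<sigma> u] show ?thesis using l1_small by fastforce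
qed

context unfolded
begin

lemma diamond_state:
  assumes \<sigma>: "\<sigma> = 1 \<or> \<sigma> = - 1"
  shows "state (bottom, diagonal \<sigma>) n = (bottom + (n * h) *\<^sub>R diagonal \<sigma>, diagonal \<sigma>)"
proof (induction n)
  case 0 then show ?case by (simp add: state_simps)
next
  case (Suc n)
  let ?V = "diagonal \<sigma>" and ?x = "bottom + (n * h) *\<^sub>R diagonal \<sigma>"
  have out: "bottom + t *\<^sub>R ?V \<notin> obstacles" if "0 \<le> t" for t
    using diamond_avoids[OF \<sigma> that] by (simp add: obstacles_def)
  have along: "?x + s *\<^sub>R ?V = bottom + (n * h + s) *\<^sub>R ?V" for s by (simp add: algebra_simps)
  have "bottom \<notin> interiors" using out[of 0] D_sub by auto
  then have "regular_step (state (bottom, ?V) n) (state (bottom, ?V) (Suc n))"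
    using norm_diagonal[OF \<sigma>] by (intro state_regular) auto
  then have "regular_step (?x, ?V) (state (bottom, ?V) (Suc n))" by (simp add: Suc)
  moreover have "\<not> bounce (?x, ?V) b s k" for b s k
  proof
    assume "bounce (?x, ?V) b s k"
    then have "0 \<le> s" "?x + s *\<^sub>R ?V \<in> obstacles" by (auto simp: bounce_def normal_def)
    then show False using out[of "n * h + s"] h_pos unfolding along by simp
  qed
  ultimately have "straight (?x, ?V) (state (bottom, ?V) (Suc n))" by (auto simp: regular_step_def)
  then show ?case by (simp add: straight_def algebra_simps)
qed

end

context small_body
begin

lemma diamond_displacement:
  assumes \<sigma>: "\<sigma> = 1 \<or> \<sigma> = - 1" and z: "z \<in> K"
  shows "has_displacement z (real (4 * N) * (sqrt 2 / 2)) (\<lambda>t. fold2 (bottom + t *\<^sub>R diagonal \<sigma>)) (N * \<sigma>)"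
proof -
  define \<gamma> where "\<gamma> t = fold2 (bottom + t *\<^sub>R diagonal \<sigma>)" for t
  define \<eta> where "\<eta> = sqrt 2 / 2"
  have \<eta>: "\<eta> > 0" by (simp add: \<eta>_def)
  have z1: "\<bar>Re z\<bar> + \<bar>Im z\<bar> < 1/2" using l1_small[OF z] .
  have at: "\<gamma> (real k * \<eta>) = edge \<sigma> (k mod 4) 0" for k
    using diamond_on_edge[OF \<sigma>, of 0 "real k * \<eta>" k] by (simp add: \<gamma>_def \<eta>_def)
  have on: "\<exists>u. 0 \<le> u \<and> u \<le> 1 \<and> \<gamma> t = edge \<sigma> (j mod 4) u" if "t \<in> {real j * \<eta>..real (Suc j) * \<eta>}" for j t
  proof -
    define u where "u = t / \<eta> - real j"
    have u: "0 \<le> u" "u \<le> 1" using that \<eta> by (auto simp: u_def field_simps)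
    have "t = (real j + u) * (sqrt 2 / 2)" using \<eta> by (simp add: u_def \<eta>_def)
    then show ?thesis using diamond_on_edge[OF \<sigma> u] u unfolding \<gamma>_def by blast
  qed
  have ne: "edge \<sigma> r u \<noteq> z" if "0 \<le> u" "u \<le> 1" for r u
    using edge_l1[OF \<sigma> that, of r] z1 by auto
  have "has_displacement z (real (4 * N) * \<eta>) \<gamma>
     (\<Sum>j<4 * N. Arg ((\<gamma> (Suc j * \<eta>) - z) / (\<gamma> (j * \<eta>) - z)) / (2 * pi))"
  proof (rule has_displacement_grid[OF \<eta>])
    show "continuous_on {0..real (4 * N) * \<eta>} \<gamma>"
      unfolding \<gamma>_def by (intro continuous_on_compose2[OF continuous_fold[of UNIV]] continuous_intros) auto
    show "\<gamma> 0 \<noteq> z" using at[of 0] ne[of 0] by simp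
    fix j t assume "t \<in> {real j * \<eta>..real (Suc j) * \<eta>}"
    then obtain u where u: "0 \<le> u" "u \<le> 1" "\<gamma> t = edge \<sigma> (j mod 4) u" using on by blast
    show "\<gamma> t \<noteq> z \<and> (\<gamma> t - z) / (\<gamma> (real j * \<eta>) - z) \<notin> \<real>\<^sub>\<le>\<^sub>0"
    proof (cases "u = 0")
      case True
      then show ?thesis using u(3) at[of j] ne[of 0 "j mod 4"] by simp
    next
      case False
      then have "0 < \<sigma> * Im ((\<gamma> t - z) / (\<gamma> (real j * \<eta>) - z))"
        using edge_seen[OF \<sigma> z1, of u "j mod 4"] u at[of j] by simp
      then show ?thesis using ne[OF u(1,2)] u(3) by (auto simp: complex_nonpos_Reals_iff)
    qed
  qed
  moreover have "(\<Sum>j<4 * N. Arg ((\<gamma> (Suc j * \<eta>) - z) / (\<gamma> (j * \<eta>) - z)) / (2 * pi)) = N * \<sigma>"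
  proof -
    have "\<gamma> (Suc j * \<eta>) = edge \<sigma> (j mod 4) 1" for j
      unfolding at edge_end[of "j mod 4" \<sigma>, simplified] by (simp add: mod_Suc_eq)
    then have "(\<Sum>j<4 * N. Arg ((\<gamma> (Suc j * \<eta>) - z) / (\<gamma> (j * \<eta>) - z)) / (2 * pi))
      = (\<Sum>j<4 * N. Arg ((edge \<sigma> (j mod 4) 1 - z) / (edge \<sigma> (j mod 4) 0 - z)) / (2 * pi))"
      unfolding at by simp
    also have "\<dots> = N * (\<Sum>r<4. Arg ((edge \<sigma> r 1 - z) / (edge \<sigma> r 0 - z)) / (2 * pi))"
      by (rule sum_periodic[of "\<lambda>r. Arg ((edge \<sigma> r 1 - z) / (edge \<sigma> r 0 - z)) / (2 * pi)" N])
    finally show ?thesis unfolding edge_sum[OF \<sigma> z1] .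
  qed
  ultimately show ?thesis by (simp add: \<gamma>_def[abs_def] \<eta>_def)
qed

text \<open>Turning the initial direction at the midpoint of the bottom side from one diagonal to the other,
  the displacement over a fixed time changes continuously between its two extreme values.\<close>

lemma every_rate_realized:
  assumes z: "z \<in> interior K" and N: "0 < N" and \<rho>: "\<bar>\<rho>\<bar> \<le> sqrt 2 / 4"
  defines "T \<equiv> 2 * sqrt 2 * real N"
  shows "\<exists>\<gamma>. trajectory_piece K T \<gamma> \<and> has_displacement z T \<gamma> (\<rho> * T)"
proof -
  have zK: "z \<in> K" using z interior_subset by blast
  obtain c where c: "c > 0" "ball z c \<subseteq> interior K" using z open_contains_ball[of "interior K"] by auto
  have far: "c \<le> norm (y - z)" if "y \<notin> interior K" for y
    using c(2) that by (force simp: subset_iff dist_norm norm_minus_commute not_less[symmetric])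
  \<comment> \<open>The step \<open>h\<close> divides the side of the diamond, is short enough for the unfolding, and is less than the
    distance from \<open>z\<close> to the table, so that the grid determines the displacement.\<close>
  define m where "m = min (1/10) (c/2)"
  have m: "m > 0" using c by (simp add: m_def)
  obtain M :: nat where M: "sqrt 2 / 2 / m < real M" using reals_Archimedean2 by blast
  have M0: "M > 0" using M m by (metis divide_pos_pos gr0I less_asym of_nat_0 real_sqrt_gt_0_iff zero_less_numeral)
  define h where "h = sqrt 2 / 2 / real M"
  have h: "0 < h" "h < m" using M M0 m by (auto simp: h_def field_simps)
  have hc: "h < c" and h10: "h \<le> 1/10" using h m c by (auto simp: m_def)
  interpret unfolded K h by unfold_locales (use h h10 in auto)
  define n where "n = 4 * N * M"
  have nh: "real n * h = T" "real (4 * N) * (sqrt 2 / 2) = T"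
    using M0 by (simp_all add: n_def h_def T_def)
  have n0: "0 < n" using N M0 by (simp add: n_def)
  have T0: "0 \<le> T" by (simp add: T_def)
  define f where "f s = (bottom, cis (pi * s))" for s
  have valid: "fst (f s) \<notin> interiors \<and> norm (snd (f s)) = 1" for s
    using diamond_avoids[of 1 0] D_sub by (auto simp: f_def obstacles_def)
  define P where "P j s = fold2 (fst (state (f s) j))" for j s
  have P_out: "P j s \<notin> interior K" for j s
    using state_valid[of "f s" j] valid[of s] by (simp add: P_def interiors_def)
  have P_close: "norm (P (Suc j) s - P j s) < norm (P j s - z)" for j s
  proof -
    have "step (state (f s) j) (state (f s) (Suc j))"
      using state_regular[of "f s" j] state_valid[of "f s" j] valid[of s] by (intro regular_step_step) auto
    then have "dist (fst (state (f s) j)) (fst (state (f s) (Suc j))) \<le> h" by (rule step_dist)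
    then have "norm (P (Suc j) s - P j s) \<le> h"
      using fold_lipschitz[of "fst (state (f s) (Suc j))" "fst (state (f s) j)"]
      by (simp add: P_def dist_norm norm_minus_commute)
    then show ?thesis using hc far[OF P_out, of j s] by linarith
  qed
  define d where "d s = (\<Sum>j<n. Arg ((P (Suc j) s - z) / (P j s - z)) / (2 * pi))" for s
  have cont: "continuous_on {1/4..3/4} d"
  proof -
    have "continuous_on {1/4..3/4} f" unfolding f_def by (intro continuous_intros)
    then have "continuous_on {1/4..3/4} (\<lambda>s. fst (state (f s) j))" for j
      by (rule continuous_on_position) (use valid in blast)
    then have "continuous_on {1/4..3/4} (P j)" for j
      unfolding P_def by (rule continuous_on_compose2[OF continuous_fold[of UNIV]]) auto
    moreover have "P j s \<noteq> z" "(P (Suc j) s - z) / (P j s - z) \<notin> \<real>\<^sub>\<le>\<^sub>0" for j s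
      using P_out[of j s] z seen_from_near[OF P_close] by auto
    ultimately show ?thesis
      unfolding d_def by (intro continuous_intros continuous_on_Arg') auto
  qed
  have displ: "has_displacement z T \<gamma> (d s)"
    if g: "continuous_on {0..T} \<gamma>" "\<And>j. j \<le> n \<Longrightarrow> \<gamma> (real j * h) = P j s"
      "\<And>j t. j < n \<Longrightarrow> t \<in> {real j * h..real (Suc j) * h} \<Longrightarrow> norm (\<gamma> t - \<gamma> (real j * h)) \<le> h" for \<gamma> s
  proof -
    have "has_displacement z (real n * h) \<gamma> (\<Sum>j<n. Arg ((\<gamma> (real (Suc j) * h) - z) / (\<gamma> (real j * h) - z)) / (2 * pi))"
    proof (rule has_displacement_grid[OF h(1)])
      show "continuous_on {0..real n * h} \<gamma>" using g(1) nh by simp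
      show "\<gamma> 0 \<noteq> z" using g(2)[of 0] P_out[of 0 s] z by auto
      show "\<gamma> t \<noteq> z \<and> (\<gamma> t - z) / (\<gamma> (real j * h) - z) \<notin> \<real>\<^sub>\<le>\<^sub>0"
        if "j < n" "t \<in> {real j * h..real (Suc j) * h}" for j t
        using g(3)[OF that] g(2)[of j] that far[OF P_out, of j s] hc
          seen_from_near[of "\<gamma> t" "\<gamma> (real j * h)" z] by auto
    qed
    also have "(\<Sum>j<n. Arg ((\<gamma> (real (Suc j) * h) - z) / (\<gamma> (real j * h) - z)) / (2 * pi)) = d s"
      unfolding d_def by (rule sum.cong[OF refl]) (simp only: g(2) lessThan_iff less_imp_le Suc_le_eq)
    finally show ?thesis using nh by simp
  qed
  have ends: "d s = N * \<sigma>" if \<sigma>: "\<sigma> = 1 \<or> \<sigma> = - 1" and s: "cis (pi * s) = diagonal \<sigma>" for s \<sigma> :: real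
  proof (rule has_displacement_unique[OF T0])
    define \<gamma> where "\<gamma> t = fold2 (bottom + t *\<^sub>R diagonal \<sigma>)" for t
    show "has_displacement z T \<gamma> (N * \<sigma>)"
      using diamond_displacement[OF \<sigma> zK, of N] unfolding nh \<gamma>_def .
    show "has_displacement z T \<gamma> (d s)"
    proof (rule displ)
      show "continuous_on {0..T} \<gamma>"
        unfolding \<gamma>_def by (intro continuous_on_compose2[OF continuous_fold[of UNIV]] continuous_intros) auto
      show "\<gamma> (real j * h) = P j s" for j
        using diamond_state[OF \<sigma>, of j] by (simp add: P_def f_def s \<gamma>_def)
      show "norm (\<gamma> t - \<gamma> (real j * h)) \<le> h" if "t \<in> {real j * h..real (Suc j) * h}" for j t
      proof -
        have "norm (\<gamma> t - \<gamma> (real j * h)) \<le> norm ((t - real j * h) *\<^sub>R diagonal \<sigma>)"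
          unfolding \<gamma>_def using fold_lipschitz[of "bottom + t *\<^sub>R diagonal \<sigma>" "bottom + (real j * h) *\<^sub>R diagonal \<sigma>"]
          by (simp add: scaleR_left_diff_distrib)
        also have "\<dots> = \<bar>t - real j * h\<bar>" by (simp add: norm_diagonal[OF \<sigma>])
        also have "\<dots> \<le> h" using that by (simp add: distrib_right)
        finally show ?thesis .
      qed
    qed
  qed
  have "cis (pi * (1/4)) = diagonal 1"
    by (simp add: diagonal_def complex_eq_iff cos_45 sin_45)
  from ends[OF _ this] have d1: "d (1/4) = N" by simp
  have "cis (pi * (3/4)) = diagonal (- 1)"
  proof -
    have "pi * (3/4) = pi - pi / 4" by simp
    then show ?thesis unfolding diagonal_def complex_eq_iff by (simp only: cis.sel cos_pi_minus sin_pi_minus) (simp add: cos_45 sin_45)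
  qed
  from ends[OF _ this] have d3: "d (3/4) = - N" by simp
  have "\<bar>\<rho> * T\<bar> \<le> (sqrt 2 / 4) * T"
    by (simp only: abs_mult abs_of_nonneg[OF T0] mult_right_mono[OF \<rho> T0])
  also have "\<dots> = N" by (simp add: T_def)
  finally have "d (3/4) \<le> \<rho> * T" "\<rho> * T \<le> d (1/4)" using d1 d3 by auto
  from IVT2'[OF this _ cont] obtain s where s: "d s = \<rho> * T" by auto
  obtain \<gamma> v0 where g: "billiard_path K 0 (n * h) \<gamma> v0 (VL (fst (state (f s) n)) (snd (state (f s) n)))"
     "\<And>j. j \<le> n \<Longrightarrow> \<gamma> (j * h) = fold2 (fst (state (f s) j))"
     "\<And>t. t \<in> {0..n * h} \<Longrightarrow> \<gamma> t \<in> square - interior K"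
     "\<And>j t. j < n \<Longrightarrow> t \<in> {j * h..Suc j * h} \<Longrightarrow> norm (\<gamma> t - \<gamma> (j * h)) \<le> h"
    using path_through_states[OF _ _ n0, of "f s"] valid[of s] by blast
  have tr: "trajectory_piece K T \<gamma>"
    by (rule billiard_path_trajectory) (use g(1,3) nh in auto)
  moreover have "has_displacement z T \<gamma> (d s)"
    by (rule displ[OF trajectory_piece_continuous[OF tr]]) (use g(2,4) in \<open>auto simp: P_def\<close>)
  ultimately show ?thesis using s by auto
qed

end

theorem theorem6p9:
  fixes K :: "complex set" and z :: complex
  assumes "obstacle K" and "small K" and "z \<in> interior K"
  shows "rotation_set K z = {- (sqrt 2 / 4)..sqrt 2 / 4}"
proof (intro equalityI subsetI)
  interpret small_body K using assms by (intro small_body_obstacle)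
  fix \<rho>
  {
    assume "\<rho> \<in> rotation_set K z"
    then obtain T \<gamma> d where tr: "\<And>n::nat. trajectory_piece K (T n) (\<gamma> n)"
      and disp: "\<And>n. has_displacement z (T n) (\<gamma> n) (d n)"
      and T: "filterlim T at_top sequentially" and lim: "(\<lambda>n. d n / T n) \<longlonglongrightarrow> \<rho>"
      unfolding rotation_set_def by blast
    have lim_abs: "(\<lambda>n. \<bar>d n / T n\<bar>) \<longlonglongrightarrow> \<bar>\<rho>\<bar>" using lim by (rule tendsto_rabs)
    have "((\<lambda>n. sqrt 2 / 4 + 4 / T n) \<longlongrightarrow> sqrt 2 / 4 + 0) sequentially"
      by (intro tendsto_intros real_tendsto_divide_at_top[OF tendsto_const T])
    moreover have "\<forall>\<^sub>F n in sequentially. \<bar>d n / T n\<bar> \<le> sqrt 2 / 4 + 4 / T n"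
    proof -
      have "\<forall>\<^sub>F n in sequentially. T n > 0" using T by (rule filterlim_at_top_dense[THEN iffD1, rule_format])
      then show ?thesis
      proof eventually_elim
        case (elim n)
        have "\<bar>d n\<bar> \<le> sqrt 2 / 4 * T n + 4"
          using displacement_bound[OF tr assms(3) _ disp] elim by simp
        then have "\<bar>d n\<bar> / T n \<le> (sqrt 2 / 4 * T n + 4) / T n" using elim by (intro divide_right_mono) auto
        then show ?case using elim by (simp add: abs_divide add_divide_distrib)
      qed
    qed
    ultimately have "\<bar>\<rho>\<bar> \<le> sqrt 2 / 4 + 0"
      using tendsto_le[OF sequentially_bot _ lim_abs] by blast
    then show "\<rho> \<in> {- (sqrt 2 / 4)..sqrt 2 / 4}" by auto
  next
    assume "\<rho> \<in> {- (sqrt 2 / 4)..sqrt 2 / 4}"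
    then have \<rho>: "\<bar>\<rho>\<bar> \<le> sqrt 2 / 4" by auto
    define T where "T n = 2 * sqrt 2 * real (Suc n)" for n
    have "\<exists>\<gamma>. trajectory_piece K (T n) \<gamma> \<and> has_displacement z (T n) \<gamma> (\<rho> * T n)" for n
      unfolding T_def by (rule every_rate_realized[OF assms(3) _ \<rho>]) simp
    then obtain \<gamma> where g: "\<And>n. trajectory_piece K (T n) (\<gamma> n) \<and> has_displacement z (T n) (\<gamma> n) (\<rho> * T n)"
      by metis
    have "filterlim (\<lambda>n. real (Suc n)) at_top sequentially"
      using filterlim_real_sequentially filterlim_sequentially_Suc by blast
    then have "filterlim T at_top sequentially"
      unfolding T_def by (intro filterlim_tendsto_pos_mult_at_top[OF tendsto_const]) auto
    moreover have "(\<lambda>n. \<rho> * T n / T n) \<longlonglongrightarrow> \<rho>"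
      by (simp add: T_def)
    ultimately show "\<rho> \<in> rotation_set K z"
      unfolding rotation_set_def mem_Collect_eq using g
      by (intro exI[of _ T] exI[of _ \<gamma>] exI[of _ "\<lambda>n. \<rho> * T n"] conjI) simp_all
  }
qed

end
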